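(* Let $N\ge 3$. Let $V:(0,+\infty)\to[0,+\infty)$ and $K:(0,+\infty)\to(0,+\infty)$ be continuous, and assume that there is $C>0$ such that $V(r)\le C/r^2$ for all $r\in(0,1)$. Let $q_1,q_2>1$ be such that $\mathcal{S}_0(q_1,R_1)<\infty$ and $\mathcal{S}_\infty(q_2,R_2)<\infty$ for some $R_1,R_2>0$. Let $g:\mathbb{R}\to\mathbb{R}$ be continuous, put $G(t)=\int_0^t g(s)\,ds$, and assume: (i) there exists $\theta>2$ such that $0\le 2\theta G(t)\le g(t)t$ for all $t\in\mathbb{R}$; (ii) there exists $t_0>0$ such that $G(t_0)>0$; (iii) there exists a constant $C>0$ such that $|g(t)|\le C\min\{|t|^{q_1-1},|t|^{q_2-1}\}$ for all $t\in\mathbb{R}$. Let $u\in E$ be a critical point of the functional $I:E\to\mathbb{R}$, $$I(u)=\frac12\int_{\mathbb{R}^N}|\nabla u|^2dx+\frac12\int_{\mathbb{R}^N}V(|x|)f(u)^2dx-\int_{\mathbb{R}^N}K(|x|)G(f(u))\,dx,$$ and set $w=f(u)$. Then $w\in X$ and, for all $h\in C^\infty_{c,r}(\mathbb{R}^N)$, $$\int_{\mathbb{R}^N}(1+2w^2)\nabla w\cdot\nabla h\,dx+\int_{\mathbb{R}^N}2w|\nabla w|^2h\,dx+\int_{\mathbb{R}^N}V(|x|)wh\,dx=\int_{\mathbb{R}^N}K(|x|)g(w)h\,dx.$$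
   Context: $f\in C^\infty(\mathbb{R},\mathbb{R})$ denotes the unique solution of the Cauchy problem $f'(t)=\frac{1}{\sqrt{1+2f(t)^2}}$ for $t\in\mathbb{R}$, $f(0)=0$. $C^\infty_{c,r}(\mathbb{R}^N)$ is the space of radial $C^\infty$ real functions with compact support in $\mathbb{R}^N$, and $D^{1,2}_r(\mathbb{R}^N)$ is its closure with respect to the norm $\|u\|_{1,2}=\left(\int_{\mathbb{R}^N}|\nabla u|^2dx\right)^{1/2}$. $X=\{u\in D^{1,2}_r(\mathbb{R}^N):\int_{\mathbb{R}^N}V(|x|)|u|^2dx<+\infty\}$. $E=\{u\in D^{1,2}_r(\mathbb{R}^N): \int_{\mathbb{R}^N}V(|x|)f(u)^2dx<+\infty\}$, endowed with the norm $\|u\|=\|u\|_{1,2}+\|u\|_o$, where $\|u\|_o=\inf_{k>0}\frac1k\left[1+\int_{\mathbb{R}^N}V(|x|)f(ku)^2dx\right]$; it is a Banach space. A critical point of $I$ is $u\in E$ with $I'(u)=0$ in the dual space $E'$, where $I'$ is the Fréchet differential. $B_R=\{x\in\mathbb{R}^N:|x|<R\}$. For $R>0$ and $q>1$, $\mathcal{S}_0(q,R)=\sup_{u\in E,\,\|u\|=1}\int_{B_R}K(|x|)|u|^q\,dx$ and $\mathcal{S}_\infty(q,R)=\sup_{u\in E,\,\|u\|=1}\int_{\mathbb{R}^N\setminus B_R}K(|x|)|u|^q\,dx$ (values in $[0,+\infty]$). *)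

theory Defs
  imports "HOL-Analysis.Analysis"
begin

text \<open>The change of variables. A differentiable solution of this Cauchy problem exists on the
  whole line, is unique, and is automatically smooth.\<close>

definition dual_f :: "real \<Rightarrow> real" where
  "dual_f = (THE f. f 0 = 0 \<and>
     (\<forall>t. (f has_real_derivative 1 / sqrt (1 + 2 * (f t)\<^sup>2)) (at t)))"

text \<open>All directional derivatives up to order \<open>k\<close> exist and are continuous; in finite
  dimension this is the usual class of \<open>k\<close> times continuously differentiable functions.\<close>

primrec C_k :: "nat \<Rightarrow> ('a::euclidean_space \<Rightarrow> real) \<Rightarrow> bool" where
  "C_k 0 h \<longleftrightarrow> continuous_on UNIV h"
| "C_k (Suc k) h \<longleftrightarrow> (\<forall>x. h differentiable (at x)) \<and>
     (\<forall>v. C_k k (\<lambda>x. frechet_derivative h (at x) v))"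

definition Cc_inf :: "(real ^ 'n \<Rightarrow> real) set" where
  "Cc_inf = {h. (\<forall>k. C_k k h) \<and> compact (closure {x. h x \<noteq> 0})}"

definition radial :: "(real ^ 'n \<Rightarrow> real) \<Rightarrow> bool" where
  "radial h \<longleftrightarrow> (\<forall>x y. norm x = norm y \<longrightarrow> h x = h y)"

definition Cc_inf_rad :: "(real ^ 'n \<Rightarrow> real) set" where
  "Cc_inf_rad = {h \<in> Cc_inf. radial h}"

definition grad :: "(real ^ 'n \<Rightarrow> real) \<Rightarrow> real ^ 'n \<Rightarrow> real ^ 'n" where
  "grad h x = (\<chi> i. frechet_derivative h (at x) (axis i 1))"

text \<open>Elements of the Lebesgue and Sobolev spaces below are represented by measurable functions,
  not by classes modulo equality almost everywhere; all norms and functionals only depend on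
  the class.\<close>

definition has_weak_gradient ::
  "(real ^ 'n \<Rightarrow> real) \<Rightarrow> (real ^ 'n \<Rightarrow> real ^ 'n) \<Rightarrow> bool" where
  "has_weak_gradient u U \<longleftrightarrow>
     (\<forall>S. compact S \<longrightarrow> set_integrable lebesgue S u \<and> set_integrable lebesgue S U) \<and>
     (\<forall>\<phi>\<in>Cc_inf. (LINT x|lebesgue. u x *\<^sub>R grad \<phi> x) = - (LINT x|lebesgue. \<phi> x *\<^sub>R U x))"

text \<open>Two weak gradients of the same function agree almost everywhere, so the choice made here
  does not influence any integral.\<close>

definition wgrad :: "(real ^ 'n \<Rightarrow> real) \<Rightarrow> real ^ 'n \<Rightarrow> real ^ 'n" where
  "wgrad u = (SOME U. has_weak_gradient u U)"

definition norm12 :: "(real ^ 'n \<Rightarrow> real) \<Rightarrow> real" where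
  "norm12 u = sqrt (LINT x|lebesgue. (norm (wgrad u x))\<^sup>2)"

text \<open>The ambient space in which the closure of the radial test functions is taken: functions in
  \<open>L\<^sup>p\<close> with the critical Sobolev exponent \<open>p = 2 N / (N - 2)\<close>, \<open>N \<ge> 3\<close>, and a square
  integrable weak gradient. It is complete for \<^const>\<open>norm12\<close>, which is a norm on it.\<close>

definition D12 :: "(real ^ 'n \<Rightarrow> real) set" where
  "D12 = {u. u \<in> borel_measurable lebesgue \<and>
     integrable lebesgue (\<lambda>x. \<bar>u x\<bar> powr (2 * real CARD('n) / (real CARD('n) - 2))) \<and>
     (\<exists>U. has_weak_gradient u U \<and> integrable lebesgue (\<lambda>x. (norm (U x))\<^sup>2))}"

definition D12_rad :: "(real ^ 'n \<Rightarrow> real) set" where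
  "D12_rad = {u \<in> D12. \<forall>e>0. \<exists>\<phi>\<in>Cc_inf_rad. norm12 (\<lambda>x. u x - \<phi> x) < e}"

definition X_space :: "(real \<Rightarrow> real) \<Rightarrow> (real ^ 'n \<Rightarrow> real) set" where
  "X_space V = {u \<in> D12_rad. integrable lebesgue (\<lambda>x. V (norm x) * (u x)\<^sup>2)}"

definition E_space :: "(real \<Rightarrow> real) \<Rightarrow> (real ^ 'n \<Rightarrow> real) set" where
  "E_space V = {u \<in> D12_rad. integrable lebesgue (\<lambda>x. V (norm x) * (dual_f (u x))\<^sup>2)}"

text \<open>For \<open>u\<close> in \<open>E_space V\<close> every integral in the infimum is finite, because
  \<open>(dual_f (k t))\<^sup>2 \<le> max 1 (k\<^sup>2) * (dual_f t)\<^sup>2\<close>.\<close>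

definition norm_o :: "(real \<Rightarrow> real) \<Rightarrow> (real ^ 'n \<Rightarrow> real) \<Rightarrow> real" where
  "norm_o V u =
     (INF k\<in>{0<..}. 1 / k * (1 + (LINT x|lebesgue. V (norm x) * (dual_f (k * u x))\<^sup>2)))"

definition norm_E :: "(real \<Rightarrow> real) \<Rightarrow> (real ^ 'n \<Rightarrow> real) \<Rightarrow> real" where
  "norm_E V u = norm12 u + norm_o V u"

text \<open>The argument of type \<open>'n itself\<close> only records the dimension.\<close>

definition S_zero ::
  "'n::finite itself \<Rightarrow> (real \<Rightarrow> real) \<Rightarrow> (real \<Rightarrow> real) \<Rightarrow> real \<Rightarrow> real \<Rightarrow> ennreal" where
  "S_zero _ V K q R =
     (SUP u\<in>{u \<in> (E_space V :: (real ^ 'n \<Rightarrow> real) set). norm_E V u = 1}.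
        \<integral>\<^sup>+x\<in>ball 0 R. ennreal (K (norm x) * \<bar>u x\<bar> powr q) \<partial>lebesgue)"

definition S_inf ::
  "'n::finite itself \<Rightarrow> (real \<Rightarrow> real) \<Rightarrow> (real \<Rightarrow> real) \<Rightarrow> real \<Rightarrow> real \<Rightarrow> ennreal" where
  "S_inf _ V K q R =
     (SUP u\<in>{u \<in> (E_space V :: (real ^ 'n \<Rightarrow> real) set). norm_E V u = 1}.
        \<integral>\<^sup>+x\<in>- ball 0 R. ennreal (K (norm x) * \<bar>u x\<bar> powr q) \<partial>lebesgue)"

text \<open>Frechet differentiability at \<open>u\<close> of a functional on a normed space of functions that is
  given by a carrier \<open>E\<close> and a norm \<open>nrm\<close>; \<open>L\<close> is the differential, an element of the dual.\<close>

definition has_frechet_differential ::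
  "('a \<Rightarrow> real) set \<Rightarrow> (('a \<Rightarrow> real) \<Rightarrow> real) \<Rightarrow> (('a \<Rightarrow> real) \<Rightarrow> real) \<Rightarrow> ('a \<Rightarrow> real) \<Rightarrow>
   (('a \<Rightarrow> real) \<Rightarrow> real) \<Rightarrow> bool" where
  "has_frechet_differential E nrm J u L \<longleftrightarrow>
     (\<forall>v\<in>E. \<forall>w\<in>E. L (\<lambda>x. v x + w x) = L v + L w) \<and>
     (\<forall>c. \<forall>v\<in>E. L (\<lambda>x. c * v x) = c * L v) \<and>
     (\<exists>B. \<forall>v\<in>E. \<bar>L v\<bar> \<le> B * nrm v) \<and>
     (\<forall>e>0. \<exists>d>0. \<forall>v\<in>E. nrm v < d \<longrightarrow>
        \<bar>J (\<lambda>x. u x + v x) - J u - L v\<bar> \<le> e * nrm v)"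

definition critical_point ::
  "('a \<Rightarrow> real) set \<Rightarrow> (('a \<Rightarrow> real) \<Rightarrow> real) \<Rightarrow> (('a \<Rightarrow> real) \<Rightarrow> real) \<Rightarrow> ('a \<Rightarrow> real) \<Rightarrow> bool" where
  "critical_point E nrm J u \<longleftrightarrow> u \<in> E \<and> has_frechet_differential E nrm J u (\<lambda>_. 0)"

definition functional_I ::
  "(real \<Rightarrow> real) \<Rightarrow> (real \<Rightarrow> real) \<Rightarrow> (real \<Rightarrow> real) \<Rightarrow> (real ^ 'n \<Rightarrow> real) \<Rightarrow> real" where
  "functional_I V K G u =
     1 / 2 * (LINT x|lebesgue. (norm (wgrad u x))\<^sup>2)
     + 1 / 2 * (LINT x|lebesgue. V (norm x) * (dual_f (u x))\<^sup>2)
     - (LINT x|lebesgue. K (norm x) * G (dual_f (u x)))"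

end

theory Submission
  imports Defs "HOL-Real_Asymp.Real_Asymp"
begin

text \<open>Write \<open>w = f(u)\<close>. Formally \<open>\<nabla>u = sqrt (1 + 2 w\<^sup>2) \<nabla>w\<close>, and the differential of the functional in the
  direction \<open>v = h / f'(u) = h sqrt (1 + 2 w\<^sup>2)\<close> is exactly the difference of the two sides of the
  claimed equation: the factor \<open>f'(u)\<close> produced by the chain rule in the two lower order terms cancels
  against \<open>v\<close>, and \<open>\<nabla>u \<bullet> \<nabla>v = (1 + 2 w\<^sup>2) \<nabla>w \<bullet> \<nabla>h + 2 w |\<nabla>w|\<^sup>2 h\<close>. So the theorem says that the differential
  vanishes in this one direction. Two things have to be justified: that \<open>v\<close>, which is unbounded in
  general, is an admissible direction, and that the functional can be differentiated along
  \<open>u + t v\<close> with the expected result.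

  Admissibility is a chain rule for elements of \<^const>\<open>D12_rad\<close>, which are given by test
  functions \<open>\<phi>\<^sub>n\<close> with \<open>\<nabla>\<phi>\<^sub>n \<rightarrow> \<nabla>u\<close> in \<open>L\<^sup>2\<close> only. A Hardy inequality, obtained by integrating the
  divergence of \<open>h\<^sup>2 x / (\<epsilon> + |x|\<^sup>2)\<close>, shows that such a sequence converges almost everywhere and
  locally in \<open>L\<^sup>2\<close> (\<open>Hardy_inequality\<close>, \<open>test_functions_converge\<close>). That the limit is \<open>u\<close> itself
  is the place where the integrability of the critical power of \<open>|u|\<close> enters: for a test function \<open>\<eta>\<close> the
  number \<open>\<integral> v \<eta>\<close> is controlled by \<open>\<nabla>v\<close>, because dilating \<open>\<eta>\<close> makes the integral decay and
  the derivative with respect to the dilation is a divergence (\<open>test_integral_le_gradient\<close>).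
  Now \<open>\<zeta> H(\<phi>\<^sub>n)\<close> approximates \<open>\<zeta> H(u)\<close> for every smooth \<open>H\<close> with bounded derivative
  (\<open>D12_rad_chain_rule\<close>). It applies to \<open>w\<close> and to \<open>v\<close>.

  The terms with \<open>V\<close> and \<open>K\<close> are differentiated by dominated convergence. For \<open>V\<close> this rests on
  \<open>\<bar>f(a)\<^sup>2 - f(b)\<^sup>2\<bar> \<le> 2 \<bar>a - b\<bar>\<close> and on \<open>V(|x|) \<le> C / |x|\<^sup>2\<close>, which is locally integrable in dimension
  at least three. For \<open>K\<close> the growth condition on \<open>g\<close> leads to powers \<open>q1\<close> and \<open>q2\<close> of \<open>|w| + |v|\<close>. By
  homogeneity of the norm the two suprema bound these powers inside \<open>B_R1\<close> and outside \<open>B_R2\<close>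
  (\<open>S_finite_imp_integrable\<close>). If a shell remains between the two radii, it is moved into \<open>B_R1\<close> by
  a dilation: a cut off and dilated copy of \<open>sqrt (1 + 2 f(u)\<^sup>2)\<close> is again in the energy space, and
  \<open>K\<close> is bounded below on the image of the shell (\<open>shell_integrable\<close>).\<close>

section \<open>Calculus of smooth functions\<close>

abbreviation smooth :: "('a::euclidean_space \<Rightarrow> real) \<Rightarrow> bool" where
  "smooth h \<equiv> \<forall>k. C_k k h"

lemma C_k_SucI:
  fixes h :: "'a::euclidean_space \<Rightarrow> real"
  assumes "\<And>x. (h has_derivative h' x) (at x)" "\<And>v. C_k k (\<lambda>x. h' x v)"
  shows "C_k (Suc k) h"
proof -
  have "frechet_derivative h (at x) = h' x" for x
    using assms(1)[of x] by (metis frechet_derivative_at)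
  then show ?thesis
    using assms by (auto simp: differentiable_def)
qed

lemma C_k_SucD:
  assumes "C_k (Suc k) h"
  shows "(h has_derivative frechet_derivative h (at x)) (at x)"
    and "C_k k (\<lambda>x. frechet_derivative h (at x) v)"
  using assms by (auto simp: frechet_derivative_works)

lemma C_k_Suc_imp_C_k: "C_k (Suc k) h \<Longrightarrow> C_k k h"
proof (induction k arbitrary: h)
  case 0
  then have "\<And>x. h differentiable (at x)" by simp
  then have "\<And>x. isCont h x" by (rule differentiable_imp_continuous_within)
  then show ?case by (simp add: continuous_at_imp_continuous_on)
next
  case (Suc k)
  show ?case
    by (rule C_k_SucI[where h'="\<lambda>x. frechet_derivative h (at x)"])
       (rule C_k_SucD(1)[OF Suc.prems], rule Suc.IH[OF C_k_SucD(2)[OF Suc.prems]])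
qed

lemma C_k_const [simp]: "C_k k (\<lambda>x. c)"
proof (induction k arbitrary: c)
  case (Suc k)
  show ?case by (rule C_k_SucI[where h'="\<lambda>_ _. 0"]) (auto intro: Suc)
qed auto

lemma C_k_add: "C_k k g \<Longrightarrow> C_k k h \<Longrightarrow> C_k k (\<lambda>x. g x + h x)"
proof (induction k arbitrary: g h)
  case 0 then show ?case by (auto intro: continuous_intros)
next
  case (Suc k)
  show ?case
    by (rule C_k_SucI, rule has_derivative_add[OF C_k_SucD(1)[OF Suc.prems(1)] C_k_SucD(1)[OF Suc.prems(2)]])
       (intro Suc.IH C_k_SucD(2) Suc.prems)
qed

lemma C_k_mult: "C_k k g \<Longrightarrow> C_k k h \<Longrightarrow> C_k k (\<lambda>x. g x * h x)"
proof (induction k arbitrary: g h)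
  case 0 then show ?case by (auto intro: continuous_intros)
next
  case (Suc k)
  show ?case
    by (rule C_k_SucI, rule has_derivative_mult[OF C_k_SucD(1)[OF Suc.prems(1)] C_k_SucD(1)[OF Suc.prems(2)]])
       (rule C_k_add; rule Suc.IH;
        rule C_k_SucD(2)[OF Suc.prems(1)] C_k_SucD(2)[OF Suc.prems(2)]
          C_k_Suc_imp_C_k[OF Suc.prems(1)] C_k_Suc_imp_C_k[OF Suc.prems(2)])
qed

lemma C_k_bounded_linear:
  assumes "bounded_linear L" shows "C_k k L"
proof (cases k)
  case 0
  then show ?thesis using assms by (simp add: linear_continuous_on)
next
  case (Suc j)
  show ?thesis unfolding Suc
    by (rule C_k_SucI[where h'="\<lambda>_. L"]) (auto intro: bounded_linear_imp_has_derivative assms)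
qed

lemma C_k_diff: "C_k k g \<Longrightarrow> C_k k h \<Longrightarrow> C_k k (\<lambda>x. g x - h x)"
  using C_k_add[of k g "\<lambda>x. (-1) * h x"] C_k_mult[of k "\<lambda>_. -1" h] by simp

lemma C_k_power: "C_k k g \<Longrightarrow> C_k k (\<lambda>x. g x ^ n)"
  by (induction n) (auto intro: C_k_mult)

lemma C_k_sum: "(\<And>i. i \<in> I \<Longrightarrow> C_k k (g i)) \<Longrightarrow> C_k k (\<lambda>x. \<Sum>i\<in>I. g i x)"
  by (induction I rule: infinite_finite_induct) (auto intro: C_k_add)

lemma C_k_prod: "(\<And>i. i \<in> I \<Longrightarrow> C_k k (g i)) \<Longrightarrow> C_k k (\<lambda>x. \<Prod>i\<in>I. g i x)"
  by (induction I rule: infinite_finite_induct) (auto intro: C_k_mult)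

text \<open>The chain rule gives \<open>(\<phi> \<circ> h)' v = (\<phi>' \<circ> h) * h' v\<close>, so one order of
  differentiability is passed from the composition to the pair of factors.\<close>

lemma C_k_compose:
  fixes \<phi> :: "real \<Rightarrow> real"
  shows "C_k k \<phi> \<Longrightarrow> C_k k h \<Longrightarrow> C_k k (\<lambda>x. \<phi> (h x))"
proof (induction k arbitrary: \<phi> h)
  case 0 then show ?case by (auto intro: continuous_on_compose2[of UNIV \<phi> UNIV h])
next
  case (Suc k)
  define \<phi>' where "\<phi>' s = frechet_derivative \<phi> (at s) 1" for s
  have d: "frechet_derivative \<phi> (at s) r = \<phi>' s * r" for s r
    using has_derivative_bounded_linear[OF C_k_SucD(1)[OF Suc.prems(1), of s]]
    unfolding \<phi>'_def by (metis bounded_linear.linear linear_scale mult.commute mult.right_neutral real_scaleR_def)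
  have 1: "((\<lambda>x. \<phi> (h x)) has_derivative (\<lambda>v. \<phi>' (h x) * frechet_derivative h (at x) v)) (at x)" for x
    using has_derivative_compose[OF C_k_SucD(1)[OF Suc.prems(2)] C_k_SucD(1)[OF Suc.prems(1)], of x]
    by (simp add: d)
  show ?case
    by (rule C_k_SucI, rule 1)
       (unfold \<phi>'_def, rule C_k_mult,
        rule Suc.IH[OF C_k_SucD(2)[OF Suc.prems(1)] C_k_Suc_imp_C_k[OF Suc.prems(2)]],
        rule C_k_SucD(2)[OF Suc.prems(2)])
qed

lemma C_k_compose_scaleR:
  fixes h :: "'a::euclidean_space \<Rightarrow> real"
  shows "C_k k h \<Longrightarrow> C_k k (\<lambda>x. h (c *\<^sub>R x))"
proof (induction k arbitrary: h)
  case 0 then show ?case by (auto intro!: continuous_intros continuous_on_compose2[of UNIV h UNIV])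
next
  case (Suc k)
  have lin: "((\<lambda>x::'a. c *\<^sub>R x) has_derivative (\<lambda>v. c *\<^sub>R v)) (at x)" for x
    by (auto intro!: derivative_eq_intros)
  have 1: "((\<lambda>x. h (c *\<^sub>R x)) has_derivative (\<lambda>v. frechet_derivative h (at (c *\<^sub>R x)) (c *\<^sub>R v))) (at x)" for x
    using has_derivative_compose[OF lin C_k_SucD(1)[OF Suc.prems]] .
  show ?case
    by (rule C_k_SucI, rule 1) (rule Suc.IH[OF C_k_SucD(2)[OF Suc.prems]])
qed

lemma C_k_Suc_DERIV:
  assumes "\<And>t. (\<phi> has_real_derivative \<phi>' t) (at t)" "C_k k \<phi>'"
  shows "C_k (Suc k) \<phi>"
  by (rule C_k_SucI[where h'="\<lambda>x v. \<phi>' x * v"])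
     (use assms in \<open>auto simp: has_field_derivative_def intro: C_k_mult\<close>)

lemma DERIV_imp_C_0:
  assumes "\<And>t. (\<phi> has_real_derivative \<phi>' t) (at t)"
  shows "C_k 0 \<phi>"
  using DERIV_isCont[OF assms] by (simp add: continuous_at_imp_continuous_on)

lemma smooth_DERIV_D:
  assumes "smooth \<phi>" "\<And>t. (\<phi> has_real_derivative \<phi>' t) (at t)"
  shows "smooth \<phi>'"
proof
  fix k
  have "frechet_derivative \<phi> (at t) 1 = \<phi>' t" for t
    using assms(2)[of t] frechet_derivative_at[of \<phi> "(*) (\<phi>' t)" t]
    by (metis has_field_derivative_def mult.right_neutral)
  then show "C_k k \<phi>'" using C_k_SucD(2)[of k \<phi> 1] assms(1) by simp
qed

text \<open>The function \<open>exp (-1/s)\<close>, extended by zero, is flat at \<open>0\<close>. All its derivatives are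
  combinations of the functions below, which makes the induction on the order of
  differentiability immediate.\<close>

definition flat_exp :: "nat \<Rightarrow> real \<Rightarrow> real" where
  "flat_exp n s = (if s > 0 then (1 / s) ^ n * exp (- (1 / s)) else 0)"

lemma flat_exp_DERIV:
  "(flat_exp n has_real_derivative flat_exp (n + 2) s - real n * flat_exp (n + 1) s) (at s)"
proof -
  consider "s > 0" | "s < 0" | "s = 0" by linarith
  then show ?thesis
  proof cases
    case 1
    have "((\<lambda>s. (1 / s) ^ n) has_real_derivative - real n * (1 / s) ^ (n + 1)) (at s)"
    proof (cases n)
      case (Suc m)
      have "((\<lambda>s. 1 / s) has_real_derivative - ((1 / s)\<^sup>2)) (at s)"
        using 1 by (auto intro!: derivative_eq_intros simp: power2_eq_square)
      have *: "(1 + real m) * (- (y\<^sup>2) * y ^ m) = - real (Suc m) * y ^ (Suc m + 1)" for y :: real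
        by (simp add: power2_eq_square algebra_simps)
      from DERIV_power_Suc[OF \<open>((\<lambda>s. 1 / s) has_real_derivative _) _\<close>, of m] show ?thesis
        unfolding Suc by (rule DERIV_cong) (rule *)
    qed simp
    moreover have "((\<lambda>s. exp (- (1 / s))) has_real_derivative exp (- (1 / s)) * (1 / s)\<^sup>2) (at s)"
      using 1 by (auto intro!: derivative_eq_intros simp: power2_eq_square)
    ultimately have "((\<lambda>s. (1 / s) ^ n * exp (- (1 / s))) has_real_derivative
        flat_exp (n + 2) s - real n * flat_exp (n + 1) s) (at s)"
      by (rule DERIV_cong[OF DERIV_mult]) (use 1 in \<open>simp add: flat_exp_def power_add power2_eq_square algebra_simps\<close>)
    then show ?thesis
      by (rule DERIV_cong_ev[THEN iffD1, rotated -1])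
         (use 1 eventually_nhds_in_open[of "{0<..}" s] in \<open>auto simp: flat_exp_def elim!: eventually_mono\<close>)
  next
    case 2
    have "((\<lambda>s. 0) has_real_derivative
        flat_exp (n + 2) s - real n * flat_exp (n + 1) s) (at s)"
      using 2 by (auto intro!: derivative_eq_intros simp: flat_exp_def)
    then show ?thesis
      by (rule DERIV_cong_ev[THEN iffD1, rotated -1])
         (use 2 eventually_nhds_in_open[of "{..<0}" s] in \<open>auto simp: flat_exp_def elim!: eventually_mono\<close>)
  next
    case 3
    have "((\<lambda>h. flat_exp n h / h) \<longlongrightarrow> 0) (at 0)"
    proof (subst filterlim_at_split, intro conjI)
      show "((\<lambda>h. flat_exp n h / h) \<longlongrightarrow> 0) (at_left 0)"
        by (rule tendsto_eventually)
           (auto simp: eventually_at_filter flat_exp_def)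
      have "((\<lambda>h::real. (1 / h) ^ n * exp (- (1 / h)) / h) \<longlongrightarrow> 0) (at_right 0)"
        by real_asymp
      then show "((\<lambda>h. flat_exp n h / h) \<longlongrightarrow> 0) (at_right 0)"
        by (rule Lim_transform_eventually)
           (auto simp: eventually_at_filter flat_exp_def)
    qed
    then show ?thesis
      using 3 by (simp add: DERIV_def flat_exp_def)
  qed
qed

lemma smooth_flat_exp: "smooth (flat_exp n)"
proof
  fix k show "C_k k (flat_exp n)"
  proof (induction k arbitrary: n)
    case 0
    show ?case
      by (rule DERIV_imp_C_0[OF flat_exp_DERIV])
  next
    case (Suc k)
    show ?case
      by (rule C_k_Suc_DERIV[OF flat_exp_DERIV])
         (intro C_k_diff C_k_mult C_k_const Suc.IH)
  qed
qed

section \<open>The change of variables\<close>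

text \<open>A primitive of \<open>sqrt (1 + 2 * s\<^sup>2)\<close>.\<close>

definition dual_inv :: "real \<Rightarrow> real" where
  "dual_inv s = s * sqrt (1 + 2 * s\<^sup>2) / 2 + arsinh (sqrt 2 * s) / (2 * sqrt 2)"

lemma one_plus_two_sq_pos: "1 + 2 * (s::real)\<^sup>2 > 0"
  by (simp add: add_pos_nonneg)

lemma dual_inv_DERIV: "(dual_inv has_real_derivative sqrt (1 + 2 * s\<^sup>2)) (at s)"
proof -
  have pos: "1 + 2 * s\<^sup>2 > 0" by (rule one_plus_two_sq_pos)
  define r where "r = sqrt (1 + 2 * s\<^sup>2)"
  have r: "r > 0" "r\<^sup>2 = 1 + 2 * s\<^sup>2" using pos by (auto simp: r_def)
  have "((\<lambda>s. sqrt (1 + 2 * s\<^sup>2)) has_real_derivative (4 * s) * (inverse r / 2)) (at s)"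
    unfolding r_def
  proof (rule DERIV_chain2[where f=sqrt and g="\<lambda>s. 1 + 2 * s\<^sup>2", THEN DERIV_cong])
    show "(sqrt has_real_derivative inverse (sqrt (1 + 2 * s\<^sup>2)) / 2) (at (1 + 2 * s\<^sup>2))"
      by (rule DERIV_real_sqrt[OF pos])
    show "((\<lambda>s. 1 + 2 * s\<^sup>2) has_real_derivative 4 * s) (at s)"
      by (auto intro!: derivative_eq_intros)
  qed simp
  from DERIV_cdivide[OF DERIV_mult[OF DERIV_ident this], of 2]
  have "((\<lambda>s. s * sqrt (1 + 2 * s\<^sup>2) / 2) has_real_derivative (r + s * (2 * s / r)) / 2) (at s)"
    by (rule DERIV_cong) (unfold r_def[symmetric], use r in \<open>simp add: field_simps\<close>)
  moreover have "((\<lambda>s. arsinh (sqrt 2 * s)) has_real_derivative 1 / sqrt ((sqrt 2 * s)\<^sup>2 + 1) * sqrt 2) (at s)"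
    using DERIV_chain2[where f=arsinh and g="\<lambda>s. sqrt 2 * s", OF arsinh_real_has_field_derivative DERIV_cmult_Id] .
  then have "((\<lambda>s. arsinh (sqrt 2 * s)) has_real_derivative sqrt 2 / r) (at s)"
    by (rule DERIV_cong) (simp add: r_def power_mult_distrib add.commute)
  ultimately have "(dual_inv has_real_derivative
      (r + s * (2 * s / r)) / 2 + (sqrt 2 / r) / (2 * sqrt 2)) (at s)"
    unfolding dual_inv_def[abs_def] by (rule DERIV_add[OF _ DERIV_cdivide])
  also have "(r + s * (2 * s / r)) / 2 + (sqrt 2 / r) / (2 * sqrt 2) = r"
    using r by (simp add: field_simps power2_eq_square)
  finally show ?thesis by (simp add: r_def)
qed

lemma dual_inv_expands: assumes "a \<le> b" shows "b - a \<le> dual_inv b - dual_inv a"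
proof (cases "a = b")
  case False
  then have "a < b" using assms by simp
  then obtain z where z: "dual_inv b - dual_inv a = (b - a) * sqrt (1 + 2 * z\<^sup>2)"
    using MVT2[OF \<open>a < b\<close>, of dual_inv "\<lambda>s. sqrt (1 + 2 * s\<^sup>2)"] dual_inv_DERIV by auto
  have "1 \<le> sqrt (1 + 2 * z\<^sup>2)" by simp
  then show ?thesis unfolding z using assms mult_left_mono[of 1 _ "b - a"] by simp
qed simp

lemma dual_inv_inj: "dual_inv a = dual_inv b \<Longrightarrow> a = b"
  using dual_inv_expands[of a b] dual_inv_expands[of b a] by linarith

lemma dual_inv_0: "dual_inv 0 = 0" by (simp add: dual_inv_def)

lemma dual_inv_surj: "\<exists>s. dual_inv s = t"
proof -
  have c: "isCont dual_inv x" for x using dual_inv_DERIV DERIV_isCont by blast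
  have "dual_inv (- \<bar>t\<bar>) \<le> - \<bar>t\<bar>" "\<bar>t\<bar> \<le> dual_inv \<bar>t\<bar>"
    using dual_inv_expands[of "- \<bar>t\<bar>" 0] dual_inv_expands[of 0 "\<bar>t\<bar>"] dual_inv_0 by auto
  then show ?thesis
    using IVT[of dual_inv "-\<bar>t\<bar>" t "\<bar>t\<bar>"] c by fastforce
qed

lemma dual_inv_solution:
  assumes "\<And>t. (g has_real_derivative 1 / sqrt (1 + 2 * (g t)\<^sup>2)) (at t)" "g 0 = 0"
  shows "dual_inv (g t) = t"
proof -
  have "((\<lambda>t. dual_inv (g t) - t) has_real_derivative
      sqrt (1 + 2 * (g t)\<^sup>2) * (1 / sqrt (1 + 2 * (g t)\<^sup>2)) - 1) (at t)" for t
    by (rule DERIV_diff[OF DERIV_chain2[OF dual_inv_DERIV assms(1)] DERIV_ident])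
  moreover have "sqrt (1 + 2 * (g t)\<^sup>2) \<noteq> 0" for t
    using one_plus_two_sq_pos[of "g t"] by simp
  ultimately have "((\<lambda>t. dual_inv (g t) - t) has_real_derivative 0) (at t)" for t
    by (metis (no_types, lifting) diff_self nonzero_mult_div_cancel_left times_divide_eq_right mult.right_neutral)
  then have "dual_inv (g t) - t = dual_inv (g 0) - 0"
    by (intro DERIV_isconst_all allI)
  then show ?thesis by (simp add: assms(2) dual_inv_0)
qed

text \<open>Separation of variables: the Cauchy problem is solved exactly by the inverse of a primitive
  of \<open>sqrt (1 + 2 * s\<^sup>2)\<close>.\<close>

lemma dual_f_0: "dual_f 0 = 0"
  and dual_f_DERIV: "(dual_f has_real_derivative 1 / sqrt (1 + 2 * (dual_f t)\<^sup>2)) (at t)"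
proof -
  obtain f where f: "\<And>t. dual_inv (f t) = t" using dual_inv_surj by metis
  have lip: "\<bar>f a - f b\<bar> \<le> \<bar>a - b\<bar>" for a b
    using dual_inv_expands[of "f a" "f b"] dual_inv_expands[of "f b" "f a"] f by fastforce
  have cont: "isCont f t" for t
    unfolding continuous_at_eps_delta dist_real_def using lip by (meson le_less_trans)
  have d: "(f has_real_derivative 1 / sqrt (1 + 2 * (f t)\<^sup>2)) (at t)" for t
  proof -
    have "(f has_real_derivative inverse (sqrt (1 + 2 * (f t)\<^sup>2))) (at t)"
      using one_plus_two_sq_pos[of "f t"]
      by (intro DERIV_inverse_function[OF dual_inv_DERIV _ _ _ _ cont, where a="t-1" and b="t+1"])
         (auto simp: f)
    then show ?thesis by (simp add: inverse_eq_divide)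
  qed
  have f0: "f 0 = 0" using dual_inv_expands[of "f 0" 0] dual_inv_expands[of 0 "f 0"] f dual_inv_0
    by (smt (verit))
  have uniq: "g = f" if g0: "g 0 = 0"
    and g: "\<forall>t. (g has_real_derivative 1 / sqrt (1 + 2 * (g t)\<^sup>2)) (at t)" for g
  proof
    fix t
    have "dual_inv (g t) = dual_inv (f t)" using dual_inv_solution[OF g[rule_format] g0, of t] f[of t] by (rule trans[OF _ sym])
    then show "g t = f t" by (rule dual_inv_inj)
  qed
  have "dual_f = f" unfolding dual_f_def
  proof (rule the_equality)
    show "f 0 = 0 \<and> (\<forall>t. (f has_real_derivative 1 / sqrt (1 + 2 * (f t)\<^sup>2)) (at t))"
      using f0 d by blast
  qed (elim conjE, rule uniq)
  then show "dual_f 0 = 0" "(dual_f has_real_derivative 1 / sqrt (1 + 2 * (dual_f t)\<^sup>2)) (at t)"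
    using f0 d by auto
qed

text \<open>This is \<open>1 / f'\<close>, the weight by which a test function has to be multiplied.\<close>

definition dual_w :: "real \<Rightarrow> real" where
  "dual_w t = sqrt (1 + 2 * (dual_f t)\<^sup>2)"

lemma dual_w_sq: "(dual_w t)\<^sup>2 = 1 + 2 * (dual_f t)\<^sup>2"
  and dual_w_ge_1: "dual_w t \<ge> 1"
  using one_plus_two_sq_pos[of "dual_f t"] by (auto simp: dual_w_def)

lemma dual_w_pos: "dual_w t > 0" using dual_w_ge_1[of t] by linarith

lemma dual_f_DERIV': "(dual_f has_real_derivative 1 / dual_w t) (at t)"
  using dual_f_DERIV by (simp add: dual_w_def)

lemma dual_w_DERIV: "(dual_w has_real_derivative 2 * dual_f t * (1 / dual_w t)\<^sup>2) (at t)"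
proof -
  have "((\<lambda>t. 1 + 2 * (dual_f t)\<^sup>2) has_real_derivative 0 + 2 * (of_nat 2 * (1 / dual_w t * dual_f t ^ (2 - Suc 0)))) (at t)"
    by (rule DERIV_add[OF DERIV_const DERIV_cmult[OF DERIV_power[OF dual_f_DERIV']]])
  then have sq: "((\<lambda>t. 1 + 2 * (dual_f t)\<^sup>2) has_real_derivative 4 * (dual_f t * (1 / dual_w t))) (at t)"
    by (rule DERIV_cong) simp
  have "((\<lambda>t. sqrt (1 + 2 * (dual_f t)\<^sup>2)) has_real_derivative
      inverse (sqrt (1 + 2 * (dual_f t)\<^sup>2)) / 2 * (4 * (dual_f t * (1 / dual_w t)))) (at t)"
    using DERIV_chain2[where f=sqrt and g="\<lambda>t. 1 + 2 * (dual_f t)\<^sup>2",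
        OF DERIV_real_sqrt[OF one_plus_two_sq_pos] sq] .
  then show ?thesis
    unfolding dual_w_def[abs_def, symmetric]
    by (rule DERIV_cong) (unfold dual_w_def[symmetric], simp add: power2_eq_square field_simps)
qed

lemma abs_dual_f_le_dual_w: "\<bar>dual_f t\<bar> \<le> dual_w t"
proof -
  have "(dual_f t)\<^sup>2 \<le> (dual_w t)\<^sup>2" by (simp add: dual_w_sq)
  then show ?thesis using dual_w_pos[of t] by (metis abs_le_square_iff abs_of_pos)
qed

lemma two_dual_f_le: "\<bar>2 * dual_f t\<bar> \<le> (dual_w t)\<^sup>2"
proof -
  have "0 \<le> (1 - \<bar>dual_f t\<bar>)\<^sup>2" by simp
  also have "\<dots> = 1 - 2 * \<bar>dual_f t\<bar> + (dual_f t)\<^sup>2" by (simp add: power2_diff)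
  also have "\<dots> \<le> 1 - 2 * \<bar>dual_f t\<bar> + 2 * (dual_f t)\<^sup>2" by simp
  finally show ?thesis by (simp add: dual_w_sq abs_mult)
qed

text \<open>The differential equation has a smooth right-hand side, so every order of differentiability of the
  solution passes to its derivative. The right-hand side is treated in the same way, because
  \<open>S y = 1 / sqrt (1 + 2 * y\<^sup>2)\<close> satisfies \<open>S' = - 2 * y * S ^ 3\<close>.\<close>

lemma smooth_dual_f: "smooth dual_f"
proof -
  define S where "S y = 1 / sqrt (1 + 2 * y\<^sup>2)" for y :: real
  have S_DERIV: "(S has_real_derivative - 2 * y * S y ^ 3) (at y)" for y
  proof -
    have "1 + 2 * y\<^sup>2 > 0" by (rule one_plus_two_sq_pos)
    then show ?thesis unfolding S_def[abs_def]
      by (auto intro!: derivative_eq_intros simp: field_simps power3_eq_cube power2_eq_square)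
  qed
  have S: "C_k k S" for k
  proof (induction k)
    case 0
    show ?case by (rule DERIV_imp_C_0[OF S_DERIV])
  next
    case (Suc k)
    show ?case by (rule C_k_Suc_DERIV[OF S_DERIV])
        (intro C_k_mult C_k_const C_k_power Suc.IH C_k_bounded_linear bounded_linear_ident)
  qed
  have d: "(dual_f has_real_derivative S (dual_f t)) (at t)" for t
    using dual_f_DERIV by (simp add: S_def)
  have "C_k k dual_f" for k
  proof (induction k)
    case 0
    show ?case by (rule DERIV_imp_C_0[OF d])
  next
    case (Suc k)
    show ?case by (rule C_k_Suc_DERIV[OF d]) (rule C_k_compose[OF S Suc.IH])
  qed
  then show ?thesis by blast
qed

lemma smooth_inverse_dual_w: "smooth (\<lambda>t. 1 / dual_w t)"
  by (rule smooth_DERIV_D[OF smooth_dual_f dual_f_DERIV'])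

lemma smooth_dual_w_deriv: "smooth (\<lambda>t. 2 * dual_f t * (1 / dual_w t)\<^sup>2)"
  using smooth_dual_f smooth_inverse_dual_w
  by (auto intro!: C_k_mult C_k_power simp del: power_one_over)

lemma smooth_dual_w: "smooth dual_w"
proof
  fix k show "C_k k dual_w"
    using C_k_Suc_DERIV[OF dual_w_DERIV smooth_dual_w_deriv[rule_format], of k] by (rule C_k_Suc_imp_C_k)
qed

lemma DERIV_bounded_imp_Lipschitz:
  fixes \<phi> :: "real \<Rightarrow> real"
  assumes "\<And>t. (\<phi> has_real_derivative \<phi>' t) (at t)" "\<And>t. \<bar>\<phi>' t\<bar> \<le> M"
  shows "\<bar>\<phi> a - \<phi> b\<bar> \<le> M * \<bar>a - b\<bar>"
  using field_differentiable_bound[of UNIV \<phi> \<phi>' M a b] assms by auto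

lemma inverse_dual_w_bounds: "0 < 1 / dual_w t" "1 / dual_w t \<le> 1"
  using dual_w_ge_1[of t] by (auto simp: field_simps)

text \<open>The weight inherits a bounded derivative from \<open>2 |f| \<le> 1 + 2 f\<^sup>2\<close>, so the chain rule below applies
  to it just as it applies to \<open>f\<close>.\<close>

lemma dual_w_deriv_le_1: "\<bar>2 * dual_f t * (1 / dual_w t)\<^sup>2\<bar> \<le> 1"
  using two_dual_f_le[of t] dual_w_pos[of t]
  by (simp add: abs_mult power_divide field_simps)

lemma dual_f_Lipschitz: "\<bar>dual_f a - dual_f b\<bar> \<le> \<bar>a - b\<bar>"
  using DERIV_bounded_imp_Lipschitz[OF dual_f_DERIV', of 1 a b] inverse_dual_w_bounds
  by (smt (verit) mult_1)

lemma dual_w_Lipschitz: "\<bar>dual_w a - dual_w b\<bar> \<le> \<bar>a - b\<bar>"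
  using DERIV_bounded_imp_Lipschitz[OF dual_w_DERIV, of 1 a b] dual_w_deriv_le_1 by simp

lemma abs_dual_f_le: "\<bar>dual_f t\<bar> \<le> \<bar>t\<bar>"
  using dual_f_Lipschitz[of t 0] dual_f_0 by simp

lemma dual_w_le': "dual_w t \<le> 1 + \<bar>t\<bar>"
  using dual_w_Lipschitz[of t 0] by (simp add: dual_w_def[of 0] dual_f_0)

lemma dual_f_mono: assumes "a \<le> b" shows "dual_f a \<le> dual_f b"
proof (rule DERIV_nonneg_imp_nondecreasing[where f=dual_f, OF assms])
  fix x show "\<exists>y. (dual_f has_real_derivative y) (at x) \<and> 0 \<le> y"
    using dual_f_DERIV' inverse_dual_w_bounds(1) less_imp_le by blast
qed

lemma dual_f_odd: "dual_f (- t) = - dual_f t"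
proof -
  have s: "dual_inv (- s) = - dual_inv s" for s by (simp add: dual_inv_def arsinh_minus_real)
  have inv: "dual_inv (dual_f t) = t" for t by (rule dual_inv_solution[OF dual_f_DERIV dual_f_0])
  have "dual_inv (dual_f (- t)) = dual_inv (- dual_f t)" by (simp add: s inv)
  then show ?thesis
    by (rule dual_inv_inj)
qed

text \<open>By concavity of \<open>f\<close> on the positive half line \<open>f (k * t) \<le> k * f t\<close> for \<open>k \<ge> 1\<close>. This keeps the energy
  space stable under multiples.\<close>

lemma dual_f_mult_sq_le:
  assumes "k > 0" shows "(dual_f (k * t))\<^sup>2 \<le> max 1 (k\<^sup>2) * (dual_f t)\<^sup>2"
proof -
  have pos: "(dual_f (k * t))\<^sup>2 \<le> max 1 (k\<^sup>2) * (dual_f t)\<^sup>2" if t: "t \<ge> 0" for t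
  proof -
    have nn: "dual_f s \<ge> 0" if "s \<ge> 0" for s using dual_f_mono[OF that] dual_f_0 by simp
    show ?thesis
    proof (cases "k \<le> 1")
      case True
      have "dual_f (k * t) \<le> dual_f t"
        using True t assms by (intro dual_f_mono) (simp add: mult_left_le_one_le)
      then have "(dual_f (k * t))\<^sup>2 \<le> (dual_f t)\<^sup>2" using nn[of "k*t"] t assms by (intro power_mono) auto
      also have "\<dots> \<le> max 1 (k\<^sup>2) * (dual_f t)\<^sup>2" by (metis max.cobounded1 mult_1 mult_right_mono zero_le_power2)
      finally show ?thesis .
    next
      case False
      then have k: "k \<ge> 1" by simp
      have d: "((\<lambda>s. k * dual_f s - dual_f (k * s)) has_real_derivative k * (1 / dual_w s) - 1 / dual_w (k * s) * k) (at s)" for s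
        by (auto intro!: derivative_eq_intros DERIV_chain2[OF dual_f_DERIV'] dual_f_DERIV')
      have "0 \<le> k * (1 / dual_w s) - 1 / dual_w (k * s) * k" if "s \<ge> 0" for s
      proof -
        have "dual_f s \<le> dual_f (k * s)" using k that by (intro dual_f_mono) (simp add: mult_ge1_I mult_le_cancel_right1)
        then have "dual_w s \<le> dual_w (k * s)"
          unfolding dual_w_def using nn[OF that] by (auto intro: power_mono)
        then have "1 / dual_w (k * s) \<le> 1 / dual_w s" using dual_w_pos by (simp add: frac_le)
        then have "k * (1 / dual_w (k * s)) \<le> k * (1 / dual_w s)" using assms by (intro mult_left_mono) auto
        then show ?thesis by (simp add: mult.commute)
      qed
      then have "k * dual_f 0 - dual_f (k * 0) \<le> k * dual_f t - dual_f (k * t)"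
        using t by (intro DERIV_nonneg_imp_nondecreasing[of 0 t "\<lambda>s. k * dual_f s - dual_f (k * s)"]) (use d in blast)+
      then have "dual_f (k * t) \<le> k * dual_f t" by (simp add: dual_f_0)
      then have "(dual_f (k * t))\<^sup>2 \<le> (k * dual_f t)\<^sup>2" using nn[of "k*t"] t assms by (intro power_mono) auto
      also have "\<dots> = k\<^sup>2 * (dual_f t)\<^sup>2" by (simp add: power_mult_distrib)
      also have "\<dots> \<le> max 1 (k\<^sup>2) * (dual_f t)\<^sup>2" by (intro mult_right_mono) auto
      finally show ?thesis .
    qed
  qed
  show ?thesis
  proof (cases "t \<ge> 0")
    case False
    then show ?thesis using pos[of "- t"] by (simp add: dual_f_odd)
  qed (rule pos)
qed

section \<open>Test functions and their gradients\<close>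

lemma grad_inner:
  fixes h :: "real ^ 'n \<Rightarrow> real"
  assumes "h differentiable (at x)"
  shows "(h has_derivative (\<lambda>v. grad h x \<bullet> v)) (at x)"
proof -
  let ?D = "frechet_derivative h (at x)"
  have D: "(h has_derivative ?D) (at x)"
    using assms by (simp add: frechet_derivative_works)
  then have lin: "linear ?D"
    by (rule has_derivative_linear)
  have "?D v = grad h x \<bullet> v" for v
  proof -
    have "?D v = ?D (\<Sum>i\<in>UNIV. v $ i *\<^sub>R axis i 1)"
      by (simp add: basis_expansion scalar_mult_eq_scaleR[symmetric])
    also have "\<dots> = (\<Sum>i\<in>UNIV. v $ i * ?D (axis i 1))"
      by (simp add: linear_sum[OF lin] linear_scale[OF lin])
    finally show ?thesis
      by (simp add: grad_def inner_vec_def mult.commute)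
  qed
  then have "?D = (\<lambda>v. grad h x \<bullet> v)" ..
  with D show ?thesis by simp
qed

lemma grad_eqI:
  fixes h :: "real ^ 'n \<Rightarrow> real"
  assumes "(h has_derivative (\<lambda>v. G \<bullet> v)) (at x)"
  shows "grad h x = G"
  unfolding grad_def frechet_derivative_at[OF assms, symmetric]
  by (simp add: vec_eq_iff inner_axis)

lemma smooth_imp_differentiable: "smooth h \<Longrightarrow> h differentiable (at x)"
  by (metis C_k.simps(2))

lemma smooth_imp_continuous: "smooth h \<Longrightarrow> continuous_on UNIV h"
  by (metis C_k.simps(1))

lemma smooth_grad: "smooth h \<Longrightarrow> smooth (\<lambda>x. grad h x $ i)"
  unfolding grad_def by (simp, metis C_k.simps(2))

lemma continuous_grad: "smooth h \<Longrightarrow> continuous_on UNIV (grad h)"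
  unfolding continuous_on_componentwise[of UNIV "grad h"]
  by (auto simp: Basis_vec_def inner_axis intro!: smooth_imp_continuous smooth_grad)

lemma grad_mult:
  assumes "smooth g" "smooth h"
  shows "grad (\<lambda>x. g x * h x) x = g x *\<^sub>R grad h x + h x *\<^sub>R grad g x"
  by (rule grad_eqI)
     (rule has_derivative_eq_rhs[OF has_derivative_mult[OF grad_inner grad_inner]],
      use assms in \<open>auto simp: smooth_imp_differentiable inner_add_left algebra_simps\<close>)

lemma grad_compose:
  assumes "(\<phi> has_real_derivative d) (at (h x))" "smooth h"
  shows "grad (\<lambda>x. \<phi> (h x)) x = d *\<^sub>R grad h x"
  by (rule grad_eqI)
     (rule has_derivative_eq_rhs[OF has_derivative_compose[where f=h and g=\<phi>, OF grad_inner
        assms(1)[unfolded has_field_derivative_def]]],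
      use assms(2) in \<open>auto simp: smooth_imp_differentiable\<close>)

lemma grad_compose_scaleR:
  fixes h :: "real ^ 'n \<Rightarrow> real"
  assumes "smooth h"
  shows "grad (\<lambda>x. h (c *\<^sub>R x)) x = c *\<^sub>R grad h (c *\<^sub>R x)"
proof (rule grad_eqI)
  have "((\<lambda>x::real^'n. c *\<^sub>R x) has_derivative (\<lambda>v. c *\<^sub>R v)) (at x)"
    by (rule has_derivative_scaleR_right[OF has_derivative_ident])
  from has_derivative_compose[OF this grad_inner]
  show "((\<lambda>x. h (c *\<^sub>R x)) has_derivative (\<lambda>v. (c *\<^sub>R grad h (c *\<^sub>R x)) \<bullet> v)) (at x)"
    using assms by (simp add: smooth_imp_differentiable)
qed

lemma grad_const: "grad (\<lambda>x. c) x = 0"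
  by (rule grad_eqI) simp

lemma continuous_compact_support_bounded:
  fixes g :: "'a::euclidean_space \<Rightarrow> 'b::real_normed_vector"
  assumes "continuous_on UNIV g" "\<And>x. norm x \<ge> r \<Longrightarrow> g x = 0"
  obtains B where "B > 0" "\<And>x. norm (g x) \<le> B"
proof -
  have "compact (g ` cball 0 r)"
    by (rule compact_continuous_image) (auto intro: continuous_on_subset[OF assms(1)])
  then obtain B where B: "B > 0" "\<forall>y\<in>g ` cball 0 r. norm y \<le> B"
    using bounded_pos compact_imp_bounded by metis
  show ?thesis
  proof (rule that[OF B(1)])
    fix x show "norm (g x) \<le> B"
      using B assms(2)[of x] by (cases "norm x \<le> r") auto
  qed
qed

lemma Cc_infI:
  assumes "smooth h" "\<And>x. norm x \<ge> r \<Longrightarrow> h x = 0"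
  shows "h \<in> Cc_inf"
proof -
  have "{x. h x \<noteq> 0} \<subseteq> cball 0 r"
    using assms(2) by (auto simp: not_le) (meson linear)
  then have "bounded {x. h x \<noteq> 0}"
    using bounded_subset bounded_cball by blast
  then show ?thesis
    using assms(1) by (auto simp: Cc_inf_def compact_closure)
qed

lemma Cc_inf_smooth: "h \<in> Cc_inf \<Longrightarrow> smooth h"
  by (simp add: Cc_inf_def)

text \<open>The two constants that estimates with a test function and its gradient use.\<close>

definition test_bound :: "(real ^ 'n \<Rightarrow> real) \<Rightarrow> real \<Rightarrow> real \<Rightarrow> bool" where
  "test_bound h r B \<longleftrightarrow> r > 0 \<and> B > 0 \<and> (\<forall>x. \<bar>h x\<bar> \<le> B \<and> norm (grad h x) \<le> B) \<and>
     (\<forall>x. norm x \<ge> r \<longrightarrow> h x = 0 \<and> grad h x = 0)"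

lemma test_boundD:
  assumes "test_bound h r B"
  shows "r > 0" "B > 0" "\<And>x. \<bar>h x\<bar> \<le> B" "\<And>x. norm (grad h x) \<le> B"
    "\<And>x. norm x \<ge> r \<Longrightarrow> h x = 0" "\<And>x. norm x \<ge> r \<Longrightarrow> grad h x = 0"
  using assms by (auto simp: test_bound_def)

lemma Cc_inf_test_bound:
  assumes "h \<in> Cc_inf"
  shows "\<exists>r B. test_bound h r B"
proof -
  have sm: "smooth h" using assms by (rule Cc_inf_smooth)
  have "bounded {x. h x \<noteq> 0}"
    using assms closure_subset by (auto simp: Cc_inf_def intro: bounded_subset compact_imp_bounded)
  then obtain s where s: "s > 0" "\<forall>x\<in>{x. h x \<noteq> 0}. norm x \<le> s"
    using bounded_pos by metis
  have h0: "h x = 0" if "norm x > s" for x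
    using s(2) that by (metis (mono_tags, lifting) mem_Collect_eq not_le)
  have g0: "grad h x = 0" if "norm x > s" for x
  proof (rule grad_eqI)
    have "open {x::real^'a. norm x > s}"
      by (rule open_Collect_less) (auto intro: continuous_intros)
    then have "(h has_derivative (\<lambda>v. 0)) (at x)"
      by (rule has_derivative_transform_within_open[where f="\<lambda>_. 0", OF has_derivative_const])
         (use that h0 in auto)
    then show "(h has_derivative (\<lambda>v. 0 \<bullet> v)) (at x)" by simp
  qed
  obtain B1 where B1: "B1 > 0" "\<And>x. norm (h x) \<le> B1"
  proof (rule continuous_compact_support_bounded[OF smooth_imp_continuous[OF sm]])
    show "h x = 0" if "s + 1 \<le> norm x" for x using h0[of x] that by simp
  qed blast
  obtain B2 where B2: "B2 > 0" "\<And>x. norm (grad h x) \<le> B2"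
  proof (rule continuous_compact_support_bounded[OF continuous_grad[OF sm]])
    show "grad h x = 0" if "s + 1 \<le> norm x" for x using g0[of x] that by simp
  qed blast
  have "\<bar>h x\<bar> \<le> max B1 B2 \<and> norm (grad h x) \<le> max B1 B2" for x
    using B1(2)[of x] B2(2)[of x] by auto
  moreover have "norm x \<ge> s + 1 \<longrightarrow> h x = 0 \<and> grad h x = 0" for x
    using h0[of x] g0[of x] by auto
  ultimately have "test_bound h (s + 1) (max B1 B2)"
    using s(1) B1(1) unfolding test_bound_def by auto
  then show ?thesis by blast
qed

section \<open>Integrals over Euclidean space\<close>

lemma continuous_imp_measurable_lebesgue:
  fixes g :: "'a::euclidean_space \<Rightarrow> 'b::topological_space"
  assumes "continuous_on UNIV g" shows "g \<in> borel_measurable lebesgue"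
  using borel_measurable_continuous_onI[OF assms] by (simp add: measurable_completion)

lemma AE_lebesgue_neq_0: "AE x in lebesgue. x \<noteq> (0::'a::euclidean_space)"
  by (rule AE_completion) (rule AE_lborel_singleton)

text \<open>Excluding the origin costs nothing and admits radial weights without a meaningful value there.\<close>

lemma integrable_lebesgue_bound:
  fixes g :: "'a::euclidean_space \<Rightarrow> 'b::{banach, second_countable_topology}"
  assumes "integrable lebesgue f" "g \<in> borel_measurable lebesgue" "\<And>x. x \<noteq> 0 \<Longrightarrow> norm (g x) \<le> f x"
  shows "integrable lebesgue g"
proof (rule Bochner_Integration.integrable_bound[OF assms(1,2)])
  show "AE x in lebesgue. norm (g x) \<le> norm (f x)"
    using AE_lebesgue_neq_0 by eventually_elim (use assms(3) in \<open>force intro: order_trans[OF _ abs_ge_self]\<close>)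
qed

lemma integrable_indicator_cball: "integrable lebesgue (indicator (cball a r) :: 'a::euclidean_space \<Rightarrow> real)"
  by (rule integrable_real_indicator)
     (auto simp: emeasure_lborel_cball_finite[unfolded infinity_ennreal_def])

lemma integrable_bounded_compact_support:
  fixes g :: "'a::euclidean_space \<Rightarrow> 'b::{banach, second_countable_topology}"
  assumes "g \<in> borel_measurable lebesgue" "\<And>x. norm (g x) \<le> B" "\<And>x. norm x > r \<Longrightarrow> g x = 0"
  shows "integrable lebesgue g"
proof (rule integrable_lebesgue_bound[OF _ assms(1)])
  show "integrable lebesgue (\<lambda>x. B * indicator (cball 0 r) x :: real)"
    by (intro integrable_mult_right integrable_indicator_cball)
qed (use assms(2,3) in \<open>auto simp: indicator_def\<close>)

lemma lebesgue_scaleR_affine: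
  fixes t :: "'a::euclidean_space" and c :: real
  assumes "c \<noteq> 0"
  shows "lebesgue = density (distr lebesgue lebesgue (\<lambda>x::'a. t + c *\<^sub>R x)) (\<lambda>_. ennreal (\<bar>c\<bar> ^ DIM('a)))"
    and "(\<lambda>x::'a. t + c *\<^sub>R x) \<in> lebesgue \<rightarrow>\<^sub>M lebesgue"
proof -
  have "(\<lambda>x. t + (\<Sum>j\<in>Basis. (c * (x \<bullet> j)) *\<^sub>R j)) = (\<lambda>x::'a. t + c *\<^sub>R x)"
    by (simp add: scaleR_scaleR[symmetric] scaleR_sum_right[symmetric] euclidean_representation
             del: scaleR_scaleR)
  then show "lebesgue = density (distr lebesgue lebesgue (\<lambda>x::'a. t + c *\<^sub>R x)) (\<lambda>_. ennreal (\<bar>c\<bar> ^ DIM('a)))"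
    "(\<lambda>x::'a. t + c *\<^sub>R x) \<in> lebesgue \<rightarrow>\<^sub>M lebesgue"
    using lebesgue_affine_euclidean[of "\<lambda>_. c" t] lebesgue_affine_measurable[of "\<lambda>_. c" t] assms
    by simp_all
qed

lemma
  fixes g :: "'a::euclidean_space \<Rightarrow> 'b::{banach, second_countable_topology}"
  assumes c: "c \<noteq> 0" and g: "g \<in> borel_measurable lebesgue"
  shows measurable_lebesgue_affine: "(\<lambda>x. g (t + c *\<^sub>R x)) \<in> borel_measurable lebesgue"
    and integral_lebesgue_affine:
      "(LINT x|lebesgue. g x) = \<bar>c\<bar> ^ DIM('a) *\<^sub>R (LINT x|lebesgue. g (t + c *\<^sub>R x))"
    and integrable_lebesgue_affine:
      "integrable lebesgue g \<longleftrightarrow> integrable lebesgue (\<lambda>x. g (t + c *\<^sub>R x))"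
proof -
  note T = lebesgue_scaleR_affine[OF c, where t=t]
  show m: "(\<lambda>x. g (t + c *\<^sub>R x)) \<in> borel_measurable lebesgue"
    using measurable_compose[OF T(2) g] .
  have "(LINT x|lebesgue. g x) = (LINT x|density (distr lebesgue lebesgue (\<lambda>x. t + c *\<^sub>R x)) (\<lambda>_. ennreal (\<bar>c\<bar> ^ DIM('a))). g x)"
    using T(1) by simp
  also have "\<dots> = (LINT x|distr lebesgue lebesgue (\<lambda>x. t + c *\<^sub>R x). \<bar>c\<bar> ^ DIM('a) *\<^sub>R g x)"
    using g by (intro integral_density) auto
  also have "\<dots> = (LINT x|lebesgue. \<bar>c\<bar> ^ DIM('a) *\<^sub>R g (t + c *\<^sub>R x))"
    using g by (intro integral_distr T(2)) auto
  finally show "(LINT x|lebesgue. g x) = \<bar>c\<bar> ^ DIM('a) *\<^sub>R (LINT x|lebesgue. g (t + c *\<^sub>R x))"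
    by simp
  have "integrable lebesgue g \<longleftrightarrow> integrable (density (distr lebesgue lebesgue (\<lambda>x. t + c *\<^sub>R x)) (\<lambda>_. ennreal (\<bar>c\<bar> ^ DIM('a)))) g"
    using T(1) by simp
  also have "\<dots> \<longleftrightarrow> integrable (distr lebesgue lebesgue (\<lambda>x. t + c *\<^sub>R x)) (\<lambda>x. \<bar>c\<bar> ^ DIM('a) *\<^sub>R g x)"
    using g by (intro integrable_density) auto
  also have "\<dots> \<longleftrightarrow> integrable lebesgue (\<lambda>x. \<bar>c\<bar> ^ DIM('a) *\<^sub>R g (t + c *\<^sub>R x))"
    using g by (intro integrable_distr_eq T(2)) auto
  also have "\<dots> \<longleftrightarrow> integrable lebesgue (\<lambda>x. g (t + c *\<^sub>R x))"
  proof
    assume "integrable lebesgue (\<lambda>x. \<bar>c\<bar> ^ DIM('a) *\<^sub>R g (t + c *\<^sub>R x))"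
    then have "integrable lebesgue (\<lambda>x. (1 / \<bar>c\<bar> ^ DIM('a)) *\<^sub>R \<bar>c\<bar> ^ DIM('a) *\<^sub>R g (t + c *\<^sub>R x))"
      by (rule integrable_scaleR_right)
    then show "integrable lebesgue (\<lambda>x. g (t + c *\<^sub>R x))" using c by simp
  qed (intro integrable_scaleR_right, auto)
  finally show "integrable lebesgue g \<longleftrightarrow> integrable lebesgue (\<lambda>x. g (t + c *\<^sub>R x))" .
qed

text \<open>A derivative in a fixed direction is the limit of difference quotients, and these have
  integral zero because Lebesgue measure is invariant under translations.\<close>

lemma integral_directional_derivative_zero:
  fixes g :: "'a::euclidean_space \<Rightarrow> real"
  assumes d: "\<And>x. (g has_derivative g' x) (at x)"
    and c: "continuous_on UNIV (\<lambda>x. g' x v)"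
    and g0: "\<And>x. norm x \<ge> r \<Longrightarrow> g x = 0" and g'0: "\<And>x. norm x \<ge> r \<Longrightarrow> g' x v = 0"
  shows "(LINT x|lebesgue. g' x v) = 0"
proof -
  obtain B where B: "B > 0" "\<And>x. norm (g' x v) \<le> B"
    using continuous_compact_support_bounded[OF c g'0] by blast
  have cont: "continuous_on UNIV g"
    using d has_derivative_continuous by (metis continuous_at_imp_continuous_on)
  have gm: "g \<in> borel_measurable lebesgue"
    by (rule continuous_imp_measurable_lebesgue[OF cont])
  obtain B0 where B0: "\<And>x. norm (g x) \<le> B0"
    using continuous_compact_support_bounded[OF cont g0] by blast
  have gi: "integrable lebesgue g"
    by (rule integrable_bounded_compact_support[OF gm B0, where r=r]) (simp add: g0)
  define q where "q n x = (g (x + (1 / real (Suc n)) *\<^sub>R v) - g x) * real (Suc n)" for n x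
  have shift: "integrable lebesgue (\<lambda>x. g (x + w))" "(LINT x|lebesgue. g (x + w)) = (LINT x|lebesgue. g x)" for w
    using integrable_lebesgue_affine[of 1 g w] integral_lebesgue_affine[of 1 g w] gm gi
    by (simp_all add: add.commute)
  have q0: "(LINT x|lebesgue. q n x) = 0" for n
    unfolding q_def using shift gi by simp
  have qm: "q n \<in> borel_measurable lebesgue" for n
    unfolding q_def using shift(1) gi
    by (intro borel_measurable_times borel_measurable_diff borel_measurable_const)
       (auto dest: borel_measurable_integrable)
  have line: "((\<lambda>s. g (x + s *\<^sub>R v)) has_real_derivative g' (x + s *\<^sub>R v) v) (at s)" for x s
  proof -
    have "((\<lambda>s. x + s *\<^sub>R v) has_derivative (\<lambda>s. s *\<^sub>R v)) (at s)"
      by (auto intro!: derivative_eq_intros)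
    from has_derivative_compose[OF this d]
    show ?thesis
      unfolding has_field_derivative_def
      by (rule has_derivative_eq_rhs)
         (simp add: linear_scale[OF has_derivative_linear[OF d]] fun_eq_iff)
  qed
  have lim: "(\<lambda>n. q n x) \<longlonglongrightarrow> g' x v" for x
  proof -
    have "((\<lambda>h. (g (x + h *\<^sub>R v) - g x) / h) \<longlongrightarrow> g' x v) (at 0)"
      using line[of x 0] by (simp add: DERIV_def)
    moreover have "filterlim (\<lambda>n. 1 / real (Suc n)) (at 0) sequentially"
      by (auto simp: filterlim_at) real_asymp
    ultimately have "(\<lambda>n. (g (x + (1 / real (Suc n)) *\<^sub>R v) - g x) / (1 / real (Suc n))) \<longlonglongrightarrow> g' x v"
      by (rule filterlim_compose)
    then show ?thesis by (simp add: q_def)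
  qed
  have bound: "norm (q n x) \<le> B * indicator (cball 0 (r + norm v)) x" for n x
  proof (cases "norm x \<le> r + norm v")
    case True
    have "\<bar>g (x + (1 / real (Suc n)) *\<^sub>R v) - g (x + 0 *\<^sub>R v)\<bar> \<le> B * \<bar>1 / real (Suc n) - 0\<bar>"
      by (rule DERIV_bounded_imp_Lipschitz[OF line]) (use B in auto)
    then have "\<bar>g (x + (1 / real (Suc n)) *\<^sub>R v) - g x\<bar> * real (Suc n) \<le> B * (1 / real (Suc n)) * real (Suc n)"
      by (intro mult_right_mono) auto
    then show ?thesis using True by (simp add: q_def abs_mult)
  next
    case False
    have "norm ((1 / real (Suc n)) *\<^sub>R v) \<le> norm v"
      by (simp add: field_simps mult_left_mono)
    then have "norm (x + (1 / real (Suc n)) *\<^sub>R v) \<ge> r" "norm x \<ge> r"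
      using False norm_diff_ineq[of x "(1 / real (Suc n)) *\<^sub>R v"] norm_ge_zero[of v] by linarith+
    then show ?thesis using False B(1) g0 by (simp add: q_def)
  qed
  have "(\<lambda>n. LINT x|lebesgue. q n x) \<longlonglongrightarrow> (LINT x|lebesgue. g' x v)"
  proof (rule integral_dominated_convergence)
    show "integrable lebesgue (\<lambda>x. B * indicator (cball 0 (r + norm v)) x)"
      by (intro integrable_mult_right integrable_indicator_cball)
  qed (use bound lim qm c continuous_imp_measurable_lebesgue in auto)
  then show ?thesis using q0 by (simp add: LIMSEQ_const_iff)
qed

text \<open>As \<open>exp (-1 / (n s))\<close> tends to \<open>1\<close> for \<open>s > 0\<close>, these test functions tend to the indicator of a
  box, and they are bounded by it.\<close>

definition box_bump :: "nat \<Rightarrow> real ^ 'n \<Rightarrow> real ^ 'n \<Rightarrow> real ^ 'n \<Rightarrow> real" where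
  "box_bump n a b x = (\<Prod>i\<in>UNIV. flat_exp 0 (real n * (x $ i - a $ i)) * flat_exp 0 (real n * (b $ i - x $ i)))"

lemma flat_exp_0_bounds: "0 \<le> flat_exp 0 s" "flat_exp 0 s \<le> 1"
  by (auto simp: flat_exp_def)

lemma smooth_component: "C_k k (\<lambda>x. x $ i)" for i :: "'n::finite"
  by (rule C_k_bounded_linear) (rule bounded_linear_vec_nth)

lemma box_bump_zero: "x \<notin> box a b \<Longrightarrow> box_bump n a b x = 0"
proof -
  assume "x \<notin> box a b"
  then obtain i where "\<not> (a $ i < x $ i \<and> x $ i < b $ i)" by (auto simp: mem_box_cart)
  then have "flat_exp 0 (real n * (x $ i - a $ i)) * flat_exp 0 (real n * (b $ i - x $ i)) = 0"
    by (auto simp: flat_exp_def mult_less_0_iff zero_less_mult_iff)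
  then show ?thesis unfolding box_bump_def by (intro prod_zero) auto
qed

lemma box_bump_bounds: "0 \<le> box_bump n a b x" "box_bump n a b x \<le> 1"
  unfolding box_bump_def
  by (auto intro!: prod_nonneg prod_le_1 mult_nonneg_nonneg mult_le_one simp: flat_exp_0_bounds)

lemma box_bump_tendsto: "(\<lambda>n. box_bump n a b x) \<longlonglongrightarrow> indicator (box a b) x"
proof (cases "x \<in> box a b")
  case True
  have 1: "(\<lambda>n. flat_exp 0 (real n * s)) \<longlonglongrightarrow> 1" if "s > 0" for s
  proof (rule Lim_transform_eventually)
    show "(\<lambda>n. exp (- (1 / (real n * s)))) \<longlonglongrightarrow> 1" using that by real_asymp
    show "\<forall>\<^sub>F n in sequentially. exp (- (1 / (real n * s))) = flat_exp 0 (real n * s)"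
      using eventually_gt_at_top[of 0] by eventually_elim (use that in \<open>simp add: flat_exp_def\<close>)
  qed
  have "(\<lambda>n. box_bump n a b x) \<longlonglongrightarrow> (\<Prod>i\<in>(UNIV::'a set). 1 * 1)"
    unfolding box_bump_def using True by (intro tendsto_prod tendsto_mult 1) (auto simp: mem_box_cart)
  then show ?thesis using True by simp
qed (simp add: box_bump_zero)

lemma box_bump_Cc_inf: "box_bump n a b \<in> Cc_inf"
proof -
  obtain r where r: "box a b \<subseteq> ball 0 r"
    using bounded_box bounded_subset_ballD by metis
  show ?thesis
  proof (rule Cc_infI)
    show "smooth (box_bump n a b)"
      unfolding box_bump_def[abs_def]
      by (auto intro!: C_k_prod C_k_mult C_k_compose[OF smooth_flat_exp[rule_format]] C_k_diff smooth_component)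
    show "box_bump n a b x = 0" if "norm x \<ge> r" for x
      using r that by (intro box_bump_zero) auto
  qed
qed

abbreviation loc_integrable :: "(real ^ 'n \<Rightarrow> 'b::{banach, second_countable_topology}) \<Rightarrow> bool" where
  "loc_integrable u \<equiv> \<forall>S. compact S \<longrightarrow> set_integrable lebesgue S u"

lemma loc_integrable_measurable:
  fixes u :: "real ^ 'n \<Rightarrow> 'b::{banach, second_countable_topology}"
  assumes "loc_integrable u" shows "u \<in> borel_measurable lebesgue"
proof (rule borel_measurable_LIMSEQ_metric)
  fix n :: nat
  show "(\<lambda>x. indicator (cball 0 (real n)) x *\<^sub>R u x) \<in> borel_measurable lebesgue"
    using assms[rule_format, of "cball 0 (real n)"] by (auto simp: set_integrable_def dest: borel_measurable_integrable)
next
  fix x :: "real ^ 'n"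
  have "\<forall>\<^sub>F n in sequentially. u x = indicator (cball 0 (real n)) x *\<^sub>R u x"
    using eventually_ge_at_top[of "nat \<lceil>norm x\<rceil>"]
    by eventually_elim (simp add: nat_le_iff ceiling_le_iff)
  then show "(\<lambda>n. indicator (cball 0 (real n)) x *\<^sub>R u x) \<longlonglongrightarrow> u x"
    by (rule Lim_transform_eventually[OF tendsto_const])
qed

lemma loc_integrable_times_test:
  fixes u :: "real ^ 'n \<Rightarrow> 'b::{banach, second_countable_topology}"
  assumes u: "loc_integrable u" and m: "\<phi> \<in> borel_measurable lebesgue"
    and b: "\<And>x. \<bar>\<phi> x\<bar> \<le> B" and z: "\<And>x. norm x \<ge> r \<Longrightarrow> \<phi> x = 0"
  shows "integrable lebesgue (\<lambda>x. \<phi> x *\<^sub>R u x)"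
proof (rule integrable_lebesgue_bound)
  show "integrable lebesgue (\<lambda>x. B * norm (indicator (cball 0 r) x *\<^sub>R u x))"
    using u[rule_format, of "cball 0 r"] by (intro integrable_mult_right integrable_norm) (simp add: set_integrable_def)
  show "(\<lambda>x. \<phi> x *\<^sub>R u x) \<in> borel_measurable lebesgue"
    using loc_integrable_measurable[OF u] m by simp
  show "norm (\<phi> x *\<^sub>R u x) \<le> B * norm (indicator (cball 0 r) x *\<^sub>R u x)" for x
    using b[of x] z[of x] by (cases "norm x \<le> r") (auto intro!: mult_right_mono)
qed

lemma measurable_indicator_box_times:
  fixes u :: "real ^ 'n \<Rightarrow> real"
  shows "u \<in> borel_measurable lebesgue \<Longrightarrow> (\<lambda>x. indicator (box a b) x * u x) \<in> borel_measurable lebesgue"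
  by (intro borel_measurable_times borel_measurable_indicator) (auto intro: fmeasurableD)

text \<open>The positive and the negative part of \<open>u\<close> are densities of two measures that agree on the
  generator of the Borel sets given by the boxes, so they agree as measures and the densities coincide.\<close>

lemma AE_zero_if_box_integrals_zero:
  fixes u :: "real ^ 'n \<Rightarrow> real"
  assumes u: "loc_integrable u"
    and z: "\<And>a b. (LINT x|lebesgue. indicator (box a b) x * u x) = 0"
  shows "AE x in lebesgue. u x = 0"
proof -
  obtain g where g[measurable]: "g \<in> borel_measurable lborel" and ug: "AE x in lborel. u x = g x"
    using completion_ex_borel_measurable_real[OF loc_integrable_measurable[OF u]] by blast
  have ug': "AE x in lebesgue. u x = g x" using ug by (rule AE_completion)
  have gi: "integrable lborel (\<lambda>x. indicator (box a b) x * g x)"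
    and gz: "(LINT x|lborel. indicator (box a b) x * g x) = 0" for a b
  proof -
    have um: "u \<in> borel_measurable lebesgue" by (rule loc_integrable_measurable[OF u])
    have "integrable lebesgue (\<lambda>x. indicator (cbox a b) x * u x)"
      using u[rule_format, OF compact_cbox, of a b] by (simp add: set_integrable_def)
    then have "integrable lebesgue (\<lambda>x. indicator (box a b) x * u x)"
      by (rule Bochner_Integration.integrable_bound)
         (use um in \<open>auto intro!: AE_I2 measurable_indicator_box_times
           split: split_indicator dest: box_subset_cbox[THEN subsetD]\<close>)
    then have "integrable lebesgue (\<lambda>x. indicator (box a b) x * g x)"
      by (rule integrable_cong_AE_imp) (use ug' in \<open>auto intro!: measurable_completion\<close>)
    then show "integrable lborel (\<lambda>x. indicator (box a b) x * g x)"
      by (subst (asm) integrable_completion) auto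
    have "(LINT x|lebesgue. indicator (box a b) x * g x) = (LINT x|lebesgue. indicator (box a b) x * u x)"
    proof (rule integral_cong_AE)
      show "(\<lambda>x. indicator (box a b) x * g x) \<in> borel_measurable lebesgue"
        by (rule measurable_indicator_box_times) (simp add: measurable_completion)
      show "(\<lambda>x. indicator (box a b) x * u x) \<in> borel_measurable lebesgue"
        by (rule measurable_indicator_box_times[OF um])
      show "AE x in lebesgue. indicator (box a b) x * g x = indicator (box a b) x * u x"
        using ug' by eventually_elim simp
    qed
    then show "(LINT x|lborel. indicator (box a b) x * g x) = 0"
      using z by (subst (asm) integral_completion) auto
  qed
  let ?E = "range (\<lambda>(a, b). box a b::(real^'n) set)"
  have pm: "emeasure (density lborel (\<lambda>x. ennreal (s * g x))) (box a b)
      = ennreal (LINT x|lborel. max 0 (s * (indicator (box a b) x * g x)))" for a b s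
  proof -
    have "emeasure (density lborel (\<lambda>x. ennreal (s * g x))) (box a b)
      = (\<integral>\<^sup>+x. ennreal (max 0 (s * (indicator (box a b) x * g x))) \<partial>lborel)"
      by (subst emeasure_density) (auto intro!: nn_integral_cong simp: indicator_def ennreal_neg max_def)
    also have "\<dots> = ennreal (LINT x|lborel. max 0 (s * (indicator (box a b) x * g x)))"
      using gi[of a b] by (intro nn_integral_eq_integral) auto
    finally show ?thesis .
  qed
  have eq: "emeasure (density lborel (\<lambda>x. ennreal (1 * g x))) (box a b)
      = emeasure (density lborel (\<lambda>x. ennreal (-1 * g x))) (box a b)" for a b
  proof -
    have "(LINT x|lborel. max 0 (1 * (indicator (box a b) x * g x))) - (LINT x|lborel. max 0 (-1 * (indicator (box a b) x * g x)))
      = (LINT x|lborel. max 0 (1 * (indicator (box a b) x * g x)) - max 0 (-1 * (indicator (box a b) x * g x)))"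
      using gi[of a b] by (intro Bochner_Integration.integral_diff[symmetric]) auto
    also have "\<dots> = (LINT x|lborel. indicator (box a b) x * g x)"
      by (rule Bochner_Integration.integral_cong) auto
    finally show ?thesis unfolding pm gz by simp
  qed
  have "density lborel (\<lambda>x. ennreal (1 * g x)) = density lborel (\<lambda>x. ennreal (-1 * g x))"
  proof (rule measure_eqI_generator_eq)
    show "Int_stable ?E" by (auto simp: Int_stable_def box_Int_box)
    show "?E \<subseteq> Pow UNIV" by simp
    let ?A = "\<lambda>n::nat. box (- (real n *\<^sub>R One)) (real n *\<^sub>R One) :: (real^'n) set"
    show "range ?A \<subseteq> ?E" "(\<Union>i. ?A i) = UNIV" unfolding UN_box_eq_UNIV by auto
    show "emeasure (density lborel (\<lambda>x. ennreal (1 * g x))) (?A i) \<noteq> \<infinity>" for i unfolding pm by simp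
  qed (use eq in \<open>auto simp: borel_eq_box\<close>)
  then have "AE x in lborel. ennreal (1 * g x) = ennreal (-1 * g x)"
    by (intro sigma_finite_measure.density_unique[OF sigma_finite_lborel]) auto
  then have "AE x in lborel. g x = 0"
  proof eventually_elim
    fix x assume "ennreal (1 * g x) = ennreal (-1 * g x)"
    then show "g x = 0" by (cases "g x" "0 :: real" rule: linorder_cases) (auto simp: ennreal_neg ennreal_eq_0_iff)
  qed
  then have "AE x in lebesgue. g x = 0" by (rule AE_completion)
  with ug' show ?thesis by eventually_elim simp
qed

text \<open>The fundamental lemma of the calculus of variations.\<close>

lemma AE_zero_if_test_integrals_zero:
  fixes u :: "real ^ 'n \<Rightarrow> real"
  assumes u: "loc_integrable u"
    and z: "\<And>\<phi>. \<phi> \<in> Cc_inf \<Longrightarrow> (LINT x|lebesgue. \<phi> x * u x) = 0"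
  shows "AE x in lebesgue. u x = 0"
proof (rule AE_zero_if_box_integrals_zero[OF u])
  fix a b :: "real ^ 'n"
  have um: "u \<in> borel_measurable lebesgue" by (rule loc_integrable_measurable[OF u])
  have bm: "box_bump n a b \<in> borel_measurable lebesgue" for n
    by (intro continuous_imp_measurable_lebesgue smooth_imp_continuous Cc_inf_smooth box_bump_Cc_inf)
  have "(\<lambda>n. LINT x|lebesgue. box_bump n a b x * u x) \<longlonglongrightarrow> (LINT x|lebesgue. indicator (box a b) x * u x)"
  proof (rule integral_dominated_convergence)
    show "integrable lebesgue (\<lambda>x. norm (indicator (cbox a b) x *\<^sub>R u x))"
      using u[rule_format, OF compact_cbox, of a b] by (intro integrable_norm) (simp add: set_integrable_def)
    have "norm (box_bump n a b x * u x) \<le> norm (indicator (cbox a b) x *\<^sub>R u x)" for n x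
      using box_bump_bounds[of n a b x] box_bump_zero[of x a b n] box_subset_cbox[of a b]
      by (cases "x \<in> box a b") (auto simp: abs_mult subset_eq intro: mult_left_le_one_le)
    then show "AE x in lebesgue. norm (box_bump n a b x * u x) \<le> norm (indicator (cbox a b) x *\<^sub>R u x)" for n
      by simp
    show "AE x in lebesgue. (\<lambda>n. box_bump n a b x * u x) \<longlonglongrightarrow> indicator (box a b) x * u x"
      by (intro AE_I2 tendsto_mult box_bump_tendsto tendsto_const)
  qed (use um bm in \<open>auto intro!: measurable_indicator_box_times\<close>)
  then show "(LINT x|lebesgue. indicator (box a b) x * u x) = 0"
    by (simp add: z[OF box_bump_Cc_inf] LIMSEQ_const_iff)
qed

section \<open>Weak gradients\<close>

lemma integral_vec_nth:
  fixes F :: "'a \<Rightarrow> real ^ 'n"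
  assumes "integrable M F"
  shows "integrable M (\<lambda>x. F x $ i)" "(LINT x|M. F x) $ i = (LINT x|M. F x $ i)"
  using integrable_bounded_linear[OF bounded_linear_vec_nth assms]
    integral_bounded_linear[OF bounded_linear_vec_nth assms] by auto

lemma loc_integrable_vec_nth:
  fixes U :: "real ^ 'm \<Rightarrow> real ^ 'n"
  assumes "loc_integrable U" shows "loc_integrable (\<lambda>x. U x $ i)"
  using assms integral_vec_nth(1)[of lebesgue "\<lambda>x. indicator _ x *\<^sub>R U x" i]
  by (fastforce simp: set_integrable_def)

lemma continuous_loc_integrable:
  fixes u :: "real ^ 'n \<Rightarrow> 'b::{banach, second_countable_topology}"
  assumes "continuous_on UNIV u" shows "loc_integrable u"
proof (intro allI impI)
  fix S :: "(real ^ 'n) set" assume S: "compact S"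
  then have "compact (u ` S)"
    by (intro compact_continuous_image) (auto intro: continuous_on_subset[OF assms])
  then obtain B where B: "B > 0" "\<forall>y\<in>u ` S. norm y \<le> B"
    using bounded_pos compact_imp_bounded by metis
  have Sm: "S \<in> sets lebesgue" using S by (auto intro: fmeasurableD lmeasurable_compact)
  show "set_integrable lebesgue S u"
    unfolding set_integrable_def
  proof (rule integrable_lebesgue_bound)
    show "integrable lebesgue (\<lambda>x. B * indicator S x :: real)"
      using lmeasurable_compact[OF S]
      by (intro integrable_mult_right integrable_real_indicator) (auto simp: fmeasurable_def)
    show "(\<lambda>x. indicator S x *\<^sub>R u x) \<in> borel_measurable lebesgue"
      by (intro borel_measurable_scaleR borel_measurable_indicator Sm continuous_imp_measurable_lebesgue assms)
  qed (use B in \<open>auto split: split_indicator\<close>)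
qed

lemma integrable_test_products:
  assumes u: "loc_integrable (u :: real ^ 'n \<Rightarrow> real)" "loc_integrable (U :: real ^ 'n \<Rightarrow> real ^ 'n)" and \<phi>: "\<phi> \<in> Cc_inf"
  shows "integrable lebesgue (\<lambda>x. u x * grad \<phi> x $ i)"
    and "integrable lebesgue (\<lambda>x. \<phi> x *\<^sub>R U x)"
    and "integrable lebesgue (\<lambda>x. u x *\<^sub>R grad \<phi> x)"
proof -
  obtain r B where "test_bound \<phi> r B" using Cc_inf_test_bound[OF \<phi>] by blast
  note rB = test_boundD[OF this]
  have sm: "smooth \<phi>" using \<phi> by (rule Cc_inf_smooth)
  have gb: "\<bar>grad \<phi> x $ i\<bar> \<le> B" for x i
    using rB(4)[of x] component_le_norm_cart[of "grad \<phi> x" i] by linarith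
  have ci: "integrable lebesgue (\<lambda>x. u x * grad \<phi> x $ i)" for i
    using loc_integrable_times_test[OF u(1) continuous_imp_measurable_lebesgue[OF smooth_imp_continuous[OF smooth_grad[OF sm]]] gb, of r i] rB(6)
    by (simp add: mult.commute)
  then show "integrable lebesgue (\<lambda>x. u x * grad \<phi> x $ i)" .
  have "integrable lebesgue (\<lambda>x. \<Sum>i\<in>UNIV. (u x * grad \<phi> x $ i) *\<^sub>R axis i (1::real))"
    by (intro Bochner_Integration.integrable_sum integrable_scaleR_left ci)
  also have "(\<lambda>x. \<Sum>i\<in>UNIV. (u x * grad \<phi> x $ i) *\<^sub>R axis i (1::real)) = (\<lambda>x. u x *\<^sub>R grad \<phi> x)"
  proof
    fix x
    have "u x *\<^sub>R grad \<phi> x = (\<Sum>i\<in>UNIV. (u x *\<^sub>R grad \<phi> x) $ i *\<^sub>R axis i (1::real))"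
      by (simp only: basis_expansion scalar_mult_eq_scaleR[symmetric])
    then show "(\<Sum>i\<in>UNIV. (u x * grad \<phi> x $ i) *\<^sub>R axis i (1::real)) = u x *\<^sub>R grad \<phi> x" by simp
  qed
  finally show "integrable lebesgue (\<lambda>x. u x *\<^sub>R grad \<phi> x)" .
  show "integrable lebesgue (\<lambda>x. \<phi> x *\<^sub>R U x)"
    by (rule loc_integrable_times_test[OF u(2) continuous_imp_measurable_lebesgue[OF smooth_imp_continuous[OF sm]] rB(3) rB(5)])
qed

lemma has_weak_gradient_component:
  assumes w: "has_weak_gradient u U" and \<phi>: "\<phi> \<in> Cc_inf"
  shows "integrable lebesgue (\<lambda>x. u x * grad \<phi> x $ i)" "integrable lebesgue (\<lambda>x. \<phi> x * U x $ i)"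
    and "(LINT x|lebesgue. u x * grad \<phi> x $ i) = - (LINT x|lebesgue. \<phi> x * U x $ i)"
proof -
  have u: "loc_integrable u" "loc_integrable U" using w by (auto simp: has_weak_gradient_def)
  note i = integrable_test_products[OF u \<phi>]
  show "integrable lebesgue (\<lambda>x. u x * grad \<phi> x $ i)" "integrable lebesgue (\<lambda>x. \<phi> x * U x $ i)"
    using i(1)[of i] integral_vec_nth(1)[OF i(2), of i] by simp_all
  have "(LINT x|lebesgue. u x *\<^sub>R grad \<phi> x) = - (LINT x|lebesgue. \<phi> x *\<^sub>R U x)"
    using w \<phi> by (auto simp: has_weak_gradient_def)
  then have "(LINT x|lebesgue. u x *\<^sub>R grad \<phi> x) $ i = (- (LINT x|lebesgue. \<phi> x *\<^sub>R U x)) $ i" by simp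
  then show "(LINT x|lebesgue. u x * grad \<phi> x $ i) = - (LINT x|lebesgue. \<phi> x * U x $ i)"
    by (simp add: integral_vec_nth(2)[OF i(3)] integral_vec_nth(2)[OF i(2)])
qed

lemma has_weak_gradientI:
  fixes u :: "real ^ 'n \<Rightarrow> real"
  assumes u: "loc_integrable u" "loc_integrable U"
    and eq: "\<And>\<phi> i. \<phi> \<in> Cc_inf \<Longrightarrow> (LINT x|lebesgue. u x * grad \<phi> x $ i) = - (LINT x|lebesgue. \<phi> x * U x $ i)"
  shows "has_weak_gradient u U"
  unfolding has_weak_gradient_def
proof (intro conjI ballI u allI impI)
  fix \<phi> :: "real ^ 'n \<Rightarrow> real" assume \<phi>: "\<phi> \<in> Cc_inf"
  note i = integrable_test_products[OF u \<phi>]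
  show "(LINT x|lebesgue. u x *\<^sub>R grad \<phi> x) = - (LINT x|lebesgue. \<phi> x *\<^sub>R U x)"
    using eq[OF \<phi>] by (simp add: vec_eq_iff integral_vec_nth(2)[OF i(2)] integral_vec_nth(2)[OF i(3)])
qed (use u in auto)

lemma loc_integrable_add:
  fixes u v :: "real ^ 'm \<Rightarrow> 'b::{banach, second_countable_topology}"
  shows "loc_integrable u \<Longrightarrow> loc_integrable v \<Longrightarrow> loc_integrable (\<lambda>x. u x + v x)"
  by (simp add: set_integrable_def scaleR_add_right)

lemma loc_integrable_cmult:
  fixes u :: "real ^ 'm \<Rightarrow> 'b::{banach, second_countable_topology}"
  shows "loc_integrable u \<Longrightarrow> loc_integrable (\<lambda>x. c *\<^sub>R u x)"
  unfolding set_integrable_def scaleR_left_commute[of _ c] by (intro allI impI integrable_scaleR_right) blast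

lemma has_weak_gradient_add:
  assumes u: "has_weak_gradient u U" and v: "has_weak_gradient v W"
  shows "has_weak_gradient (\<lambda>x. u x + v x) (\<lambda>x. U x + W x)"
proof (rule has_weak_gradientI)
  show "loc_integrable (\<lambda>x. u x + v x)" "loc_integrable (\<lambda>x. U x + W x)"
    using u v by (auto simp: has_weak_gradient_def intro!: loc_integrable_add[rule_format])
  fix \<phi> :: "real^'a \<Rightarrow> real" and i assume \<phi>: "\<phi> \<in> Cc_inf"
  note c = has_weak_gradient_component[OF u \<phi>, of i] has_weak_gradient_component[OF v \<phi>, of i]
  show "(LINT x|lebesgue. (u x + v x) * grad \<phi> x $ i) = - (LINT x|lebesgue. \<phi> x * (U x + W x) $ i)"
    using c by (simp add: distrib_left distrib_right)
qed

lemma has_weak_gradient_cmult: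
  assumes u: "has_weak_gradient u U"
  shows "has_weak_gradient (\<lambda>x. c * u x) (\<lambda>x. c *\<^sub>R U x)"
proof (rule has_weak_gradientI)
  show "loc_integrable (\<lambda>x. c * u x)" "loc_integrable (\<lambda>x. c *\<^sub>R U x)"
    using u loc_integrable_cmult[of u c] loc_integrable_cmult[of U c] by (auto simp: has_weak_gradient_def)
  fix \<phi> :: "real^'a \<Rightarrow> real" and i assume \<phi>: "\<phi> \<in> Cc_inf"
  show "(LINT x|lebesgue. (c * u x) * grad \<phi> x $ i) = - (LINT x|lebesgue. \<phi> x * (c *\<^sub>R U x) $ i)"
    using has_weak_gradient_component(3)[OF u \<phi>, of i] by (simp add: mult.assoc mult.left_commute[of _ c])
qed

lemma has_weak_gradient_diff:
  assumes "has_weak_gradient u U" "has_weak_gradient v W"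
  shows "has_weak_gradient (\<lambda>x. u x - v x) (\<lambda>x. U x - W x)"
  using has_weak_gradient_add[OF assms(1) has_weak_gradient_cmult[OF assms(2), of "-1"]] by simp

lemma smooth_has_weak_gradient:
  fixes h :: "real ^ 'n \<Rightarrow> real"
  assumes h: "smooth h" shows "has_weak_gradient h (grad h)"
proof (rule has_weak_gradientI)
  show l: "loc_integrable h" "loc_integrable (grad h)"
    using continuous_loc_integrable smooth_imp_continuous continuous_grad h by blast+
  fix \<phi> :: "real^'n \<Rightarrow> real" and i assume \<phi>: "\<phi> \<in> Cc_inf"
  then have sm: "smooth \<phi>" by (rule Cc_inf_smooth)
  obtain r B where "test_bound \<phi> r B" using Cc_inf_test_bound[OF \<phi>] by blast
  note rB = test_boundD[OF this]
  have smp: "smooth (\<lambda>x. h x * \<phi> x)" using h sm by (auto intro: C_k_mult)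
  have e: "grad (\<lambda>x. h x * \<phi> x) x \<bullet> axis i 1 = h x * grad \<phi> x $ i + \<phi> x * grad h x $ i" for x
    by (simp add: grad_mult[OF h sm] inner_axis)
  have "(LINT x|lebesgue. grad (\<lambda>x. h x * \<phi> x) x \<bullet> axis i 1) = 0"
  proof (rule integral_directional_derivative_zero)
    show "((\<lambda>x. h x * \<phi> x) has_derivative (\<lambda>v. grad (\<lambda>x. h x * \<phi> x) x \<bullet> v)) (at x)" for x
      by (rule grad_inner[OF smooth_imp_differentiable[OF smp]])
    show "continuous_on UNIV (\<lambda>x. grad (\<lambda>x. h x * \<phi> x) x \<bullet> axis i 1)"
      by (intro continuous_intros continuous_grad smp)
  qed (use rB e in auto)
  moreover have "integrable lebesgue (\<lambda>x. h x * grad \<phi> x $ i)" "integrable lebesgue (\<lambda>x. \<phi> x * grad h x $ i)"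
    using integrable_test_products(1)[OF l \<phi>, of i] integral_vec_nth(1)[OF integrable_test_products(2)[OF l \<phi>], of i]
    by simp_all
  ultimately show "(LINT x|lebesgue. h x * grad \<phi> x $ i) = - (LINT x|lebesgue. \<phi> x * grad h x $ i)"
    by (simp add: e)
qed

lemma has_weak_gradient_unique:
  assumes u: "has_weak_gradient u U" and v: "has_weak_gradient u W"
  shows "AE x in lebesgue. U x = W x"
proof -
  have "AE x in lebesgue. U x $ i - W x $ i = 0" for i
  proof (rule AE_zero_if_test_integrals_zero)
    have "loc_integrable (\<lambda>x. (U x - W x) $ i)"
      using has_weak_gradient_diff[OF u v] by (intro loc_integrable_vec_nth) (auto simp: has_weak_gradient_def)
    then show "loc_integrable (\<lambda>x. U x $ i - W x $ i)" by simp
    fix \<phi> :: "real^'a \<Rightarrow> real" assume \<phi>: "\<phi> \<in> Cc_inf"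
    show "(LINT x|lebesgue. \<phi> x * (U x $ i - W x $ i)) = 0"
      using has_weak_gradient_component[OF u \<phi>, of i] has_weak_gradient_component[OF v \<phi>, of i]
      by (simp add: right_diff_distrib)
  qed
  then have "AE x in lebesgue. \<forall>i. U x $ i - W x $ i = 0"
    by (simp add: AE_all_countable)
  then show ?thesis by eventually_elim (simp add: vec_eq_iff)
qed

lemma wgrad_AE_eq:
  assumes "has_weak_gradient u U"
  shows "has_weak_gradient u (wgrad u)" "AE x in lebesgue. wgrad u x = U x"
proof -
  show "has_weak_gradient u (wgrad u)" unfolding wgrad_def by (rule someI[where P="has_weak_gradient u", OF assms])
  from has_weak_gradient_unique[OF this assms] show "AE x in lebesgue. wgrad u x = U x" .
qed

lemma has_weak_gradient_measurable:
  assumes "has_weak_gradient u U"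
  shows "u \<in> borel_measurable lebesgue" "U \<in> borel_measurable lebesgue"
  using assms loc_integrable_measurable by (auto simp: has_weak_gradient_def)

lemma norm12_eq:
  assumes "has_weak_gradient u U"
  shows "norm12 u = sqrt (LINT x|lebesgue. (norm (U x))\<^sup>2)"
    and "(LINT x|lebesgue. (norm (wgrad u x))\<^sup>2) = (LINT x|lebesgue. (norm (U x))\<^sup>2)"
proof -
  note w = wgrad_AE_eq[OF assms]
  show "(LINT x|lebesgue. (norm (wgrad u x))\<^sup>2) = (LINT x|lebesgue. (norm (U x))\<^sup>2)"
    by (rule integral_cong_AE)
       (use w has_weak_gradient_measurable[OF w(1)] has_weak_gradient_measurable[OF assms] in auto)
  then show "norm12 u = sqrt (LINT x|lebesgue. (norm (U x))\<^sup>2)" by (simp add: norm12_def)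
qed

section \<open>A Hardy inequality\<close>

text \<open>The vector field \<open>\<Psi> x = x / (\<epsilon> + |x|\<^sup>2)\<close> has divergence at least \<open>(N - 2) / (\<epsilon> + |x|\<^sup>2)\<close> and
  length at most \<open>(\<epsilon> + |x|\<^sup>2) powr (-1/2)\<close>. Integrating the divergence of \<open>h\<^sup>2 \<Psi>\<close> bounds a
  weighted square integral of \<open>h\<close> by the Dirichlet integral, on the whole space and without any
  boundary term. The parameter \<open>\<epsilon>\<close> keeps the field smooth at the origin.\<close>

lemma Hardy_inequality:
  fixes h :: "real ^ 'n \<Rightarrow> real"
  assumes N: "CARD('n) \<ge> 3" and h: "h \<in> Cc_inf" and \<epsilon>: "\<epsilon> > 0"
  shows "integrable lebesgue (\<lambda>x. (h x)\<^sup>2 / (\<epsilon> + (norm x)\<^sup>2))"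
    and "integrable lebesgue (\<lambda>x. (norm (grad h x))\<^sup>2)"
    and "(LINT x|lebesgue. (h x)\<^sup>2 / (\<epsilon> + (norm x)\<^sup>2)) \<le> 4 * (LINT x|lebesgue. (norm (grad h x))\<^sup>2)"
proof -
  have sm: "smooth h" using h by (rule Cc_inf_smooth)
  have ch: "continuous_on UNIV h" "continuous_on UNIV (grad h)"
    using sm smooth_imp_continuous continuous_grad by blast+
  obtain r B where "test_bound h r B" using Cc_inf_test_bound[OF h] by blast
  note rB = test_boundD[OF this]
  have cc: "integrable lebesgue g" if g: "continuous_on UNIV g" "\<And>x. norm x \<ge> r \<Longrightarrow> g x = 0" for g :: "real^'n \<Rightarrow> real"
  proof -
    obtain C where "\<And>x. norm (g x) \<le> C" using continuous_compact_support_bounded[OF g] by blast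
    then show ?thesis
      by (rule integrable_bounded_compact_support[OF continuous_imp_measurable_lebesgue[OF g(1)], where r=r])
         (use g(2) in auto)
  qed
  define \<omega> where "\<omega> x = inverse (\<epsilon> + x \<bullet> x)" for x :: "real^'n"
  have pos: "\<epsilon> + x \<bullet> x > 0" for x :: "real^'n" using \<epsilon> by (simp add: add_pos_nonneg)
  have \<omega>n: "(h x)\<^sup>2 / (\<epsilon> + (norm x)\<^sup>2) = (h x)\<^sup>2 * \<omega> x" for x
    by (simp add: \<omega>_def power2_norm_eq_inner divide_inverse)
  have c\<omega>: "continuous_on UNIV \<omega>"
    unfolding \<omega>_def by (intro continuous_intros) (use pos in \<open>auto simp: less_imp_neq[symmetric]\<close>)
  define D where "D i x v = (2 * h x * (grad h x \<bullet> v)) * (x $ i * \<omega> x)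
    + (h x)\<^sup>2 * (v $ i * \<omega> x - x $ i * (2 * (x \<bullet> v) * (\<omega> x)\<^sup>2))" for i x v
  have d: "((\<lambda>x. (h x)\<^sup>2 * (x $ i * \<omega> x)) has_derivative D i x) (at x)" for i x
  proof -
    have 1: "((\<lambda>x. (h x)\<^sup>2) has_derivative (\<lambda>v. 2 * h x * (grad h x \<bullet> v))) (at x)"
      by (rule has_derivative_eq_rhs[OF has_derivative_power[OF grad_inner[OF smooth_imp_differentiable[OF sm]]]])
         (simp add: fun_eq_iff)
    have 2: "(\<omega> has_derivative (\<lambda>v. - (2 * (x \<bullet> v) * (\<omega> x)\<^sup>2))) (at x)"
    proof -
      have "((\<lambda>x. \<epsilon> + x \<bullet> x) has_derivative (\<lambda>v. 2 * (x \<bullet> v))) (at x)"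
        by (auto intro!: derivative_eq_intros simp: inner_commute)
      from Deriv.has_derivative_inverse[OF _ this] pos[of x] show ?thesis
        unfolding \<omega>_def[abs_def]
        by (auto elim!: has_derivative_eq_rhs simp: power2_eq_square fun_eq_iff algebra_simps)
    qed
    have 3: "((\<lambda>x. x $ i) has_derivative (\<lambda>v. v $ i)) (at x)"
      by (rule bounded_linear_imp_has_derivative) (rule bounded_linear_vec_nth)
    show ?thesis
      by (rule has_derivative_eq_rhs[OF has_derivative_mult[OF 1 has_derivative_mult[OF 3 2]]])
         (simp add: D_def fun_eq_iff algebra_simps)
  qed
  have Dc: "continuous_on UNIV (\<lambda>x. D i x (axis i 1))" for i
    unfolding D_def by (intro continuous_intros ch c\<omega>)
  have D0: "D i x (axis i 1) = 0" if "norm x \<ge> r" for i x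
    using rB(5,6)[OF that] by (simp add: D_def)
  have Dint: "(LINT x|lebesgue. D i x (axis i 1)) = 0" for i
    by (rule integral_directional_derivative_zero[OF d Dc, where r=r]) (use rB(5) D0 in auto)
  have Di: "integrable lebesgue (\<lambda>x. D i x (axis i 1))" for i
    by (rule cc[OF Dc D0])
  have div: "(\<Sum>i\<in>UNIV. D i x (axis i 1)) = 2 * h x * (grad h x \<bullet> x) * \<omega> x
      + (h x)\<^sup>2 * (real CARD('n) * \<omega> x - 2 * (x \<bullet> x) * (\<omega> x)\<^sup>2)" for x
  proof -
    have "D i x (axis i 1) = 2 * h x * \<omega> x * (grad h x $ i * x $ i) + (h x)\<^sup>2 * \<omega> x
        - 2 * (h x)\<^sup>2 * (\<omega> x)\<^sup>2 * (x $ i * x $ i)" for i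
      by (simp add: D_def inner_axis algebra_simps power2_eq_square)
    then have "(\<Sum>i\<in>UNIV. D i x (axis i 1)) = 2 * h x * \<omega> x * (grad h x \<bullet> x) + real CARD('n) * ((h x)\<^sup>2 * \<omega> x)
        - 2 * (h x)\<^sup>2 * (\<omega> x)\<^sup>2 * (x \<bullet> x)"
      by (simp add: sum.distrib sum_subtractf sum_distrib_left[symmetric] inner_vec_def)
    then show ?thesis by (simp add: algebra_simps)
  qed
  show i1: "integrable lebesgue (\<lambda>x. (h x)\<^sup>2 / (\<epsilon> + (norm x)\<^sup>2))"
    unfolding \<omega>n by (rule cc) (use rB in \<open>auto intro!: continuous_intros ch c\<omega>\<close>)
  show i2: "integrable lebesgue (\<lambda>x. (norm (grad h x))\<^sup>2)"
    by (rule cc) (use rB in \<open>auto intro!: continuous_intros ch\<close>)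
  \<comment> \<open>Young's inequality with weights \<open>1/2\<close> and \<open>2\<close>, so that half of the weighted square is absorbed on the left.\<close>
  have pt: "(1/2) * ((h x)\<^sup>2 / (\<epsilon> + (norm x)\<^sup>2)) \<le> (\<Sum>i\<in>UNIV. D i x (axis i 1)) + 2 * (norm (grad h x))\<^sup>2" for x
  proof -
    have \<omega>p: "\<omega> x > 0" using pos by (simp add: \<omega>_def)
    have \<omega>1: "(x \<bullet> x) * \<omega> x \<le> 1" using pos[of x] \<epsilon> by (simp add: \<omega>_def field_simps)
    have "(x \<bullet> x) * (\<omega> x)\<^sup>2 = ((x \<bullet> x) * \<omega> x) * \<omega> x" by (simp add: power2_eq_square)
    also have "\<dots> \<le> 1 * \<omega> x" using \<omega>1 \<omega>p by (intro mult_right_mono) auto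
    finally have \<omega>2: "(x \<bullet> x) * (\<omega> x)\<^sup>2 \<le> \<omega> x" by simp
    have "3 * \<omega> x \<le> real CARD('n) * \<omega> x" using N \<omega>p by (intro mult_right_mono) auto
    then have "\<omega> x \<le> real CARD('n) * \<omega> x - 2 * (x \<bullet> x) * (\<omega> x)\<^sup>2" using \<omega>2 by simp
    then have A: "(h x)\<^sup>2 * \<omega> x \<le> (h x)\<^sup>2 * (real CARD('n) * \<omega> x - 2 * (x \<bullet> x) * (\<omega> x)\<^sup>2)"
      by (intro mult_left_mono) auto
    define a where "a = \<bar>h x\<bar> * (norm x * \<omega> x)"
    define b where "b = norm (grad h x)"
    have "\<bar>2 * h x * (grad h x \<bullet> x) * \<omega> x\<bar> = 2 * \<bar>h x\<bar> * \<bar>grad h x \<bullet> x\<bar> * \<omega> x"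
      using \<omega>p by (simp add: abs_mult)
    also have "\<dots> \<le> 2 * \<bar>h x\<bar> * (norm (grad h x) * norm x) * \<omega> x"
      using \<omega>p by (intro mult_right_mono mult_left_mono Cauchy_Schwarz_ineq2) auto
    also have "\<dots> = 2 * a * b" by (simp add: a_def b_def)
    also have "\<dots> \<le> a\<^sup>2 / 2 + 2 * b\<^sup>2"
      using zero_le_power2[of "a - 2 * b"] by (simp add: power2_diff power_mult_distrib)
    also have "a\<^sup>2 = (h x)\<^sup>2 * ((x \<bullet> x) * (\<omega> x)\<^sup>2)"
      by (simp add: a_def power_mult_distrib power2_norm_eq_inner)
    also have "(h x)\<^sup>2 * ((x \<bullet> x) * (\<omega> x)\<^sup>2) / 2 \<le> (h x)\<^sup>2 * \<omega> x / 2"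
      using \<omega>2 by (intro divide_right_mono mult_left_mono) auto
    finally have "\<bar>2 * h x * (grad h x \<bullet> x) * \<omega> x\<bar> \<le> (h x)\<^sup>2 * \<omega> x / 2 + 2 * b\<^sup>2" by simp
    then show ?thesis using A unfolding div \<omega>n b_def by linarith
  qed
  have "(LINT x|lebesgue. (1/2) * ((h x)\<^sup>2 / (\<epsilon> + (norm x)\<^sup>2)))
      \<le> (LINT x|lebesgue. (\<Sum>i\<in>UNIV. D i x (axis i 1)) + 2 * (norm (grad h x))\<^sup>2)"
    by (intro integral_mono pt integrable_mult_right i1 Bochner_Integration.integrable_add
        Bochner_Integration.integrable_sum Di i2)
  also have "\<dots> = 2 * (LINT x|lebesgue. (norm (grad h x))\<^sup>2)"
    using Di i2 Dint by (simp add: Bochner_Integration.integral_add Bochner_Integration.integral_sum)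
  finally show "(LINT x|lebesgue. (h x)\<^sup>2 / (\<epsilon> + (norm x)\<^sup>2)) \<le> 4 * (LINT x|lebesgue. (norm (grad h x))\<^sup>2)"
    unfolding integral_mult_right_zero by linarith
qed

text \<open>Let \<open>\<epsilon> \<rightarrow> 0\<close> in Hardy's inequality, using Fatou's lemma.\<close>

lemma integrable_sq_divide_norm_sq:
  fixes h :: "real ^ 'n \<Rightarrow> real"
  assumes N: "CARD('n) \<ge> 3" and h: "h \<in> Cc_inf"
  shows "integrable lebesgue (\<lambda>x. (h x)\<^sup>2 / (norm x)\<^sup>2)"
proof (rule integrableI_bounded)
  have sm: "smooth h" using h by (rule Cc_inf_smooth)
  have hm[measurable]: "h \<in> borel_measurable lebesgue"
    by (intro continuous_imp_measurable_lebesgue smooth_imp_continuous sm)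
  have nm[measurable]: "(norm :: real^'n \<Rightarrow> real) \<in> borel_measurable lebesgue"
    by (intro continuous_imp_measurable_lebesgue continuous_on_norm continuous_on_id)
  show "(\<lambda>x. (h x)\<^sup>2 / (norm x)\<^sup>2) \<in> borel_measurable lebesgue" by measurable
  define G where "G = (LINT x|lebesgue. (norm (grad h x))\<^sup>2)"
  let ?f = "\<lambda>n x. (h x)\<^sup>2 / (1 / real (Suc n) + (norm x)\<^sup>2)"
  have b: "(\<integral>\<^sup>+x. ennreal (?f n x) \<partial>lebesgue) \<le> ennreal (4 * G)" for n
  proof -
    note H = Hardy_inequality[OF N h, of "1 / real (Suc n)"]
    have "(\<integral>\<^sup>+x. ennreal (?f n x) \<partial>lebesgue) = ennreal (LINT x|lebesgue. ?f n x)"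
      by (intro nn_integral_eq_integral H(1) AE_I2) (auto intro!: divide_nonneg_nonneg add_nonneg_nonneg)
    also have "\<dots> \<le> ennreal (4 * G)" unfolding G_def by (intro ennreal_leI H(3)) simp
    finally show ?thesis .
  qed
  have "(\<integral>\<^sup>+x. ennreal (norm ((h x)\<^sup>2 / (norm x)\<^sup>2)) \<partial>lebesgue) \<le> (\<integral>\<^sup>+x. liminf (\<lambda>n. ennreal (?f n x)) \<partial>lebesgue)"
  proof (rule nn_integral_mono)
    fix x :: "real^'n"
    show "ennreal (norm ((h x)\<^sup>2 / (norm x)\<^sup>2)) \<le> liminf (\<lambda>n. ennreal (?f n x))"
    proof (cases "x = 0")
      case False
      have "(\<lambda>n. 1 / real (Suc n)) \<longlonglongrightarrow> 0" by real_asymp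
      then have "(\<lambda>n. ennreal (?f n x)) \<longlonglongrightarrow> ennreal ((h x)\<^sup>2 / (0 + (norm x)\<^sup>2))"
        using False by (intro tendsto_ennrealI tendsto_divide tendsto_add tendsto_const) auto
      from lim_imp_Liminf[OF _ this] show ?thesis by simp
    qed simp
  qed
  also have "\<dots> \<le> liminf (\<lambda>n. \<integral>\<^sup>+x. ennreal (?f n x) \<partial>lebesgue)"
    by (rule nn_integral_liminf) measurable
  also have "\<dots> \<le> ennreal (4 * G)"
  proof (rule order_trans[OF Liminf_le_Limsup])
    show "limsup (\<lambda>n. \<integral>\<^sup>+x. ennreal (?f n x) \<partial>lebesgue) \<le> ennreal (4 * G)"
      by (rule Limsup_bounded) (intro always_eventually allI b)
  qed simp
  also have "\<dots> < \<infinity>" by simp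
  finally show "(\<integral>\<^sup>+x. ennreal (norm ((h x)\<^sup>2 / (norm x)\<^sup>2)) \<partial>lebesgue) < \<infinity>" .
qed

lemma Hardy_local:
  fixes h :: "real ^ 'n \<Rightarrow> real"
  assumes N: "CARD('n) \<ge> 3" and h: "h \<in> Cc_inf" and r: "r \<ge> 0"
  shows "(\<integral>\<^sup>+x\<in>cball 0 r. ennreal ((h x)\<^sup>2) \<partial>lebesgue)
    \<le> ennreal (4 * (1 + r\<^sup>2) * (LINT x|lebesgue. (norm (grad h x))\<^sup>2))"
proof -
  note H = Hardy_inequality[OF N h zero_less_one]
  have "(\<integral>\<^sup>+x\<in>cball 0 r. ennreal ((h x)\<^sup>2) \<partial>lebesgue)
      \<le> (\<integral>\<^sup>+x. ennreal ((1 + r\<^sup>2) * ((h x)\<^sup>2 / (1 + (norm x)\<^sup>2))) \<partial>lebesgue)"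
  proof (rule nn_integral_mono)
    fix x :: "real^'n"
    have p: "1 + (norm x)\<^sup>2 > 0" by (simp add: add_pos_nonneg)
    have "(h x)\<^sup>2 \<le> (1 + r\<^sup>2) * ((h x)\<^sup>2 / (1 + (norm x)\<^sup>2))" if "norm x \<le> r"
    proof -
      have "(norm x)\<^sup>2 \<le> r\<^sup>2" using that by (intro power_mono) auto
      then have "(1 + (norm x)\<^sup>2) * ((h x)\<^sup>2 / (1 + (norm x)\<^sup>2)) \<le> (1 + r\<^sup>2) * ((h x)\<^sup>2 / (1 + (norm x)\<^sup>2))"
        using p by (intro mult_right_mono) auto
      then show ?thesis using p by simp
    qed
    then show "ennreal ((h x)\<^sup>2) * indicator (cball 0 r) x \<le> ennreal ((1 + r\<^sup>2) * ((h x)\<^sup>2 / (1 + (norm x)\<^sup>2)))"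
      by (auto split: split_indicator intro!: ennreal_leI)
  qed
  also have "\<dots> = ennreal (LINT x|lebesgue. (1 + r\<^sup>2) * ((h x)\<^sup>2 / (1 + (norm x)\<^sup>2)))"
    using H(1) by (intro nn_integral_eq_integral integrable_mult_right) (auto simp: add_nonneg_nonneg)
  also have "\<dots> \<le> ennreal (4 * (1 + r\<^sup>2) * (LINT x|lebesgue. (norm (grad h x))\<^sup>2))"
  proof (rule ennreal_leI)
    have "(1 + r\<^sup>2) * (LINT x|lebesgue. (h x)\<^sup>2 / (1 + (norm x)\<^sup>2)) \<le> (1 + r\<^sup>2) * (4 * (LINT x|lebesgue. (norm (grad h x))\<^sup>2))"
      by (rule mult_left_mono[OF H(3)]) simp
    then show "(LINT x|lebesgue. (1 + r\<^sup>2) * ((h x)\<^sup>2 / (1 + (norm x)\<^sup>2))) \<le> 4 * (1 + r\<^sup>2) * (LINT x|lebesgue. (norm (grad h x))\<^sup>2)"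
      unfolding integral_mult_right_zero by (simp only: mult.assoc mult.left_commute)
  qed
  finally show ?thesis .
qed

section \<open>Functions with a small gradient are small as distributions\<close>

lemma has_real_derivative_integral_parameter:
  fixes \<Phi> \<Phi>' :: "real \<Rightarrow> 'a \<Rightarrow> real"
  assumes s: "l < s" "s < r"
    and d: "\<And>t x. l < t \<Longrightarrow> t < r \<Longrightarrow> ((\<lambda>t. \<Phi> t x) has_real_derivative \<Phi>' t x) (at t)"
    and b: "\<And>t x. l < t \<Longrightarrow> t < r \<Longrightarrow> \<bar>\<Phi>' t x\<bar> \<le> w x" and w: "integrable M w"
    and i: "\<And>t. l < t \<Longrightarrow> t < r \<Longrightarrow> integrable M (\<Phi> t)"
    and m: "\<Phi>' s \<in> borel_measurable M"
  shows "((\<lambda>t. LINT x|M. \<Phi> t x) has_real_derivative (LINT x|M. \<Phi>' s x)) (at s)"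
proof -
  have "((\<lambda>t. ((LINT x|M. \<Phi> t x) - (LINT x|M. \<Phi> s x)) / (t - s)) \<longlongrightarrow> (LINT x|M. \<Phi>' s x)) (at s within {l<..<r})"
    unfolding tendsto_at_iff_sequentially comp_def
  proof (intro allI impI)
    fix X :: "nat \<Rightarrow> real" assume X: "\<forall>n. X n \<in> {l<..<r} - {s}" "X \<longlonglongrightarrow> s"
    then have X': "l < X n" "X n < r" "X n \<noteq> s" for n by auto
    have "(\<lambda>n. LINT x|M. (\<Phi> (X n) x - \<Phi> s x) / (X n - s)) \<longlonglongrightarrow> (LINT x|M. \<Phi>' s x)"
    proof (rule integral_dominated_convergence[OF m _ w])
      show "(\<lambda>x. (\<Phi> (X n) x - \<Phi> s x) / (X n - s)) \<in> borel_measurable M" for n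
        using i[OF X'(1,2)] i[OF s] by (intro borel_measurable_divide borel_measurable_diff) auto
      show "AE x in M. (\<lambda>n. (\<Phi> (X n) x - \<Phi> s x) / (X n - s)) \<longlonglongrightarrow> \<Phi>' s x"
      proof (rule AE_I2)
        fix x
        have "((\<lambda>t. (\<Phi> t x - \<Phi> s x) / (t - s)) \<longlongrightarrow> \<Phi>' s x) (at s)"
          using d[OF s] by (simp add: has_field_derivative_iff)
        moreover have "filterlim X (at s) sequentially"
          using X X' by (auto simp: filterlim_at)
        ultimately show "(\<lambda>n. (\<Phi> (X n) x - \<Phi> s x) / (X n - s)) \<longlonglongrightarrow> \<Phi>' s x"
          by (rule filterlim_compose)
      qed
      show "AE x in M. norm ((\<Phi> (X n) x - \<Phi> s x) / (X n - s)) \<le> w x" for n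
      proof (rule AE_I2)
        fix x
        have "norm (\<Phi> (X n) x - \<Phi> s x) \<le> w x * norm (X n - s)"
        proof (rule field_differentiable_bound[where S="{l<..<r}" and f'="\<lambda>t. \<Phi>' t x"])
          show "((\<lambda>t. \<Phi> t x) has_field_derivative \<Phi>' t x) (at t within {l<..<r})" if "t \<in> {l<..<r}" for t
            using d[of t x] that by (auto intro: has_field_derivative_at_within)
        qed (use b X' s in auto)
        then show "norm ((\<Phi> (X n) x - \<Phi> s x) / (X n - s)) \<le> w x"
          using X'(3)[of n] by (simp add: norm_divide divide_le_eq)
      qed
    qed
    moreover have "(LINT x|M. (\<Phi> (X n) x - \<Phi> s x) / (X n - s)) = ((LINT x|M. \<Phi> (X n) x) - (LINT x|M. \<Phi> s x)) / (X n - s)" for n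
      unfolding integral_divide_zero Bochner_Integration.integral_diff[OF i[OF X'(1,2)] i[OF s]] ..
    ultimately show "(\<lambda>n. ((LINT x|M. \<Phi> (X n) x) - (LINT x|M. \<Phi> s x)) / (X n - s)) \<longlonglongrightarrow> (LINT x|M. \<Phi>' s x)"
      by (simp only:)
  qed
  moreover have "at s within {l<..<r} = at s" using s by (intro at_within_open) auto
  ultimately show ?thesis unfolding has_field_derivative_iff by (simp only:)
qed

lemma integral_weak_gradient_field:
  assumes w: "has_weak_gradient u U" and \<psi>: "\<And>i. \<psi> i \<in> Cc_inf"
  shows "(LINT x|lebesgue. u x * (\<Sum>i\<in>UNIV. grad (\<psi> i) x $ i)) = - (LINT x|lebesgue. (\<Sum>i\<in>UNIV. \<psi> i x * U x $ i))"
    and "integrable lebesgue (\<lambda>x. (\<Sum>i\<in>UNIV. \<psi> i x * U x $ i))"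
    and "integrable lebesgue (\<lambda>x. u x * (\<Sum>i\<in>UNIV. grad (\<psi> i) x $ i))"
proof -
  note c = has_weak_gradient_component[OF w \<psi>]
  show "integrable lebesgue (\<lambda>x. (\<Sum>i\<in>UNIV. \<psi> i x * U x $ i))"
    by (intro Bochner_Integration.integrable_sum c)
  show "integrable lebesgue (\<lambda>x. u x * (\<Sum>i\<in>UNIV. grad (\<psi> i) x $ i))"
    unfolding sum_distrib_left by (intro Bochner_Integration.integrable_sum c)
  show "(LINT x|lebesgue. u x * (\<Sum>i\<in>UNIV. grad (\<psi> i) x $ i)) = - (LINT x|lebesgue. (\<Sum>i\<in>UNIV. \<psi> i x * U x $ i))"
    unfolding sum_distrib_left
    by (subst (1 2) Bochner_Integration.integral_sum) (auto simp: c sum_negf)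
qed

text \<open>Up to an arbitrarily small constant, a function is dominated by a multiple of its \<open>p\<close>-th power. This
  replaces Hoelder's inequality where only a qualitative limit is needed.\<close>

lemma le_small_plus_power:
  fixes t e p :: real
  assumes "t \<ge> 0" "e > 0" "p \<ge> 1"
  shows "t \<le> e + e powr (1 - p) * t powr p"
proof (cases "t \<le> e")
  case False
  then have t: "t > 0" "t > e" using assms by auto
  have "t = t powr (1 - p) * t powr p"
    using t by (simp add: powr_add[symmetric])
  also have "\<dots> \<le> e powr (1 - p) * t powr p"
    using t assms by (intro mult_right_mono powr_mono2') auto
  finally show ?thesis using assms by simp
qed (use assms in \<open>simp add: add_increasing2\<close>)

text \<open>For a test function \<open>\<eta>\<close> the dilated averages \<open>M s = \<integral> v x * s\<^sup>N \<eta> (s x)\<close> interpolate between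
  \<open>\<integral> v \<eta>\<close> at \<open>s = 1\<close> and \<open>0\<close> at \<open>s = 0\<close>, the latter because \<open>|v| powr p\<close> is
  integrable. The derivative of \<open>s\<^sup>N \<eta> (s x)\<close> with respect to \<open>s\<close> is the divergence of \<open>s\<^bsup>N-1\<^esup> \<eta> (s x) x\<close>, so
  \<open>M'\<close> only sees the gradient of \<open>v\<close>; by Young's inequality it is \<open>O (s powr (-1/2))\<close> in dimension at least
  three, hence integrable near \<open>0\<close>.\<close>

lemma test_integral_le_gradient:
  fixes \<eta> :: "real ^ 'n \<Rightarrow> real"
  assumes N: "CARD('n) \<ge> 3" and \<eta>: "\<eta> \<in> Cc_inf"
  obtains C where "C \<ge> 0"
    "\<And>v V p a. has_weak_gradient v V \<Longrightarrow> integrable lebesgue (\<lambda>x. (norm (V x))\<^sup>2) \<Longrightarrow> p \<ge> 1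
      \<Longrightarrow> integrable lebesgue (\<lambda>x. \<bar>v x\<bar> powr p) \<Longrightarrow> a > 0
      \<Longrightarrow> \<bar>LINT x|lebesgue. v x * \<eta> x\<bar> \<le> C * (a * (LINT x|lebesgue. (norm (V x))\<^sup>2) + 1 / a)"
proof -
  obtain \<rho> A where "test_bound \<eta> \<rho> A" using Cc_inf_test_bound[OF \<eta>] by blast
  note rB = test_boundD[OF this]
  have sm: "smooth \<eta>" using \<eta> by (rule Cc_inf_smooth)
  define n where "n = CARD('n)"
  have n3: "n \<ge> 3" using N by (simp add: n_def)
  then obtain k where nk: "n = 3 + k" using le_Suc_ex by blast
  define vol where "vol = measure lborel (cball (0::real^'n) \<rho>)"
  have vol0: "vol \<ge> 0" by (simp add: vol_def)
  have ball: "integrable lebesgue (indicator (cball 0 (\<rho> / s)) :: real^'n \<Rightarrow> real)"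
    "(LINT x|lebesgue. indicator (cball (0::real^'n) (\<rho> / s)) x) = vol / s ^ n" if "s > 0" for s
  proof -
    show "integrable lebesgue (indicator (cball 0 (\<rho> / s)) :: real^'n \<Rightarrow> real)" by (rule integrable_indicator_cball)
    have "(LINT x|lebesgue. indicator (cball (0::real^'n) (\<rho> / s)) x) = measure lborel (cball (0::real^'n) (\<rho> / s))"
      by simp
    also have "\<dots> = vol / s ^ n"
      using that rB(1) by (simp add: vol_def content_cball n_def power_divide)
    finally show "(LINT x|lebesgue. indicator (cball (0::real^'n) (\<rho> / s)) x) = vol / s ^ n" .
  qed
  define C where "C = A * \<rho> * (1 + vol)"
  show ?thesis
  proof (rule that[of C])
    show "C \<ge> 0" using rB(1,2) vol0 by (simp add: C_def)
    fix v :: "real^'n \<Rightarrow> real" and V and p a :: real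
    assume w: "has_weak_gradient v V" and V2: "integrable lebesgue (\<lambda>x. (norm (V x))\<^sup>2)"
      and p: "p \<ge> 1" and vp: "integrable lebesgue (\<lambda>x. \<bar>v x\<bar> powr p)" and a: "a > 0"
    have vl: "loc_integrable v" "loc_integrable V" using w by (auto simp: has_weak_gradient_def)
    have vm: "v \<in> borel_measurable lebesgue" by (rule loc_integrable_measurable[OF vl(1)])
    define \<Phi> where "\<Phi> s x = v x * (s ^ n * \<eta> (s *\<^sub>R x))" for s x
    define \<Phi>' where "\<Phi>' s x = v x * (real n * s ^ (n - 1) * \<eta> (s *\<^sub>R x) + s ^ n * (grad \<eta> (s *\<^sub>R x) \<bullet> x))" for s x
    define M where "M s = (LINT x|lebesgue. \<Phi> s x)" for s
    have far: "norm (s *\<^sub>R x) \<ge> \<rho>" if "s > 0" "norm x \<ge> \<rho> / s" for s and x :: "real^'n"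
      using that by (simp add: field_simps)
    have c\<eta>: "continuous_on UNIV (\<lambda>x. \<eta> (s *\<^sub>R x))" "continuous_on UNIV (\<lambda>x. grad \<eta> (s *\<^sub>R x))" for s
      by (auto intro!: continuous_intros continuous_on_compose2[OF smooth_imp_continuous[OF sm]]
           continuous_on_compose2[OF continuous_grad[OF sm]])
    have \<Phi>i: "integrable lebesgue (\<Phi> s)" if s: "s > 0" for s
    proof -
      have "integrable lebesgue (\<lambda>x. (s ^ n * \<eta> (s *\<^sub>R x)) *\<^sub>R v x)"
      proof (rule loc_integrable_times_test[OF vl(1), where r="\<rho> / s" and B="s ^ n * A"])
        show "(\<lambda>x. s ^ n * \<eta> (s *\<^sub>R x)) \<in> borel_measurable lebesgue"
          by (intro continuous_imp_measurable_lebesgue continuous_intros c\<eta>)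
      qed (use s rB far in \<open>auto simp: abs_mult intro!: mult_left_mono\<close>)
      then show ?thesis by (simp add: \<Phi>_def[abs_def] mult.commute)
    qed
    have dM: "(M has_real_derivative (LINT x|lebesgue. \<Phi>' s x)) (at s)" if s: "s > 0" for s
      unfolding M_def
    proof (rule has_real_derivative_integral_parameter[where l="s/2" and r="2 * s"])
      let ?B = "real n * (2 * s) ^ (n - 1) * A + (2 * s) ^ n * (A * (\<rho> / (s / 2)))"
      show "((\<lambda>t. \<Phi> t x) has_real_derivative \<Phi>' t x) (at t)" for t x
      proof -
        have "((\<lambda>t. t *\<^sub>R x) has_derivative (\<lambda>h. h *\<^sub>R x)) (at t)" by (auto intro!: derivative_eq_intros)
        from has_derivative_compose[OF this grad_inner[OF smooth_imp_differentiable[OF sm]]]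
        have 1: "((\<lambda>t. \<eta> (t *\<^sub>R x)) has_real_derivative (grad \<eta> (t *\<^sub>R x) \<bullet> x)) (at t)"
          unfolding has_field_derivative_def by (rule has_derivative_eq_rhs) (simp add: fun_eq_iff mult.commute)
        have "((\<lambda>t. t ^ n) has_real_derivative real n * t ^ (n - 1)) (at t)"
          using DERIV_pow[of n t] by simp
        from DERIV_cmult[OF DERIV_mult[OF this 1], of "v x"]
        show ?thesis unfolding \<Phi>_def \<Phi>'_def by (rule DERIV_cong) (simp add: algebra_simps)
      qed
      show "\<bar>\<Phi>' t x\<bar> \<le> ?B * (indicator (cball 0 (\<rho> / (s / 2))) x * \<bar>v x\<bar>)" if t: "s / 2 < t" "t < 2 * s" for t x
      proof (cases "norm x \<le> \<rho> / (s / 2)")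
        case True
        have t0: "t > 0" using t s by simp
        have tp: "t ^ k \<le> (2 * s) ^ k" for k
          by (rule power_mono) (use t t0 in auto)
        have "\<bar>real n * t ^ (n - 1) * \<eta> (t *\<^sub>R x)\<bar> \<le> real n * (2 * s) ^ (n - 1) * A"
          unfolding abs_mult using t0 tp[of "n - 1"] rB(2) s by (intro mult_mono rB(3)) (auto simp del: power_mult_distrib)
        moreover have "\<bar>grad \<eta> (t *\<^sub>R x) \<bullet> x\<bar> \<le> A * (\<rho> / (s / 2))"
          using Cauchy_Schwarz_ineq2[of "grad \<eta> (t *\<^sub>R x)" x] mult_mono[OF rB(4)[of "t *\<^sub>R x"] True] rB(2) by simp
        then have "\<bar>t ^ n * (grad \<eta> (t *\<^sub>R x) \<bullet> x)\<bar> \<le> (2 * s) ^ n * (A * (\<rho> / (s / 2)))"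
          unfolding abs_mult using t0 s tp[of n] by (intro mult_mono) (auto simp del: power_mult_distrib)
        ultimately have "\<bar>real n * t ^ (n - 1) * \<eta> (t *\<^sub>R x) + t ^ n * (grad \<eta> (t *\<^sub>R x) \<bullet> x)\<bar> \<le> ?B" by linarith
        then have "\<bar>\<Phi>' t x\<bar> \<le> \<bar>v x\<bar> * ?B" unfolding \<Phi>'_def abs_mult by (intro mult_left_mono) auto
        then show ?thesis using True by (simp add: mult.commute)
      next
        case False
        have t0: "t > 0" using t s by simp
        have "\<rho> / t \<le> \<rho> / (s / 2)" using t t0 s rB(1) by (intro divide_left_mono) auto
        then have "norm (t *\<^sub>R x) \<ge> \<rho>" using False t0 by (intro far) auto
        then show ?thesis using False rB(5,6) by (simp add: \<Phi>'_def)
      qed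
      show "integrable lebesgue (\<lambda>x. ?B * (indicator (cball 0 (\<rho> / (s / 2))) x * \<bar>v x\<bar>))"
        using integrable_norm[OF vl(1)[rule_format, OF compact_cball, of 0 "\<rho> / (s / 2)", unfolded set_integrable_def]]
        by (intro integrable_mult_right) (simp add: abs_mult)
      show "\<Phi>' s \<in> borel_measurable lebesgue"
        unfolding \<Phi>'_def[abs_def]
        by (intro borel_measurable_times vm continuous_imp_measurable_lebesgue continuous_intros c\<eta>)
    qed (use s \<Phi>i in auto)
    define G where "G = (LINT x|lebesgue. (norm (V x))\<^sup>2)"
    define B where "B = A * \<rho> * (a * G + vol / a) / 2"
    have M'b: "\<bar>LINT x|lebesgue. \<Phi>' s x\<bar> \<le> B / sqrt s" if s: "s > 0" "s \<le> 1" for s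
    proof -
      define \<psi> where "\<psi> i x = x $ i * (s ^ (n - 1) * \<eta> (s *\<^sub>R x))" for i and x :: "real^'n"
      have sm\<eta>: "smooth (\<lambda>x. \<eta> (s *\<^sub>R x))"
        by (intro allI C_k_compose_scaleR[OF sm[rule_format]])
      have sm1: "smooth (\<lambda>x. s ^ (n - 1) * \<eta> (s *\<^sub>R x))"
        by (intro allI C_k_mult[OF C_k_const sm\<eta>[rule_format]])
      have smi: "smooth (\<lambda>x. x $ i)" for i :: 'n by (simp add: smooth_component)
      have \<psi>: "\<psi> i \<in> Cc_inf" for i
      proof (rule Cc_infI[where r="\<rho> / s"])
        show "smooth (\<psi> i)" unfolding \<psi>_def by (intro allI C_k_mult[OF smi[rule_format] sm1[rule_format]])
      qed (use s rB far in \<open>auto simp: \<psi>_def\<close>)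
      have gi: "grad (\<lambda>x. x $ i) x = axis i 1" for i :: 'n and x :: "real^'n"
        by (rule grad_eqI) (auto simp: inner_axis' intro!: bounded_linear_imp_has_derivative bounded_linear_vec_nth)
      have g\<psi>: "grad (\<psi> i) x $ i = x $ i * (s ^ (n - 1) * (s * grad \<eta> (s *\<^sub>R x) $ i)) + s ^ (n - 1) * \<eta> (s *\<^sub>R x)" for i x
      proof -
        have "grad (\<lambda>x. s ^ (n - 1) * \<eta> (s *\<^sub>R x)) x = s ^ (n - 1) *\<^sub>R s *\<^sub>R grad \<eta> (s *\<^sub>R x)"
          using grad_mult[OF _ sm\<eta>, of "\<lambda>_. s ^ (n - 1)" x]
          by (simp add: grad_const grad_compose_scaleR[OF sm])
        then show ?thesis
          unfolding \<psi>_def using grad_mult[OF smi sm1, of i x] by (simp add: gi axis_def)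
      qed
      have "(\<Sum>i\<in>UNIV. grad (\<psi> i) x $ i) = real n * s ^ (n - 1) * \<eta> (s *\<^sub>R x) + s ^ n * (grad \<eta> (s *\<^sub>R x) \<bullet> x)" for x
      proof -
        have "s ^ n = s ^ (n - 1) * s" by (simp add: nk eval_nat_numeral)
        then show ?thesis
          by (simp add: g\<psi> sum.distrib inner_vec_def n_def sum_distrib_left mult_ac)
      qed
      then have "(LINT x|lebesgue. \<Phi>' s x) = - (LINT x|lebesgue. (\<Sum>i\<in>UNIV. \<psi> i x * V x $ i))"
        using integral_weak_gradient_field(1)[where \<psi>=\<psi>, OF w \<psi>] unfolding \<Phi>'_def by (simp only:)
      then have "\<bar>LINT x|lebesgue. \<Phi>' s x\<bar> = \<bar>LINT x|lebesgue. (\<Sum>i\<in>UNIV. \<psi> i x * V x $ i)\<bar>" by simp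
      \<comment> \<open>This weight in Young's inequality makes both terms of order \<open>s powr (-1/2)\<close>, using \<open>n \<ge> 3\<close>.\<close>
      define \<kappa> where "\<kappa> = a / (s * sqrt s)"
      have \<kappa>: "\<kappa> > 0" using a s by (simp add: \<kappa>_def)
      define D where "D = s ^ (n - 2) * A * \<rho> / 2"
      have D0: "D \<ge> 0" using s rB by (simp add: D_def)
      let ?w = "\<lambda>x. D * (\<kappa> * (norm (V x))\<^sup>2 + 1 / \<kappa> * indicator (cball 0 (\<rho> / s)) x)"
      have pt: "\<bar>\<Sum>i\<in>UNIV. \<psi> i x * V x $ i\<bar> \<le> ?w x" for x
      proof -
        have e: "(\<Sum>i\<in>UNIV. \<psi> i x * V x $ i) = s ^ (n - 1) * \<eta> (s *\<^sub>R x) * (x \<bullet> V x)"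
          by (simp add: \<psi>_def inner_vec_def sum_distrib_left mult_ac)
        show ?thesis
        proof (cases "norm x \<le> \<rho> / s")
          case True
          have sp: "s ^ (n - 1) = s ^ (n - 2) * s"
            by (simp add: nk eval_nat_numeral)
          have "\<bar>\<Sum>i\<in>UNIV. \<psi> i x * V x $ i\<bar> = s ^ (n - 1) * \<bar>\<eta> (s *\<^sub>R x)\<bar> * \<bar>x \<bullet> V x\<bar>"
            using s by (simp add: e abs_mult)
          also have "\<dots> \<le> s ^ (n - 1) * A * ((\<rho> / s) * norm (V x))"
          proof -
            have "\<bar>x \<bullet> V x\<bar> \<le> norm x * norm (V x)" by (rule Cauchy_Schwarz_ineq2)
            also have "\<dots> \<le> (\<rho> / s) * norm (V x)" using True by (intro mult_right_mono) auto
            finally show ?thesis using s rB(2,3) by (intro mult_mono) auto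
          qed
          also have "\<dots> = 2 * D * norm (V x)" unfolding sp D_def using s by simp
          also have "\<dots> \<le> D * (\<kappa> * (norm (V x))\<^sup>2 + 1 / \<kappa>)"
          proof -
            have "0 \<le> (\<kappa> * norm (V x) - 1)\<^sup>2 / \<kappa>" using \<kappa> by simp
            also have "\<dots> = \<kappa> * (norm (V x))\<^sup>2 + 1 / \<kappa> - 2 * norm (V x)"
              using \<kappa> by (simp add: power2_diff power_mult_distrib field_simps power2_eq_square)
            finally have "2 * norm (V x) \<le> \<kappa> * (norm (V x))\<^sup>2 + 1 / \<kappa>" by linarith
            from mult_left_mono[OF this D0] show ?thesis by (simp only: mult.assoc mult.left_commute)
          qed
          finally show ?thesis using True by simp
        next
          case False
          then have "norm (s *\<^sub>R x) \<ge> \<rho>" using s by (intro far) auto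
          then show ?thesis using False rB(5) D0 \<kappa> by (simp add: e)
        qed
      qed
      have wi: "integrable lebesgue ?w"
        using V2 ball(1)[OF s(1)] by (intro integrable_mult_right Bochner_Integration.integrable_add) auto
      have "\<bar>LINT x|lebesgue. (\<Sum>i\<in>UNIV. \<psi> i x * V x $ i)\<bar> \<le> (LINT x|lebesgue. \<bar>\<Sum>i\<in>UNIV. \<psi> i x * V x $ i\<bar>)"
        by (rule integral_abs_bound)
      also have "\<dots> \<le> (LINT x|lebesgue. ?w x)"
        using integral_weak_gradient_field(2)[where \<psi>=\<psi>, OF w \<psi>] by (intro integral_mono integrable_abs wi pt)
      also have "\<dots> = D * (\<kappa> * G + 1 / \<kappa> * (vol / s ^ n))"
        using V2 ball[OF s(1)] by (simp add: G_def)
      also have "\<dots> \<le> B / sqrt s"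
      proof -
        have G0: "G \<ge> 0" by (simp add: G_def)
        have sn: "s ^ n = s ^ (n - 2) * s\<^sup>2"
          by (simp add: nk eval_nat_numeral)
        have s2: "s ^ (n - 2) \<le> s" using power_decreasing[of 1 "n - 2" s] s n3 by simp
        have q: "sqrt s > 0" "sqrt s * sqrt s = s" using s by auto
        have "s ^ (n - 2) * \<kappa> \<le> a / sqrt s"
        proof -
          have "s ^ (n - 2) * \<kappa> \<le> s * \<kappa>" using s2 \<kappa> by (intro mult_right_mono) auto
          also have "\<dots> = a / sqrt s" using s by (simp add: \<kappa>_def)
          finally show ?thesis .
        qed
        then have 1: "s ^ (n - 2) * \<kappa> * G \<le> a / sqrt s * G" using G0 by (rule mult_right_mono)
        have 2: "s ^ (n - 2) * (1 / \<kappa> * (vol / s ^ n)) = vol / a / sqrt s"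
          unfolding sn \<kappa>_def using s a q by (simp add: field_simps power2_eq_square)
        have "D * (\<kappa> * G + 1 / \<kappa> * (vol / s ^ n)) = A * \<rho> / 2 * (s ^ (n - 2) * \<kappa> * G + s ^ (n - 2) * (1 / \<kappa> * (vol / s ^ n)))"
          by (simp add: D_def algebra_simps)
        also have "\<dots> \<le> A * \<rho> / 2 * (a / sqrt s * G + vol / a / sqrt s)"
          unfolding 2 using 1 rB by (intro mult_left_mono) auto
        also have "\<dots> = B / sqrt s" by (simp add: B_def add_divide_distrib algebra_simps)
        finally show ?thesis .
      qed
      finally show ?thesis using \<open>\<bar>LINT x|lebesgue. \<Phi>' s x\<bar> = _\<close> by simp
    qed
    \<comment> \<open>\<open>2 * B * sqrt s\<close> is a primitive of the bound for \<open>M'\<close>.\<close>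
    have Mdiff: "\<bar>M 1\<bar> \<le> \<bar>M s\<bar> + 2 * B" if s: "0 < s" "s < 1" for s
    proof -
      have sq: "((\<lambda>s. 2 * B * sqrt s) has_real_derivative B / sqrt t) (at t)" if "t > 0" for t
        by (rule DERIV_cong[OF DERIV_cmult[OF DERIV_real_sqrt[OF that]]]) (simp add: inverse_eq_divide)
      have le: "\<bar>LINT x|lebesgue. \<Phi>' t x\<bar> \<le> B / sqrt t" if "s \<le> t" "t \<le> 1" for t
        using M'b[of t] that s by auto
      have "2 * B * sqrt s - M s \<le> 2 * B * sqrt 1 - M 1"
      proof (rule DERIV_nonneg_imp_nondecreasing[of s 1 "\<lambda>s. 2 * B * sqrt s - M s"])
        fix t assume t: "s \<le> t" "t \<le> 1"
        show "\<exists>y. ((\<lambda>s. 2 * B * sqrt s - M s) has_real_derivative y) (at t) \<and> 0 \<le> y"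
          using le[OF t] DERIV_diff[OF sq dM, of t] t s
          by (intro exI[of _ "B / sqrt t - (LINT x|lebesgue. \<Phi>' t x)"]) auto
      qed (use s in auto)
      moreover have "2 * B * sqrt s + M s \<le> 2 * B * sqrt 1 + M 1"
      proof (rule DERIV_nonneg_imp_nondecreasing[of s 1 "\<lambda>s. 2 * B * sqrt s + M s"])
        fix t assume t: "s \<le> t" "t \<le> 1"
        show "\<exists>y. ((\<lambda>s. 2 * B * sqrt s + M s) has_real_derivative y) (at t) \<and> 0 \<le> y"
          using le[OF t] DERIV_add[OF sq dM, of t] t s
          by (intro exI[of _ "B / sqrt t + (LINT x|lebesgue. \<Phi>' t x)"]) auto
      qed (use s in auto)
      moreover have "B \<ge> 0" using rB a vol0 by (simp add: B_def G_def)
      then have "2 * B * sqrt s \<ge> 0" using s by simp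
      ultimately show ?thesis by (simp only: real_sqrt_one mult_1_right)
    qed
    define P where "P = (LINT x|lebesgue. \<bar>v x\<bar> powr p)"
    have Msmall: "\<bar>M s\<bar> \<le> A * vol * e + A * s ^ n * (e powr (1 - p) * P)" if s: "0 < s" and e: "e > 0" for s e
    proof -
      let ?w = "\<lambda>x. A * s ^ n * (e * indicator (cball 0 (\<rho> / s)) x + e powr (1 - p) * \<bar>v x\<bar> powr p)"
      have wi: "integrable lebesgue ?w"
        using vp ball(1)[OF s] by (intro integrable_mult_right Bochner_Integration.integrable_add) auto
      have "\<bar>M s\<bar> \<le> (LINT x|lebesgue. \<bar>\<Phi> s x\<bar>)" unfolding M_def by (rule integral_abs_bound)
      also have "\<dots> \<le> (LINT x|lebesgue. ?w x)"
      proof (intro integral_mono integrable_abs wi \<Phi>i s)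
        fix x
        show "\<bar>\<Phi> s x\<bar> \<le> ?w x"
        proof (cases "norm x \<le> \<rho> / s")
          case True
          have "\<bar>\<Phi> s x\<bar> = s ^ n * \<bar>\<eta> (s *\<^sub>R x)\<bar> * \<bar>v x\<bar>" using s by (simp add: \<Phi>_def abs_mult)
          also have "\<dots> \<le> s ^ n * A * (e + e powr (1 - p) * \<bar>v x\<bar> powr p)"
            using s rB(2,3) by (intro mult_mono le_small_plus_power e p) auto
          finally show ?thesis using True by (simp add: mult.commute)
        next
          case False
          then have "norm (s *\<^sub>R x) \<ge> \<rho>" using s by (intro far) auto
          then show ?thesis using False rB s by (simp add: \<Phi>_def)
        qed
      qed
      also have "\<dots> = A * s ^ n * (e * (vol / s ^ n) + e powr (1 - p) * P)"
        using vp ball[OF s] by (simp add: P_def)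
      also have "\<dots> = A * vol * e + A * s ^ n * (e powr (1 - p) * P)"
        using s by (simp add: field_simps)
      finally show ?thesis .
    qed
    have lim: "\<bar>M 1\<bar> \<le> 2 * B + A * vol * e" if e: "e > 0" for e
    proof (rule tendsto_lowerbound)
      show "((\<lambda>s. 2 * B + A * vol * e + A * s ^ n * (e powr (1 - p) * P)) \<longlongrightarrow> 2 * B + A * vol * e) (at_right 0)"
      proof -
        have "((\<lambda>s. 2 * B + A * vol * e + A * s ^ n * (e powr (1 - p) * P)) \<longlongrightarrow> 2 * B + A * vol * e + A * 0 ^ n * (e powr (1 - p) * P)) (at_right 0)"
          by (intro tendsto_intros)
        moreover have "(0::real) ^ n = 0" using n3 by simp
        ultimately show ?thesis by (simp only: mult_zero_left mult_zero_right add_0_right)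
      qed
      show "\<forall>\<^sub>F s in at_right 0. \<bar>M 1\<bar> \<le> 2 * B + A * vol * e + A * s ^ n * (e powr (1 - p) * P)"
        using eventually_at_right_real[OF zero_less_one]
      proof eventually_elim
        fix s :: real assume "s \<in> {0<..<1}"
        then show "\<bar>M 1\<bar> \<le> 2 * B + A * vol * e + A * s ^ n * (e powr (1 - p) * P)"
          using Mdiff[of s] Msmall[OF _ e, of s] by auto
      qed
    qed simp
    have "\<bar>M 1\<bar> \<le> 2 * B + e" if e: "e > 0" for e
    proof (cases "vol = 0")
      case True
      then show ?thesis using lim[OF e] e by simp
    next
      case False
      then show ?thesis using lim[of "e / (A * vol)"] e rB(2) vol0 by simp
    qed
    then have "\<bar>M 1\<bar> \<le> 2 * B" by (rule field_le_epsilon)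
    also have "2 * B = A * \<rho> * (a * G + vol * (1 / a))" by (simp add: B_def)
    also have "\<dots> \<le> A * \<rho> * ((1 + vol) * (a * G + 1 / a))"
    proof -
      have "a * G \<ge> 0" "1 / a \<ge> 0" using a by (simp_all add: G_def)
      then have "0 \<le> vol * (a * G)" using vol0 by simp
      moreover have "(1 + vol) * (a * G + 1 / a) = a * G + vol * (1 / a) + vol * (a * G) + 1 / a"
        by (simp only: distrib_left distrib_right mult_1 add.assoc add.left_commute add.commute)
      ultimately have "a * G + vol * (1 / a) \<le> (1 + vol) * (a * G + 1 / a)" using \<open>1 / a \<ge> 0\<close> by linarith
      then show ?thesis using rB by (intro mult_left_mono) auto
    qed
    finally have "\<bar>M 1\<bar> \<le> C * (a * G + 1 / a)" by (simp add: C_def mult.assoc)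
    then show "\<bar>LINT x|lebesgue. v x * \<eta> x\<bar> \<le> C * (a * (LINT x|lebesgue. (norm (V x))\<^sup>2) + 1 / a)"
      by (simp add: M_def \<Phi>_def G_def)
  qed
qed

section \<open>Square integrable functions\<close>

lemma integral_Cauchy_Schwarz:
  fixes f g :: "'a \<Rightarrow> real"
  assumes m[measurable]: "f \<in> borel_measurable M" "g \<in> borel_measurable M"
    and f: "integrable M (\<lambda>x. (f x)\<^sup>2)" and g: "integrable M (\<lambda>x. (g x)\<^sup>2)"
  shows "integrable M (\<lambda>x. f x * g x)"
    and "\<bar>LINT x|M. f x * g x\<bar> \<le> sqrt (LINT x|M. (f x)\<^sup>2) * sqrt (LINT x|M. (g x)\<^sup>2)"
proof -
  have le: "\<bar>f x * g x\<bar> \<le> (f x)\<^sup>2 + (g x)\<^sup>2" for x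
  proof -
    have "2 * \<bar>f x\<bar> * \<bar>g x\<bar> \<le> (f x)\<^sup>2 + (g x)\<^sup>2"
      using sum_squares_bound[of "\<bar>f x\<bar>" "\<bar>g x\<bar>"] by simp
    moreover have "0 \<le> \<bar>f x\<bar> * \<bar>g x\<bar>" by simp
    ultimately show ?thesis unfolding abs_mult by linarith
  qed
  show i: "integrable M (\<lambda>x. f x * g x)"
    by (rule Bochner_Integration.integrable_bound[OF Bochner_Integration.integrable_add[OF f g]])
       (use le in \<open>auto intro!: AE_I2 intro: order_trans[OF _ abs_ge_self]\<close>)
  have "(\<integral>\<^sup>+x. ennreal \<bar>f x\<bar> * ennreal \<bar>g x\<bar> \<partial>M)\<^sup>2 \<le> (\<integral>\<^sup>+x. (ennreal \<bar>f x\<bar>)\<^sup>2 \<partial>M) * (\<integral>\<^sup>+x. (ennreal \<bar>g x\<bar>)\<^sup>2 \<partial>M)"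
    by (rule Cauchy_Schwarz_nn_integral) auto
  also have "(\<integral>\<^sup>+x. ennreal \<bar>f x\<bar> * ennreal \<bar>g x\<bar> \<partial>M) = ennreal (LINT x|M. \<bar>f x * g x\<bar>)"
    unfolding ennreal_mult'[OF abs_ge_zero, symmetric] abs_mult[symmetric]
    by (rule nn_integral_eq_integral) (use i in auto)
  also have "(\<integral>\<^sup>+x. (ennreal \<bar>f x\<bar>)\<^sup>2 \<partial>M) = ennreal (LINT x|M. (f x)\<^sup>2)"
    by (simp add: ennreal_power nn_integral_eq_integral f)
  also have "(\<integral>\<^sup>+x. (ennreal \<bar>g x\<bar>)\<^sup>2 \<partial>M) = ennreal (LINT x|M. (g x)\<^sup>2)"
    by (simp add: ennreal_power nn_integral_eq_integral g)
  finally have "(LINT x|M. \<bar>f x * g x\<bar>)\<^sup>2 \<le> (LINT x|M. (f x)\<^sup>2) * (LINT x|M. (g x)\<^sup>2)"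
    by (simp add: ennreal_power ennreal_mult[symmetric] ennreal_le_iff)
  then have "(LINT x|M. \<bar>f x * g x\<bar>) \<le> sqrt (LINT x|M. (f x)\<^sup>2) * sqrt (LINT x|M. (g x)\<^sup>2)"
    unfolding real_sqrt_mult[symmetric] by (rule real_le_rsqrt)
  then show "\<bar>LINT x|M. f x * g x\<bar> \<le> sqrt (LINT x|M. (f x)\<^sup>2) * sqrt (LINT x|M. (g x)\<^sup>2)"
    using integral_abs_bound[of M "\<lambda>x. f x * g x"] by linarith
qed

lemma norm_add_sq_le: "(norm (a + b))\<^sup>2 \<le> 2 * (norm a)\<^sup>2 + 2 * (norm (b::'a::real_normed_vector))\<^sup>2"
proof -
  have "(norm (a + b))\<^sup>2 \<le> (norm a + norm b)\<^sup>2" by (intro power_mono norm_triangle_ineq) auto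
  also have "\<dots> \<le> 2 * (norm a)\<^sup>2 + 2 * (norm b)\<^sup>2"
    using sum_squares_bound[of "norm a" "norm b"] by (simp add: power2_sum)
  finally show ?thesis .
qed

lemma integrable_norm_sq_add:
  fixes F G :: "'a \<Rightarrow> 'b::{banach, second_countable_topology}"
  assumes "F \<in> borel_measurable M" "G \<in> borel_measurable M"
    "integrable M (\<lambda>x. (norm (F x))\<^sup>2)" "integrable M (\<lambda>x. (norm (G x))\<^sup>2)"
  shows "integrable M (\<lambda>x. (norm (F x + G x))\<^sup>2)"
proof (rule Bochner_Integration.integrable_bound)
  show "integrable M (\<lambda>x. 2 * (norm (F x))\<^sup>2 + 2 * (norm (G x))\<^sup>2)" using assms by auto
  show "(\<lambda>x. (norm (F x + G x))\<^sup>2) \<in> borel_measurable M" using assms(1,2) by measurable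
qed (use norm_add_sq_le in \<open>auto intro!: AE_I2 intro: order_trans\<close>)

lemma integrable_norm_sq_diff:
  fixes F G :: "'a \<Rightarrow> 'b::{banach, second_countable_topology}"
  assumes "F \<in> borel_measurable M" "G \<in> borel_measurable M"
    "integrable M (\<lambda>x. (norm (F x))\<^sup>2)" "integrable M (\<lambda>x. (norm (G x))\<^sup>2)"
  shows "integrable M (\<lambda>x. (norm (F x - G x))\<^sup>2)"
  using integrable_norm_sq_add[of F M "\<lambda>x. - G x"] assms by simp

lemma square_integrable_imp_loc_integrable:
  fixes f :: "real ^ 'n \<Rightarrow> 'b::{banach, second_countable_topology}"
  assumes m: "f \<in> borel_measurable lebesgue"
    and i: "\<And>r. integrable lebesgue (\<lambda>x. indicator (cball 0 r) x * (norm (f x))\<^sup>2)"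
  shows "loc_integrable f"
proof (intro allI impI)
  fix S :: "(real ^ 'n) set" assume S: "compact S"
  then obtain r where r: "S \<subseteq> cball 0 r"
    using bounded_subset_ballD[of S 0] compact_imp_bounded ball_subset_cball by (meson order_trans)
  have Sm: "S \<in> sets lebesgue" using S by (auto intro: fmeasurableD lmeasurable_compact)
  show "set_integrable lebesgue S f"
    unfolding set_integrable_def
  proof (rule integrable_lebesgue_bound)
    show "integrable lebesgue (\<lambda>x. indicator (cball 0 r) x * (norm (f x))\<^sup>2 + indicator (cball 0 r) x)"
      by (intro Bochner_Integration.integrable_add i integrable_indicator_cball)
    show "(\<lambda>x. indicator S x *\<^sub>R f x) \<in> borel_measurable lebesgue"
      by (intro borel_measurable_scaleR borel_measurable_indicator Sm m)
    have "t \<le> t\<^sup>2 + 1" for t :: real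
      using zero_le_power2[of "t - 1 / 2"] by (simp add: power2_diff power_divide)
    then show "norm (indicator S x *\<^sub>R f x) \<le> indicator (cball 0 r) x * (norm (f x))\<^sup>2 + indicator (cball 0 r) x" for x
      using r by (auto split: split_indicator)
  qed
qed

lemma square_integrable_imp_loc_integrable':
  fixes F :: "real ^ 'n \<Rightarrow> 'b::{banach, second_countable_topology}"
  assumes m: "F \<in> borel_measurable lebesgue" and i: "integrable lebesgue (\<lambda>x. (norm (F x))\<^sup>2)"
  shows "loc_integrable F"
proof (rule square_integrable_imp_loc_integrable[OF m])
  show "integrable lebesgue (\<lambda>x. indicator (cball 0 r) x * (norm (F x))\<^sup>2)" for r
    using integrable_mult_indicator[OF _ i, of "cball 0 r"] by simp
qed

definition L2_loc_tendsto :: "(nat \<Rightarrow> real ^ 'n \<Rightarrow> real) \<Rightarrow> (real ^ 'n \<Rightarrow> real) \<Rightarrow> bool" where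
  "L2_loc_tendsto z u \<longleftrightarrow> (\<forall>r.
     (\<forall>n. integrable lebesgue (\<lambda>x. indicator (cball 0 r) x * (z n x - u x)\<^sup>2)) \<and>
     (\<lambda>n. LINT x|lebesgue. indicator (cball 0 r) x * (z n x - u x)\<^sup>2) \<longlonglongrightarrow> 0)"

text \<open>Strong convergence implies weak convergence, by the Cauchy-Schwarz inequality.\<close>

lemma L2_loc_tendsto_test:
  assumes lim: "L2_loc_tendsto z u"
    and m: "\<And>n. z n \<in> borel_measurable lebesgue" "u \<in> borel_measurable lebesgue" "\<psi> \<in> borel_measurable lebesgue"
    and sq: "integrable lebesgue (\<lambda>x. (\<psi> x)\<^sup>2)" and z: "\<And>x. norm x \<ge> r \<Longrightarrow> \<psi> x = 0"
  shows "integrable lebesgue (\<lambda>x. (z n x - u x) * \<psi> x)"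
    and "(\<lambda>n. LINT x|lebesgue. (z n x - u x) * \<psi> x) \<longlonglongrightarrow> 0"
proof -
  let ?f = "\<lambda>n x. indicator (cball 0 r) x * (z n x - u x)"
  have cm: "cball (0 :: real^'n) r \<in> sets lebesgue" by (auto intro: fmeasurableD)
  have f: "(?f n x)\<^sup>2 = indicator (cball 0 r) x * (z n x - u x)\<^sup>2" for n x
    by (auto split: split_indicator)
  have fm: "?f n \<in> borel_measurable lebesgue" for n
    by (intro borel_measurable_times borel_measurable_diff borel_measurable_indicator cm m)
  have fi: "integrable lebesgue (\<lambda>x. (?f n x)\<^sup>2)" for n
    using lim unfolding f L2_loc_tendsto_def by blast
  have e: "(z n x - u x) * \<psi> x = ?f n x * \<psi> x" for n x
    using z[of x] by (auto split: split_indicator)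
  note CS = integral_Cauchy_Schwarz[OF fm m(3) fi sq]
  show "integrable lebesgue (\<lambda>x. (z n x - u x) * \<psi> x)" unfolding e by (rule CS(1))
  show "(\<lambda>n. LINT x|lebesgue. (z n x - u x) * \<psi> x) \<longlonglongrightarrow> 0"
    unfolding e
  proof (rule Lim_null_comparison)
    show "\<forall>\<^sub>F n in sequentially. norm (LINT x|lebesgue. ?f n x * \<psi> x)
      \<le> sqrt (LINT x|lebesgue. (?f n x)\<^sup>2) * sqrt (LINT x|lebesgue. (\<psi> x)\<^sup>2)"
      using CS(2) by (intro always_eventually allI) simp
    have "(\<lambda>n. sqrt (LINT x|lebesgue. (?f n x)\<^sup>2) * sqrt (LINT x|lebesgue. (\<psi> x)\<^sup>2))
      \<longlonglongrightarrow> sqrt 0 * sqrt (LINT x|lebesgue. (\<psi> x)\<^sup>2)"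
      unfolding f by (intro tendsto_intros) (use lim in \<open>simp add: L2_loc_tendsto_def\<close>)
    then show "(\<lambda>n. sqrt (LINT x|lebesgue. (?f n x)\<^sup>2) * sqrt (LINT x|lebesgue. (\<psi> x)\<^sup>2)) \<longlonglongrightarrow> 0"
      by simp
  qed
qed

lemma Cc_inf_square_integrable:
  assumes "\<phi> \<in> Cc_inf"
  shows "integrable lebesgue (\<lambda>x. (\<phi> x)\<^sup>2)" "integrable lebesgue (\<lambda>x. (grad \<phi> x $ i)\<^sup>2)"
    "integrable lebesgue (\<lambda>x. (norm (grad \<phi> x))\<^sup>2)"
proof -
  obtain r B where "test_bound \<phi> r B" using Cc_inf_test_bound[OF assms] by blast
  note rB = test_boundD[OF this]
  have sm: "smooth \<phi>" using assms by (rule Cc_inf_smooth)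
  have b: "(norm a)\<^sup>2 \<le> B\<^sup>2" if "norm a \<le> B" for a :: "'b::real_normed_vector"
    using that by (intro power_mono) auto
  show "integrable lebesgue (\<lambda>x. (\<phi> x)\<^sup>2)"
    by (rule integrable_bounded_compact_support[where r=r and B="B\<^sup>2"])
       (use rB b[of "\<phi> _"] in \<open>auto intro!: continuous_imp_measurable_lebesgue continuous_on_power smooth_imp_continuous[OF sm]\<close>)
  show "integrable lebesgue (\<lambda>x. (norm (grad \<phi> x))\<^sup>2)"
    by (rule integrable_bounded_compact_support[where r=r and B="B\<^sup>2"])
       (use rB b[of "grad \<phi> _"] in \<open>auto intro!: continuous_imp_measurable_lebesgue continuous_on_power continuous_on_norm continuous_grad[OF sm]\<close>)
  show "integrable lebesgue (\<lambda>x. (grad \<phi> x $ i)\<^sup>2)"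
  proof (rule integrable_bounded_compact_support[where r=r and B="B\<^sup>2"])
    show "norm ((grad \<phi> x $ i)\<^sup>2) \<le> B\<^sup>2" for x
      using b[of "grad \<phi> x $ i"] rB(4)[of x] component_le_norm_cart[of "grad \<phi> x" i] by simp
  qed (use rB in \<open>auto intro!: continuous_imp_measurable_lebesgue continuous_on_power smooth_imp_continuous[OF smooth_grad[OF sm]]\<close>)
qed

lemma measurable_vec_nth:
  fixes F :: "'a \<Rightarrow> real ^ 'n"
  assumes "F \<in> borel_measurable M" shows "(\<lambda>x. F x $ i) \<in> borel_measurable M"
  using assms borel_measurable_continuous_onI[OF continuous_on_component[OF continuous_on_id], of i]
  by (rule measurable_compose)

text \<open>Weak gradients are closed under limits, because the defining identities are tested with
  square integrable functions of compact support.\<close>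

lemma has_weak_gradient_limit:
  fixes z :: "nat \<Rightarrow> real ^ 'n \<Rightarrow> real"
  assumes zn: "\<And>n. has_weak_gradient (z n) (Z n)"
    and u: "loc_integrable u" and U: "loc_integrable U"
    and lim: "L2_loc_tendsto z u"
    and Zi: "\<And>n. integrable lebesgue (\<lambda>x. (norm (Z n x - U x))\<^sup>2)"
    and Zl: "(\<lambda>n. LINT x|lebesgue. (norm (Z n x - U x))\<^sup>2) \<longlonglongrightarrow> 0"
  shows "has_weak_gradient u U"
proof (rule has_weak_gradientI[OF u U])
  fix \<phi> :: "real^'n \<Rightarrow> real" and i assume \<phi>: "\<phi> \<in> Cc_inf"
  obtain r B where "test_bound \<phi> r B" using Cc_inf_test_bound[OF \<phi>] by blast
  note rB = test_boundD[OF this]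
  have sm: "smooth \<phi>" using \<phi> by (rule Cc_inf_smooth)
  note S = Cc_inf_square_integrable[OF \<phi>]
  have um: "u \<in> borel_measurable lebesgue" and Um: "U \<in> borel_measurable lebesgue"
    using u U loc_integrable_measurable by blast+
  note zm = has_weak_gradient_measurable[OF zn]
  have \<phi>m: "\<phi> \<in> borel_measurable lebesgue" "(\<lambda>x. grad \<phi> x $ i) \<in> borel_measurable lebesgue"
    by (auto intro!: continuous_imp_measurable_lebesgue smooth_imp_continuous sm smooth_grad)
  note uc = integrable_test_products(1)[OF u U \<phi>, of i]
  note Uc = integral_vec_nth(1)[OF integrable_test_products(2)[OF u U \<phi>], of i, simplified]
  note zc = has_weak_gradient_component[OF zn \<phi>, of _ i]
  have 1: "(\<lambda>n. LINT x|lebesgue. z n x * grad \<phi> x $ i) \<longlonglongrightarrow> (LINT x|lebesgue. u x * grad \<phi> x $ i)"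
  proof (rule LIM_zero_cancel)
    have "(LINT x|lebesgue. z n x * grad \<phi> x $ i) - (LINT x|lebesgue. u x * grad \<phi> x $ i)
        = (LINT x|lebesgue. (z n x - u x) * grad \<phi> x $ i)" for n
      using zc uc by (simp add: Bochner_Integration.integral_diff left_diff_distrib)
    then show "(\<lambda>n. (LINT x|lebesgue. z n x * grad \<phi> x $ i) - (LINT x|lebesgue. u x * grad \<phi> x $ i)) \<longlonglongrightarrow> 0"
      using L2_loc_tendsto_test(2)[OF lim zm(1) um \<phi>m(2) S(2), of r] rB(6) by simp
  qed
  have 2: "(\<lambda>n. LINT x|lebesgue. \<phi> x * Z n x $ i) \<longlonglongrightarrow> (LINT x|lebesgue. \<phi> x * U x $ i)"
  proof (rule LIM_zero_cancel, rule Lim_null_comparison)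
    have cmp: "integrable lebesgue (\<lambda>x. (Z n x $ i - U x $ i)\<^sup>2)"
      "(LINT x|lebesgue. (Z n x $ i - U x $ i)\<^sup>2) \<le> (LINT x|lebesgue. (norm (Z n x - U x))\<^sup>2)" for n
    proof -
      have le: "(Z n x $ i - U x $ i)\<^sup>2 \<le> (norm (Z n x - U x))\<^sup>2" for x
        using component_le_norm_cart[of "Z n x - U x" i] by (metis abs_le_square_iff abs_norm_cancel vector_minus_component)
      show I: "integrable lebesgue (\<lambda>x. (Z n x $ i - U x $ i)\<^sup>2)"
        by (rule Bochner_Integration.integrable_bound[OF Zi[of n]])
           (use le zm(2)[of n] Um in \<open>auto intro!: AE_I2 borel_measurable_power borel_measurable_diff measurable_vec_nth\<close>)
      show "(LINT x|lebesgue. (Z n x $ i - U x $ i)\<^sup>2) \<le> (LINT x|lebesgue. (norm (Z n x - U x))\<^sup>2)"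
        by (intro integral_mono I Zi le)
    qed
    show "\<forall>\<^sub>F n in sequentially. norm ((LINT x|lebesgue. \<phi> x * Z n x $ i) - (LINT x|lebesgue. \<phi> x * U x $ i))
      \<le> sqrt (LINT x|lebesgue. (\<phi> x)\<^sup>2) * sqrt (LINT x|lebesgue. (norm (Z n x - U x))\<^sup>2)"
    proof (rule always_eventually, rule allI)
      fix n
      have "(LINT x|lebesgue. \<phi> x * Z n x $ i) - (LINT x|lebesgue. \<phi> x * U x $ i)
        = (LINT x|lebesgue. \<phi> x * (Z n x $ i - U x $ i))"
        using zc Uc by (simp add: Bochner_Integration.integral_diff right_diff_distrib)
      moreover have "\<bar>LINT x|lebesgue. \<phi> x * (Z n x $ i - U x $ i)\<bar>
        \<le> sqrt (LINT x|lebesgue. (\<phi> x)\<^sup>2) * sqrt (LINT x|lebesgue. (Z n x $ i - U x $ i)\<^sup>2)"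
        by (rule integral_Cauchy_Schwarz(2)[OF \<phi>m(1) _ S(1) cmp(1)])
           (use zm(2)[of n] Um in \<open>auto intro!: borel_measurable_diff measurable_vec_nth\<close>)
      moreover have "\<dots> \<le> sqrt (LINT x|lebesgue. (\<phi> x)\<^sup>2) * sqrt (LINT x|lebesgue. (norm (Z n x - U x))\<^sup>2)"
        by (intro mult_left_mono real_sqrt_le_mono cmp) auto
      ultimately show "norm ((LINT x|lebesgue. \<phi> x * Z n x $ i) - (LINT x|lebesgue. \<phi> x * U x $ i))
      \<le> sqrt (LINT x|lebesgue. (\<phi> x)\<^sup>2) * sqrt (LINT x|lebesgue. (norm (Z n x - U x))\<^sup>2)"
        by simp
    qed
    have "(\<lambda>n. sqrt (LINT x|lebesgue. (\<phi> x)\<^sup>2) * sqrt (LINT x|lebesgue. (norm (Z n x - U x))\<^sup>2))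
      \<longlonglongrightarrow> sqrt (LINT x|lebesgue. (\<phi> x)\<^sup>2) * sqrt 0"
      by (intro tendsto_intros Zl)
    then show "(\<lambda>n. sqrt (LINT x|lebesgue. (\<phi> x)\<^sup>2) * sqrt (LINT x|lebesgue. (norm (Z n x - U x))\<^sup>2)) \<longlonglongrightarrow> 0"
      by simp
  qed
  show "(LINT x|lebesgue. u x * grad \<phi> x $ i) = - (LINT x|lebesgue. \<phi> x * U x $ i)"
    using LIMSEQ_unique[OF 1 tendsto_minus[OF 2, folded zc(3)]] .
qed

section \<open>Approximation by radial test functions\<close>

lemma Cc_inf_rad_Cc_inf: "h \<in> Cc_inf_rad \<Longrightarrow> h \<in> Cc_inf"
  by (simp add: Cc_inf_rad_def)

lemma Cc_inf_support:
  assumes "h \<in> Cc_inf"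
  obtains r where "r > 0" "\<And>x. norm x \<ge> r \<Longrightarrow> h x = 0"
  using Cc_inf_test_bound[OF assms] test_boundD(1,5) by metis

lemma Cc_inf_diff: "g \<in> Cc_inf \<Longrightarrow> h \<in> Cc_inf \<Longrightarrow> (\<lambda>x. g x - h x) \<in> Cc_inf"
proof -
  assume gh: "g \<in> Cc_inf" "h \<in> Cc_inf"
  obtain r where r: "r > 0" "\<And>x. norm x \<ge> r \<Longrightarrow> g x = 0" using Cc_inf_support[OF gh(1)] by blast
  obtain s where s: "s > 0" "\<And>x. norm x \<ge> s \<Longrightarrow> h x = 0" using Cc_inf_support[OF gh(2)] by blast
  show ?thesis
  proof (rule Cc_infI[where r="max r s"])
    show "smooth (\<lambda>x. g x - h x)"
      by (intro allI C_k_diff Cc_inf_smooth[rule_format] gh)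
  qed (use r s in auto)
qed

lemma grad_diff:
  assumes "smooth g" "smooth h"
  shows "grad (\<lambda>x. g x - h x) x = grad g x - grad h x"
  by (rule grad_eqI)
     (rule has_derivative_eq_rhs[OF has_derivative_diff[OF grad_inner grad_inner]],
      use assms in \<open>auto simp: smooth_imp_differentiable inner_diff_left\<close>)

lemma powr_abs_add_le:
  fixes a b p :: real
  assumes "p \<ge> 0" shows "\<bar>a + b\<bar> powr p \<le> 2 powr p * (\<bar>a\<bar> powr p + \<bar>b\<bar> powr p)"
proof -
  have "\<bar>a + b\<bar> powr p \<le> (2 * max \<bar>a\<bar> \<bar>b\<bar>) powr p"
    using assms by (intro powr_mono2) auto
  also have "\<dots> = 2 powr p * max \<bar>a\<bar> \<bar>b\<bar> powr p" by (simp add: powr_mult)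
  also have "max \<bar>a\<bar> \<bar>b\<bar> powr p \<le> \<bar>a\<bar> powr p + \<bar>b\<bar> powr p" by (simp add: max_def)
  finally show ?thesis by (simp add: mult_left_mono)
qed

text \<open>By the local Hardy inequality the increments of the sequence are geometrically small in \<open>L\<^sup>2\<close> of
  every ball. They are therefore summable almost everywhere, and Fatou's lemma transfers the bound on
  \<open>\<phi> m - \<phi> n\<close> to the limit.\<close>

lemma test_functions_converge:
  fixes \<phi> :: "nat \<Rightarrow> real ^ 'n \<Rightarrow> real"
  assumes N: "CARD('n) \<ge> 3" and \<phi>: "\<And>n. \<phi> n \<in> Cc_inf"
    and cau: "\<And>m n. n \<le> m \<Longrightarrow> (LINT x|lebesgue. (norm (grad (\<phi> m) x - grad (\<phi> n) x))\<^sup>2) \<le> 4 * (1 / 4) ^ n"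
  obtains u where "u \<in> borel_measurable lebesgue" "AE x in lebesgue. (\<lambda>n. \<phi> n x) \<longlonglongrightarrow> u x"
    "L2_loc_tendsto \<phi> u"
proof -
  have sm: "smooth (\<phi> n)" for n using \<phi> by (rule Cc_inf_smooth)
  have pm[measurable]: "\<phi> n \<in> borel_measurable lebesgue" for n
    using sm by (intro continuous_imp_measurable_lebesgue smooth_imp_continuous)
  have cm[measurable]: "cball (0::real^'n) r \<in> sets lebesgue" for r :: real by (auto intro: fmeasurableD)
  have loc: "(\<integral>\<^sup>+x\<in>cball 0 r. ennreal ((\<phi> m x - \<phi> n x)\<^sup>2) \<partial>lebesgue) \<le> ennreal (16 * (1 + r\<^sup>2) * (1 / 4) ^ n)"
    if "n \<le> m" "r \<ge> 0" for m n r
  proof -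
    have "(\<integral>\<^sup>+x\<in>cball 0 r. ennreal ((\<phi> m x - \<phi> n x)\<^sup>2) \<partial>lebesgue)
      \<le> ennreal (4 * (1 + r\<^sup>2) * (LINT x|lebesgue. (norm (grad (\<lambda>x. \<phi> m x - \<phi> n x) x))\<^sup>2))"
      by (rule Hardy_local[OF N Cc_inf_diff[OF \<phi> \<phi>] that(2)])
    also have "\<dots> \<le> ennreal (4 * (1 + r\<^sup>2) * (4 * (1 / 4) ^ n))"
      using cau[OF that(1)] by (intro ennreal_leI mult_left_mono) (auto simp: grad_diff[OF sm sm])
    also have "4 * (1 + r\<^sup>2) * (4 * (1 / 4) ^ n) = 16 * (1 + r\<^sup>2) * (1 / 4) ^ n" by simp
    finally show ?thesis .
  qed
  have conv: "AE x in lebesgue. x \<in> cball 0 r \<longrightarrow> convergent (\<lambda>n. \<phi> n x)" if r: "r \<ge> 0" for r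
  proof -
    define d where "d n x = \<bar>\<phi> (Suc n) x - \<phi> n x\<bar> * indicator (cball 0 r) x" for n x
    have dm[measurable]: "d n \<in> borel_measurable lebesgue" for n
      unfolding d_def by measurable
    define c where "c = 16 * (1 + r\<^sup>2) + measure lborel (cball (0::real^'n) r)"
    have c0: "c \<ge> 0" by (simp add: c_def add_nonneg_nonneg)
    have dn: "(\<integral>\<^sup>+x. ennreal (d n x) \<partial>lebesgue) \<le> ennreal (c * (1 / 2) ^ n)" for n
    proof -
      have pt: "ennreal (d n x) \<le> ennreal (2 ^ n) * (ennreal ((\<phi> (Suc n) x - \<phi> n x)\<^sup>2) * indicator (cball 0 r) x)
          + ennreal ((1/2) ^ n) * indicator (cball 0 r) x" for x
      proof -
        define t where "t = \<bar>\<phi> (Suc n) x - \<phi> n x\<bar>"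
        \<comment> \<open>The weight \<open>2 ^ n\<close> balances the bound \<open>(1/4) ^ n\<close> for the squares against the volume of the ball.\<close>
        have "t \<le> 2 ^ n * t\<^sup>2 + (1 / 2) ^ n"
        proof (cases "t \<le> (1/2) ^ n")
          case False
          then have "1 \<le> 2 ^ n * t" by (simp add: power_one_over field_simps)
          then have "1 * t \<le> (2 ^ n * t) * t" by (intro mult_right_mono) (auto simp: t_def)
          then show ?thesis by (simp add: power2_eq_square add_increasing2)
        qed (simp add: add_increasing)
        then have "ennreal t \<le> ennreal (2 ^ n * t\<^sup>2 + (1 / 2) ^ n)" by (rule ennreal_leI)
        also have "\<dots> = ennreal (2 ^ n) * ennreal (t\<^sup>2) + ennreal ((1/2) ^ n)"
          by (simp add: ennreal_plus ennreal_mult)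
        finally show ?thesis by (simp add: d_def t_def split: split_indicator)
      qed
      have "(\<integral>\<^sup>+x. ennreal (d n x) \<partial>lebesgue)
        \<le> (\<integral>\<^sup>+x. ennreal (2 ^ n) * (ennreal ((\<phi> (Suc n) x - \<phi> n x)\<^sup>2) * indicator (cball 0 r) x)
          + ennreal ((1/2) ^ n) * indicator (cball 0 r) x \<partial>lebesgue)"
        by (intro nn_integral_mono pt)
      also have "\<dots> = ennreal (2 ^ n) * (\<integral>\<^sup>+x\<in>cball 0 r. ennreal ((\<phi> (Suc n) x - \<phi> n x)\<^sup>2) \<partial>lebesgue)
          + ennreal ((1/2) ^ n) * emeasure lebesgue (cball (0::real^'n) r)"
        by (subst nn_integral_add) (measurable, simp add: nn_integral_cmult nn_integral_cmult_indicator)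
      also have "emeasure lebesgue (cball (0::real^'n) r) = ennreal (measure lborel (cball (0::real^'n) r))"
        by (simp add: emeasure_eq_ennreal_measure emeasure_lborel_cball_finite[unfolded infinity_ennreal_def] less_imp_neq)
      also have "ennreal (2 ^ n) * (\<integral>\<^sup>+x\<in>cball 0 r. ennreal ((\<phi> (Suc n) x - \<phi> n x)\<^sup>2) \<partial>lebesgue)
          \<le> ennreal (2 ^ n) * ennreal (16 * (1 + r\<^sup>2) * (1 / 4) ^ n)"
        using loc[of n "Suc n" r] r by (intro mult_left_mono) auto
      also have "ennreal (2 ^ n) * ennreal (16 * (1 + r\<^sup>2) * (1 / 4) ^ n) = ennreal (16 * (1 + r\<^sup>2) * (1 / 2) ^ n)"
      proof -
        have "(2::real) ^ n * (1 / 4) ^ n = (1 / 2) ^ n" by (simp add: power_mult_distrib[symmetric])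
        then show ?thesis by (simp add: ennreal_mult'[symmetric] mult_ac)
      qed
      finally show ?thesis
        by (simp add: c_def ennreal_plus[symmetric] ennreal_mult'[symmetric] algebra_simps add_mono del: ennreal_plus)
    qed
    have "(\<integral>\<^sup>+x. (\<Sum>n. ennreal (d n x)) \<partial>lebesgue) = (\<Sum>n. \<integral>\<^sup>+x. ennreal (d n x) \<partial>lebesgue)"
      by (rule nn_integral_suminf) auto
    also have "\<dots> \<le> (\<Sum>n. ennreal (c * (1 / 2) ^ n))"
      by (intro suminf_le dn) auto
    also have "\<dots> = ennreal (\<Sum>n. c * (1 / 2) ^ n)"
      using c0 by (intro suminf_ennreal2) (auto intro!: summable_mult summable_geometric)
    also have "\<dots> < \<infinity>" by simp
    finally have "AE x in lebesgue. (\<Sum>n. ennreal (d n x)) \<noteq> \<infinity>"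
      by (intro nn_integral_PInf_AE) auto
    then show ?thesis
    proof eventually_elim
      fix x assume fin: "(\<Sum>n. ennreal (d n x)) \<noteq> \<infinity>"
      show "x \<in> cball 0 r \<longrightarrow> convergent (\<lambda>n. \<phi> n x)"
      proof
        assume x: "x \<in> cball 0 r"
        have "summable (\<lambda>n. d n x)"
          using fin by (intro summable_suminf_not_top) (auto simp: d_def)
        then have "summable (\<lambda>n. \<bar>\<phi> (Suc n) x - \<phi> n x\<bar>)" using x by (simp add: d_def)
        then have "summable (\<lambda>n. \<phi> (Suc n) x - \<phi> n x)" by (rule summable_rabs_cancel)
        then have "convergent (\<lambda>n. \<Sum>i<n. \<phi> (Suc i) x - \<phi> i x)" by (simp add: summable_iff_convergent)
        then have "convergent (\<lambda>n. \<phi> n x - \<phi> 0 x)" unfolding sum_lessThan_telescope[of "\<lambda>i. \<phi> i x"] .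
        then show "convergent (\<lambda>n. \<phi> n x)" by (simp add: convergent_diff_const_right_iff)
      qed
    qed
  qed
  have "AE x in lebesgue. \<forall>k::nat. x \<in> cball 0 (real k) \<longrightarrow> convergent (\<lambda>n. \<phi> n x)"
    unfolding AE_all_countable using conv by simp
  then have cv: "AE x in lebesgue. convergent (\<lambda>n. \<phi> n x)"
  proof eventually_elim
    fix x assume a: "\<forall>k::nat. x \<in> cball 0 (real k) \<longrightarrow> convergent (\<lambda>n. \<phi> n x)"
    obtain k where "norm x \<le> real k" using real_arch_simple by blast
    then show "convergent (\<lambda>n. \<phi> n x)" using a by auto
  qed
  define u where "u x = lim (\<lambda>n. \<phi> n x)" for x
  have um[measurable]: "u \<in> borel_measurable lebesgue" unfolding u_def by measurable
  have ul: "AE x in lebesgue. (\<lambda>n. \<phi> n x) \<longlonglongrightarrow> u x"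
    using cv by eventually_elim (simp add: u_def convergent_LIMSEQ_iff)
  have key: "(\<integral>\<^sup>+x\<in>cball 0 r. ennreal ((\<phi> n x - u x)\<^sup>2) \<partial>lebesgue) \<le> ennreal (16 * (1 + r\<^sup>2) * (1 / 4) ^ n)"
    if r: "r \<ge> 0" for r n
  proof -
    have "(\<integral>\<^sup>+x\<in>cball 0 r. ennreal ((\<phi> n x - u x)\<^sup>2) \<partial>lebesgue)
      = (\<integral>\<^sup>+x. liminf (\<lambda>m. ennreal ((\<phi> m x - \<phi> n x)\<^sup>2) * indicator (cball 0 r) x) \<partial>lebesgue)"
    proof (rule nn_integral_cong_AE)
      show "AE x in lebesgue. ennreal ((\<phi> n x - u x)\<^sup>2) * indicator (cball 0 r) x
        = liminf (\<lambda>m. ennreal ((\<phi> m x - \<phi> n x)\<^sup>2) * indicator (cball 0 r) x)"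
        using ul
      proof eventually_elim
        fix x assume "(\<lambda>n. \<phi> n x) \<longlonglongrightarrow> u x"
        then have "(\<lambda>m. ennreal ((\<phi> m x - \<phi> n x)\<^sup>2)) \<longlonglongrightarrow> ennreal ((u x - \<phi> n x)\<^sup>2)"
          by (intro tendsto_intros) auto
        then have "(\<lambda>m. ennreal ((\<phi> m x - \<phi> n x)\<^sup>2) * indicator (cball 0 r) x) \<longlonglongrightarrow> ennreal ((u x - \<phi> n x)\<^sup>2) * indicator (cball 0 r) x"
          by (auto split: split_indicator)
        from lim_imp_Liminf[OF _ this]
        show "ennreal ((\<phi> n x - u x)\<^sup>2) * indicator (cball 0 r) x
        = liminf (\<lambda>m. ennreal ((\<phi> m x - \<phi> n x)\<^sup>2) * indicator (cball 0 r) x)"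
          by (simp add: power2_commute)
      qed
    qed
    also have "\<dots> \<le> liminf (\<lambda>m. \<integral>\<^sup>+x. ennreal ((\<phi> m x - \<phi> n x)\<^sup>2) * indicator (cball 0 r) x \<partial>lebesgue)"
      by (rule nn_integral_liminf) measurable
    also have "\<dots> \<le> ennreal (16 * (1 + r\<^sup>2) * (1 / 4) ^ n)"
    proof (rule order_trans[OF Liminf_le_Limsup])
      show "limsup (\<lambda>m. \<integral>\<^sup>+x. ennreal ((\<phi> m x - \<phi> n x)\<^sup>2) * indicator (cball 0 r) x \<partial>lebesgue) \<le> ennreal (16 * (1 + r\<^sup>2) * (1 / 4) ^ n)"
        using eventually_mono[OF eventually_ge_at_top[of n] loc[OF _ r]] by (rule Limsup_bounded)
    qed simp
    finally show ?thesis .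
  qed
  have "L2_loc_tendsto \<phi> u"
    unfolding L2_loc_tendsto_def
  proof (intro allI conjI)
    fix r :: real
    define s where "s = \<bar>r\<bar>"
    have 1: "integrable lebesgue (\<lambda>x. indicator (cball 0 r) x * (\<phi> n x - u x)\<^sup>2)
      \<and> (LINT x|lebesgue. indicator (cball 0 r) x * (\<phi> n x - u x)\<^sup>2) \<le> 16 * (1 + s\<^sup>2) * (1 / 4) ^ n" for n
    proof -
      have m: "(\<lambda>x. indicator (cball 0 r) x * (\<phi> n x - u x)\<^sup>2) \<in> borel_measurable lebesgue"
        by measurable
      have "(\<integral>\<^sup>+x. ennreal (indicator (cball 0 r) x * (\<phi> n x - u x)\<^sup>2) \<partial>lebesgue) \<le> (\<integral>\<^sup>+x\<in>cball 0 s. ennreal ((\<phi> n x - u x)\<^sup>2) \<partial>lebesgue)"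
        by (intro nn_integral_mono) (auto simp: s_def split: split_indicator)
      also have "\<dots> \<le> ennreal (16 * (1 + s\<^sup>2) * (1 / 4) ^ n)" by (rule key) (simp add: s_def)
      finally have b: "(\<integral>\<^sup>+x. ennreal (indicator (cball 0 r) x * (\<phi> n x - u x)\<^sup>2) \<partial>lebesgue) \<le> ennreal (16 * (1 + s\<^sup>2) * (1 / 4) ^ n)" .
      have i: "integrable lebesgue (\<lambda>x. indicator (cball 0 r) x * (\<phi> n x - u x)\<^sup>2)"
        by (rule integrableI_bounded[OF m]) (use b in \<open>auto simp: abs_mult intro: le_less_trans\<close>)
      from nn_integral_eq_integral[OF i] b have "ennreal (LINT x|lebesgue. indicator (cball 0 r) x * (\<phi> n x - u x)\<^sup>2) \<le> ennreal (16 * (1 + s\<^sup>2) * (1 / 4) ^ n)"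
        by simp
      then show ?thesis using i by (subst (asm) ennreal_le_iff) auto
    qed
    then show "integrable lebesgue (\<lambda>x. indicator (cball 0 r) x * (\<phi> n x - u x)\<^sup>2)" for n by blast
    have "(\<lambda>n. 16 * (1 + s\<^sup>2) * (1 / 4 :: real) ^ n) \<longlonglongrightarrow> 16 * (1 + s\<^sup>2) * 0"
      by (intro tendsto_intros LIMSEQ_realpow_zero) auto
    then have g0: "(\<lambda>n. 16 * (1 + s\<^sup>2) * (1 / 4 :: real) ^ n) \<longlonglongrightarrow> 0" by simp
    show "(\<lambda>n. LINT x|lebesgue. indicator (cball 0 r) x * (\<phi> n x - u x)\<^sup>2) \<longlonglongrightarrow> 0"
      by (rule tendsto_sandwich[OF _ _ tendsto_const g0]) (use 1 in auto)
  qed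
  with um ul show ?thesis by (rule that)
qed

text \<open>Membership in the closure of the test functions is defined by the gradients alone. The
  duality estimate identifies the limit of the approximating test functions, so they converge to
  \<open>u\<close> itself.\<close>

lemma D12_rad_approximation:
  fixes u :: "real ^ 'n \<Rightarrow> real"
  assumes N: "CARD('n) \<ge> 3" and u: "u \<in> D12_rad"
  obtains U \<phi> where "has_weak_gradient u U" "integrable lebesgue (\<lambda>x. (norm (U x))\<^sup>2)"
    "\<And>n. \<phi> n \<in> Cc_inf_rad" "AE x in lebesgue. (\<lambda>n. \<phi> n x) \<longlonglongrightarrow> u x" "L2_loc_tendsto \<phi> u"
    "\<And>n. integrable lebesgue (\<lambda>x. (norm (grad (\<phi> n) x - U x))\<^sup>2)"
    "(\<lambda>n. LINT x|lebesgue. (norm (grad (\<phi> n) x - U x))\<^sup>2) \<longlonglongrightarrow> 0"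
proof -
  define p where "p = 2 * real CARD('n) / (real CARD('n) - 2)"
  have p1: "p \<ge> 1" using N by (simp add: p_def field_simps)
  obtain U where U: "has_weak_gradient u U" "integrable lebesgue (\<lambda>x. (norm (U x))\<^sup>2)"
    and up: "integrable lebesgue (\<lambda>x. \<bar>u x\<bar> powr p)"
    using u by (auto simp: D12_rad_def D12_def p_def)
  have "\<exists>\<phi>\<in>Cc_inf_rad. norm12 (\<lambda>x. u x - \<phi> x) < (1 / 2) ^ n" for n :: nat
    using u by (auto simp: D12_rad_def)
  then obtain \<phi> where \<phi>r: "\<And>n. \<phi> n \<in> Cc_inf_rad" and \<phi>n: "\<And>n. norm12 (\<lambda>x. u x - \<phi> n x) < (1 / 2) ^ n"
    by metis
  have \<phi>: "\<phi> n \<in> Cc_inf" for n by (rule Cc_inf_rad_Cc_inf[OF \<phi>r])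
  have sm: "smooth (\<phi> n)" for n using \<phi> by (rule Cc_inf_smooth)
  have um[measurable]: "u \<in> borel_measurable lebesgue" and Um[measurable]: "U \<in> borel_measurable lebesgue"
    using has_weak_gradient_measurable[OF U(1)] by auto
  have \<phi>m[measurable]: "\<phi> n \<in> borel_measurable lebesgue" "grad (\<phi> n) \<in> borel_measurable lebesgue" for n
    using sm by (auto intro!: continuous_imp_measurable_lebesgue smooth_imp_continuous continuous_grad)
  note \<phi>w = smooth_has_weak_gradient[OF sm]
  have di: "integrable lebesgue (\<lambda>x. (norm (U x - grad (\<phi> n) x))\<^sup>2)" for n
    by (intro integrable_norm_sq_diff Um \<phi>m U Cc_inf_square_integrable(3)[OF \<phi>])
  have d: "(LINT x|lebesgue. (norm (U x - grad (\<phi> n) x))\<^sup>2) \<le> (1 / 4) ^ n" for n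
  proof -
    have "sqrt (LINT x|lebesgue. (norm (U x - grad (\<phi> n) x))\<^sup>2) \<le> (1 / 2) ^ n"
      using \<phi>n[of n] norm12_eq(1)[OF has_weak_gradient_diff[OF U(1) \<phi>w]] by simp
    then have "(LINT x|lebesgue. (norm (U x - grad (\<phi> n) x))\<^sup>2) \<le> ((1 / 2) ^ n)\<^sup>2"
      by (rule sqrt_le_D)
    then show ?thesis by (simp add: power2_eq_square power_mult_distrib[symmetric])
  qed
  have cau: "(LINT x|lebesgue. (norm (grad (\<phi> m) x - grad (\<phi> n) x))\<^sup>2) \<le> 4 * (1 / 4) ^ n" if "n \<le> m" for m n
  proof -
    have pt: "(norm (grad (\<phi> m) x - grad (\<phi> n) x))\<^sup>2 \<le> 2 * (norm (U x - grad (\<phi> m) x))\<^sup>2 + 2 * (norm (U x - grad (\<phi> n) x))\<^sup>2" for x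
      using norm_add_sq_le[of "grad (\<phi> m) x - U x" "U x - grad (\<phi> n) x"] by (simp add: norm_minus_commute)
    have "(LINT x|lebesgue. (norm (grad (\<phi> m) x - grad (\<phi> n) x))\<^sup>2)
      \<le> (LINT x|lebesgue. 2 * (norm (U x - grad (\<phi> m) x))\<^sup>2 + 2 * (norm (U x - grad (\<phi> n) x))\<^sup>2)"
      by (intro integral_mono pt Bochner_Integration.integrable_add integrable_mult_right di
          integrable_norm_sq_diff \<phi>m Cc_inf_square_integrable(3)[OF \<phi>])
    also have "\<dots> = 2 * (LINT x|lebesgue. (norm (U x - grad (\<phi> m) x))\<^sup>2) + 2 * (LINT x|lebesgue. (norm (U x - grad (\<phi> n) x))\<^sup>2)"
      using di by simp
    also have "\<dots> \<le> 2 * (1 / 4) ^ n + 2 * (1 / 4) ^ n"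
    proof -
      have "(1 / 4 :: real) ^ m \<le> (1 / 4) ^ n" using that by (intro power_decreasing) auto
      then show ?thesis using d[of m] d[of n] by linarith
    qed
    finally show ?thesis by simp
  qed
  obtain v where v[measurable]: "v \<in> borel_measurable lebesgue" and \<phi>v: "AE x in lebesgue. (\<lambda>n. \<phi> n x) \<longlonglongrightarrow> v x"
    and Lv: "L2_loc_tendsto \<phi> v"
    using test_functions_converge[OF N \<phi> cau] by blast
  have ul: "loc_integrable u" using U(1) by (auto simp: has_weak_gradient_def)
  have vl: "loc_integrable v"
  proof -
    have "loc_integrable (\<lambda>x. \<phi> 0 x - v x)"
      by (rule square_integrable_imp_loc_integrable) (use Lv in \<open>auto simp: L2_loc_tendsto_def\<close>)
    moreover have "loc_integrable (\<phi> 0)" by (rule continuous_loc_integrable[OF smooth_imp_continuous[OF sm]])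
    ultimately have "loc_integrable (\<lambda>x. \<phi> 0 x + (-1) *\<^sub>R (\<phi> 0 x - v x))"
      by (intro loc_integrable_add loc_integrable_cmult)
    then show ?thesis by simp
  qed
  have uv: "loc_integrable (\<lambda>x. u x - v x)"
    using loc_integrable_add[OF ul loc_integrable_cmult[OF vl, of "-1"]] by simp
  have "AE x in lebesgue. u x - v x = 0"
  proof (rule AE_zero_if_test_integrals_zero[OF uv])
    fix \<eta> :: "real^'n \<Rightarrow> real" assume \<eta>: "\<eta> \<in> Cc_inf"
    obtain r B where "test_bound \<eta> r B" using Cc_inf_test_bound[OF \<eta>] by blast
    note rB = test_boundD[OF this]
    have \<eta>m: "\<eta> \<in> borel_measurable lebesgue"
      by (intro continuous_imp_measurable_lebesgue smooth_imp_continuous[OF Cc_inf_smooth[OF \<eta>]])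
    note T = L2_loc_tendsto_test[OF Lv \<phi>m(1) v \<eta>m Cc_inf_square_integrable(1)[OF \<eta>] rB(5)]
    obtain C where C: "C \<ge> 0"
      "\<And>v V p a. has_weak_gradient v V \<Longrightarrow> integrable lebesgue (\<lambda>x. (norm (V x))\<^sup>2) \<Longrightarrow> p \<ge> 1
      \<Longrightarrow> integrable lebesgue (\<lambda>x. \<bar>v x\<bar> powr p) \<Longrightarrow> a > 0
      \<Longrightarrow> \<bar>LINT x|lebesgue. v x * \<eta> x\<bar> \<le> C * (a * (LINT x|lebesgue. (norm (V x))\<^sup>2) + 1 / a)"
      using test_integral_le_gradient[OF N \<eta>] by blast
    have bnd: "\<bar>LINT x|lebesgue. (u x - \<phi> n x) * \<eta> x\<bar> \<le> 2 * C * (1 / 2) ^ n" for n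
    proof -
      have up': "integrable lebesgue (\<lambda>x. \<bar>u x - \<phi> n x\<bar> powr p)"
      proof (rule integrable_lebesgue_bound)
        obtain r B where "test_bound (\<phi> n) r B" using Cc_inf_test_bound[OF \<phi>] by blast
        note rB = test_boundD[OF this]
        have "integrable lebesgue (\<lambda>x. \<bar>\<phi> n x\<bar> powr p)"
          by (rule integrable_bounded_compact_support[where r=r and B="B powr p"])
             (use rB(3,5) p1 in \<open>auto intro!: powr_mono2\<close>)
        then show "integrable lebesgue (\<lambda>x. 2 powr p * (\<bar>u x\<bar> powr p + \<bar>\<phi> n x\<bar> powr p))"
          using up by (intro integrable_mult_right Bochner_Integration.integrable_add)
        show "norm (\<bar>u x - \<phi> n x\<bar> powr p) \<le> 2 powr p * (\<bar>u x\<bar> powr p + \<bar>\<phi> n x\<bar> powr p)" for x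
          using powr_abs_add_le[of p "u x" "- \<phi> n x"] p1 by simp
      qed measurable
      \<comment> \<open>The free parameter of the duality estimate is the reciprocal of the bound for the gradient norm.\<close>
      have "\<bar>LINT x|lebesgue. (u x - \<phi> n x) * \<eta> x\<bar> \<le> C * (2 ^ n * (LINT x|lebesgue. (norm (U x - grad (\<phi> n) x))\<^sup>2) + 1 / 2 ^ n)"
        by (rule C(2)[OF has_weak_gradient_diff[OF U(1) \<phi>w] di p1 up']) simp
      also have "\<dots> \<le> C * (2 ^ n * (1 / 4) ^ n + 1 / 2 ^ n)"
        using d[of n] C(1) by (intro mult_left_mono add_right_mono) auto
      also have "(2::real) ^ n * (1 / 4) ^ n = (1 / 2) ^ n" by (simp add: power_mult_distrib[symmetric])
      finally show ?thesis by (simp add: power_one_over algebra_simps)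
    qed
    have 1: "(\<lambda>n. LINT x|lebesgue. (u x - \<phi> n x) * \<eta> x) \<longlonglongrightarrow> 0"
    proof (rule Lim_null_comparison)
      show "\<forall>\<^sub>F n in sequentially. norm (LINT x|lebesgue. (u x - \<phi> n x) * \<eta> x) \<le> 2 * C * (1 / 2) ^ n"
        using bnd by simp
      have "(\<lambda>n. 2 * C * (1 / 2) ^ n) \<longlonglongrightarrow> 2 * C * 0" by (intro tendsto_intros LIMSEQ_realpow_zero) auto
      then show "(\<lambda>n. 2 * C * (1 / 2) ^ n) \<longlonglongrightarrow> 0" by simp
    qed
    have ui: "integrable lebesgue (\<lambda>x. (u x - \<phi> n x) * \<eta> x)" for n
    proof -
      have "loc_integrable (\<lambda>x. u x - \<phi> n x)"
        using has_weak_gradient_diff[OF U(1) \<phi>w, of n] by (auto simp: has_weak_gradient_def)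
      from loc_integrable_times_test[OF this \<eta>m rB(3) rB(5)] show ?thesis by (simp add: mult.commute)
    qed
    have "(LINT x|lebesgue. (u x - \<phi> n x) * \<eta> x) + (LINT x|lebesgue. (\<phi> n x - v x) * \<eta> x) = (LINT x|lebesgue. \<eta> x * (u x - v x))" for n
    proof -
      have "(LINT x|lebesgue. (u x - \<phi> n x) * \<eta> x) + (LINT x|lebesgue. (\<phi> n x - v x) * \<eta> x)
        = (LINT x|lebesgue. (u x - \<phi> n x) * \<eta> x + (\<phi> n x - v x) * \<eta> x)"
        by (rule Bochner_Integration.integral_add[OF ui T(1), symmetric])
      also have "\<dots> = (LINT x|lebesgue. \<eta> x * (u x - v x))"
        by (intro Bochner_Integration.integral_cong) (auto simp: algebra_simps)
      finally show ?thesis .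
    qed
    with tendsto_add[OF 1 T(2)] show "(LINT x|lebesgue. \<eta> x * (u x - v x)) = 0"
      by (simp add: LIMSEQ_const_iff)
  qed
  then have uv: "AE x in lebesgue. v x = u x" by eventually_elim simp
  show ?thesis
  proof (rule that[OF U \<phi>r])
    show "AE x in lebesgue. (\<lambda>n. \<phi> n x) \<longlonglongrightarrow> u x" using \<phi>v uv by eventually_elim simp
    have cm[measurable]: "cball (0 :: real^'n) r \<in> sets lebesgue" for r by (auto intro: fmeasurableD)
    have "AE x in lebesgue. indicator (cball 0 r) x * (\<phi> n x - v x)\<^sup>2 = indicator (cball 0 r) x * (\<phi> n x - u x)\<^sup>2" for r n
      using uv by eventually_elim simp
    then have "integrable lebesgue (\<lambda>x. indicator (cball 0 r) x * (\<phi> n x - v x)\<^sup>2) = integrable lebesgue (\<lambda>x. indicator (cball 0 r) x * (\<phi> n x - u x)\<^sup>2)"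
      "(LINT x|lebesgue. indicator (cball 0 r) x * (\<phi> n x - v x)\<^sup>2) = (LINT x|lebesgue. indicator (cball 0 r) x * (\<phi> n x - u x)\<^sup>2)" for r n
      by (intro integrable_cong_AE integral_cong_AE; measurable)+
    then show "L2_loc_tendsto \<phi> u" using Lv by (simp add: L2_loc_tendsto_def)
    show "integrable lebesgue (\<lambda>x. (norm (grad (\<phi> n) x - U x))\<^sup>2)" for n
      using di[of n] by (simp add: norm_minus_commute)
    show "(\<lambda>n. LINT x|lebesgue. (norm (grad (\<phi> n) x - U x))\<^sup>2) \<longlonglongrightarrow> 0"
      by (rule tendsto_sandwich[OF _ _ tendsto_const LIMSEQ_realpow_zero[of "1/4"]])
         (use d in \<open>auto simp: norm_minus_commute\<close>)
  qed
qed

section \<open>The chain rule\<close>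

lemma norm_add3_sq_le:
  "(norm (a + b + c))\<^sup>2 \<le> 4 * ((norm a)\<^sup>2 + (norm b)\<^sup>2 + (norm (c::'a::real_normed_vector))\<^sup>2)"
  using norm_add_sq_le[of "a + b" c] norm_add_sq_le[of a b] zero_le_power2[of "norm c"] unfolding distrib_left by linarith

text \<open>For a function \<open>H\<close> with bounded derivative and a cutoff \<open>\<zeta>\<close>, the functions \<open>\<zeta> * H(\<phi>)\<close> of the
  approximating test functions are again test functions, and their gradients converge in \<open>L\<^sup>2\<close> by
  dominated convergence.\<close>

lemma D12_rad_chain_rule:
  fixes u :: "real ^ 'n \<Rightarrow> real"
  assumes N: "CARD('n) \<ge> 3" and u: "u \<in> D12_rad" and U: "has_weak_gradient u U"
    and \<zeta>: "smooth \<zeta>" "\<And>x. \<bar>\<zeta> x\<bar> \<le> M" "\<And>x. norm (grad \<zeta> x) \<le> M" "\<And>x. norm x \<ge> R \<Longrightarrow> grad \<zeta> x = 0"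
    and H: "smooth H" "\<And>t. (H has_real_derivative H' t) (at t)" "\<And>t. \<bar>H' t\<bar> \<le> L"
    and test: "\<And>\<phi>. \<phi> \<in> Cc_inf_rad \<Longrightarrow> (\<lambda>x. \<zeta> x * H (\<phi> x)) \<in> Cc_inf_rad"
    and powr: "integrable lebesgue (\<lambda>x. \<bar>\<zeta> x * H (u x)\<bar> powr (2 * real CARD('n) / (real CARD('n) - 2)))"
  defines "Z \<equiv> \<lambda>x. H (u x) *\<^sub>R grad \<zeta> x + (\<zeta> x * H' (u x)) *\<^sub>R U x"
  shows "(\<lambda>x. \<zeta> x * H (u x)) \<in> D12_rad" "has_weak_gradient (\<lambda>x. \<zeta> x * H (u x)) Z"
    "integrable lebesgue (\<lambda>x. (norm (Z x))\<^sup>2)" "integrable lebesgue (\<lambda>x. (norm (U x))\<^sup>2)"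
proof -
  obtain U0 \<phi> where A: "has_weak_gradient u U0" "integrable lebesgue (\<lambda>x. (norm (U0 x))\<^sup>2)"
    "\<And>n. \<phi> n \<in> Cc_inf_rad" "AE x in lebesgue. (\<lambda>n. \<phi> n x) \<longlonglongrightarrow> u x" "L2_loc_tendsto \<phi> u"
    "\<And>n. integrable lebesgue (\<lambda>x. (norm (grad (\<phi> n) x - U0 x))\<^sup>2)"
    "(\<lambda>n. LINT x|lebesgue. (norm (grad (\<phi> n) x - U0 x))\<^sup>2) \<longlonglongrightarrow> 0"
    using D12_rad_approximation[OF N u] by blast
  have UU: "AE x in lebesgue. U0 x = U x" by (rule has_weak_gradient_unique[OF A(1) U])
  have sm: "smooth (\<phi> n)" for n using A(3) by (intro Cc_inf_smooth Cc_inf_rad_Cc_inf)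
  have um[measurable]: "u \<in> borel_measurable lebesgue" and Um[measurable]: "U \<in> borel_measurable lebesgue"
    and U0m[measurable]: "U0 \<in> borel_measurable lebesgue"
    using has_weak_gradient_measurable[OF U] has_weak_gradient_measurable[OF A(1)] by auto
  have \<phi>m[measurable]: "\<phi> n \<in> borel_measurable lebesgue" "grad (\<phi> n) \<in> borel_measurable lebesgue" for n
    using sm by (auto intro!: continuous_imp_measurable_lebesgue smooth_imp_continuous continuous_grad)
  have \<zeta>m[measurable]: "\<zeta> \<in> borel_measurable lebesgue" "grad \<zeta> \<in> borel_measurable lebesgue"
    using \<zeta>(1) by (auto intro!: continuous_imp_measurable_lebesgue smooth_imp_continuous continuous_grad)
  have H': "smooth H'" by (rule smooth_DERIV_D[OF H(1,2)])
  have Hc: "continuous_on UNIV H" "continuous_on UNIV H'" using smooth_imp_continuous H(1) H' by auto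
  have Hb[measurable]: "H \<in> borel_measurable borel" "H' \<in> borel_measurable borel"
    using borel_measurable_continuous_onI Hc by auto
  have cm[measurable]: "cball (0 :: real^'n) r \<in> sets lebesgue" for r by (auto intro: fmeasurableD)
  have Zm[measurable]: "Z \<in> borel_measurable lebesgue" unfolding Z_def by measurable
  have M0: "M \<ge> 0" using \<zeta>(2)[of 0] by linarith
  have L0: "L \<ge> 0" using H(3)[of 0] by linarith
  have lip: "\<bar>H a - H b\<bar> \<le> L * \<bar>a - b\<bar>" for a b by (rule DERIV_bounded_imp_Lipschitz[OF H(2,3)])
  show U2: "integrable lebesgue (\<lambda>x. (norm (U x))\<^sup>2)"
    by (rule integrable_cong_AE_imp[OF A(2)]) (use UU in \<open>auto elim: eventually_mono\<close>)
  have A6: "integrable lebesgue (\<lambda>x. (norm (grad (\<phi> n) x - U x))\<^sup>2)" for n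
    by (rule integrable_cong_AE_imp[OF A(6)[of n]]) (use UU in \<open>auto elim: eventually_mono\<close>)
  have "(LINT x|lebesgue. (norm (grad (\<phi> n) x - U0 x))\<^sup>2) = (LINT x|lebesgue. (norm (grad (\<phi> n) x - U x))\<^sup>2)" for n
    by (rule integral_cong_AE) (use UU in \<open>auto elim: eventually_mono\<close>)
  with A(7) have A7: "(\<lambda>n. LINT x|lebesgue. (norm (grad (\<phi> n) x - U x))\<^sup>2) \<longlonglongrightarrow> 0" by simp
  define z where "z = (\<lambda>x. \<zeta> x * H (u x))"
  define zn where "zn n x = \<zeta> x * H (\<phi> n x)" for n x
  define Zn where "Zn n x = H (\<phi> n x) *\<^sub>R grad \<zeta> x + (\<zeta> x * H' (\<phi> n x)) *\<^sub>R grad (\<phi> n) x" for n x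
  have zr: "zn n \<in> Cc_inf_rad" for n unfolding zn_def by (rule test[OF A(3)])
  have gz: "grad (zn n) = Zn n" for n
  proof
    fix x
    have sH: "smooth (\<lambda>x. H (\<phi> n x))" by (intro allI) (rule C_k_compose[OF H(1)[rule_format] sm[rule_format]])
    have "grad (zn n) x = \<zeta> x *\<^sub>R grad (\<lambda>x. H (\<phi> n x)) x + H (\<phi> n x) *\<^sub>R grad \<zeta> x"
      unfolding zn_def by (rule grad_mult[OF \<zeta>(1) sH])
    also have "grad (\<lambda>x. H (\<phi> n x)) x = H' (\<phi> n x) *\<^sub>R grad (\<phi> n) x"
      by (rule grad_compose[OF H(2) sm])
    finally show "grad (zn n) x = Zn n x" by (simp add: Zn_def add.commute)
  qed
  have znw: "has_weak_gradient (zn n) (Zn n)" for n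
    using smooth_has_weak_gradient[OF Cc_inf_smooth[OF Cc_inf_rad_Cc_inf[OF zr]], of n] by (simp add: gz)
  note znm[measurable] = has_weak_gradient_measurable[OF znw]
  have zm[measurable]: "z \<in> borel_measurable lebesgue" unfolding z_def by measurable
  have Lz: "L2_loc_tendsto zn z"
    unfolding L2_loc_tendsto_def
  proof (intro allI conjI)
    fix r
    have le: "indicator (cball 0 r) x * (zn n x - z x)\<^sup>2 \<le> (M * L)\<^sup>2 * (indicator (cball 0 r) x * (\<phi> n x - u x)\<^sup>2)" for n x
    proof -
      have "\<bar>zn n x - z x\<bar> = \<bar>\<zeta> x\<bar> * \<bar>H (\<phi> n x) - H (u x)\<bar>"
        by (simp add: zn_def z_def abs_mult[symmetric] right_diff_distrib)
      also have "\<dots> \<le> M * (L * \<bar>\<phi> n x - u x\<bar>)" using M0 by (intro mult_mono \<zeta> lip) auto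
      finally have "\<bar>zn n x - z x\<bar>\<^sup>2 \<le> (M * (L * \<bar>\<phi> n x - u x\<bar>))\<^sup>2" by (intro power_mono) auto
      then show ?thesis by (auto simp: power_mult_distrib split: split_indicator)
    qed
    have i: "integrable lebesgue (\<lambda>x. (M * L)\<^sup>2 * (indicator (cball 0 r) x * (\<phi> n x - u x)\<^sup>2))" for n
      using A(5) unfolding L2_loc_tendsto_def by (intro integrable_mult_right) blast
    show i2: "integrable lebesgue (\<lambda>x. indicator (cball 0 r) x * (zn n x - z x)\<^sup>2)" for n
      by (rule Bochner_Integration.integrable_bound[OF i[of n]])
         (use le in \<open>auto intro!: AE_I2\<close>)
    have l: "(\<lambda>n. (M * L)\<^sup>2 * (LINT x|lebesgue. indicator (cball 0 r) x * (\<phi> n x - u x)\<^sup>2)) \<longlonglongrightarrow> (M * L)\<^sup>2 * 0"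
      using A(5) unfolding L2_loc_tendsto_def by (intro tendsto_intros) blast
    show "(\<lambda>n. LINT x|lebesgue. indicator (cball 0 r) x * (zn n x - z x)\<^sup>2) \<longlonglongrightarrow> 0"
    proof (rule tendsto_sandwich[OF _ _ tendsto_const l[simplified mult_zero_right]])
      show "\<forall>\<^sub>F n in sequentially. (LINT x|lebesgue. indicator (cball 0 r) x * (zn n x - z x)\<^sup>2)
         \<le> (M * L)\<^sup>2 * (LINT x|lebesgue. indicator (cball 0 r) x * (\<phi> n x - u x)\<^sup>2)"
        using integral_mono[OF i2 i le] by (intro always_eventually allI) simp
    qed (auto intro!: always_eventually integral_nonneg_AE)
  qed
  let ?R = "\<bar>R\<bar>"
  \<comment> \<open>The error in the gradient has three parts: \<open>a\<close> from \<open>H(\<phi>\<^sub>n) \<rightarrow> H(u)\<close>, \<open>b\<close> from the convergence of the gradients,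
      and \<open>c\<close> from \<open>H'(\<phi>\<^sub>n) \<rightarrow> H'(u)\<close>, for which only dominated convergence is available.\<close>
  define a where "a n x = (L * M)\<^sup>2 * (indicator (cball 0 ?R) x * (\<phi> n x - u x)\<^sup>2)" for n x
  define b where "b n x = (M * L)\<^sup>2 * (norm (grad (\<phi> n) x - U x))\<^sup>2" for n x
  define c where "c n x = M\<^sup>2 * ((H' (\<phi> n x) - H' (u x))\<^sup>2 * (norm (U x))\<^sup>2)" for n x
  have dec: "(norm (Zn n x - Z x))\<^sup>2 \<le> 4 * (a n x + b n x + c n x)" for n x
  proof -
    define X1 where "X1 = (H (\<phi> n x) - H (u x)) *\<^sub>R grad \<zeta> x"
    define X2 where "X2 = (\<zeta> x * H' (\<phi> n x)) *\<^sub>R (grad (\<phi> n) x - U x)"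
    define X3 where "X3 = (\<zeta> x * (H' (\<phi> n x) - H' (u x))) *\<^sub>R U x"
    have e: "Zn n x - Z x = X1 + X2 + X3"
      by (simp add: Zn_def Z_def X1_def X2_def X3_def algebra_simps)
    have 1: "(norm X1)\<^sup>2 \<le> a n x"
    proof (cases "norm x \<le> ?R")
      case True
      have "norm X1 \<le> (L * \<bar>\<phi> n x - u x\<bar>) * M"
        unfolding X1_def norm_scaleR using L0 by (intro mult_mono \<zeta>) (auto intro: lip)
      then have "(norm X1)\<^sup>2 \<le> ((L * \<bar>\<phi> n x - u x\<bar>) * M)\<^sup>2" by (intro power_mono) auto
      then show ?thesis using True by (simp add: a_def power_mult_distrib mult_ac)
    next
      case False
      then have "grad \<zeta> x = 0" by (intro \<zeta>(4)) auto
      then show ?thesis by (simp add: X1_def a_def)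
    qed
    have "norm X2 \<le> (M * L) * norm (grad (\<phi> n) x - U x)"
      unfolding X2_def norm_scaleR using M0 by (intro mult_right_mono) (auto simp: abs_mult intro!: mult_mono \<zeta> H(3))
    then have "(norm X2)\<^sup>2 \<le> ((M * L) * norm (grad (\<phi> n) x - U x))\<^sup>2" by (intro power_mono) auto
    then have 2: "(norm X2)\<^sup>2 \<le> b n x" by (simp add: b_def power_mult_distrib)
    have "norm X3 \<le> (M * \<bar>H' (\<phi> n x) - H' (u x)\<bar>) * norm (U x)"
      unfolding X3_def norm_scaleR abs_mult by (intro mult_right_mono \<zeta>) auto
    then have "(norm X3)\<^sup>2 \<le> ((M * \<bar>H' (\<phi> n x) - H' (u x)\<bar>) * norm (U x))\<^sup>2" by (intro power_mono) auto
    then have 3: "(norm X3)\<^sup>2 \<le> c n x" by (simp add: c_def power_mult_distrib mult.assoc)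
    show ?thesis unfolding e using norm_add3_sq_le[of X1 X2 X3] 1 2 3 unfolding distrib_left by linarith
  qed
  have ai: "integrable lebesgue (a n)" for n
    using A(5) unfolding a_def L2_loc_tendsto_def by (intro integrable_mult_right) blast
  have bi: "integrable lebesgue (b n)" for n unfolding b_def using A6 by (intro integrable_mult_right)
  have cb: "norm (c n x) \<le> M\<^sup>2 * ((2 * L)\<^sup>2 * (norm (U x))\<^sup>2)" for n x
  proof -
    have "\<bar>H' (\<phi> n x) - H' (u x)\<bar> \<le> 2 * L" using H(3)[of "\<phi> n x"] H(3)[of "u x"] by linarith
    then have "\<bar>H' (\<phi> n x) - H' (u x)\<bar>\<^sup>2 \<le> (2 * L)\<^sup>2" by (intro power_mono) auto
    then have "(H' (\<phi> n x) - H' (u x))\<^sup>2 \<le> (2 * L)\<^sup>2" by simp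
    then show ?thesis by (auto simp: c_def intro!: mult_left_mono mult_right_mono)
  qed
  have wi: "integrable lebesgue (\<lambda>x. M\<^sup>2 * ((2 * L)\<^sup>2 * (norm (U x))\<^sup>2))"
    by (intro integrable_mult_right U2)
  have cms: "c n \<in> borel_measurable lebesgue" for n unfolding c_def by measurable
  have ci: "integrable lebesgue (c n)" for n
    by (rule integrable_lebesgue_bound[OF wi cms cb])
  have cl: "(\<lambda>n. LINT x|lebesgue. c n x) \<longlonglongrightarrow> (LINT x|(lebesgue :: (real^'n) measure). 0)"
  proof (rule integral_dominated_convergence[OF _ cms wi])
    show "AE x in lebesgue. (\<lambda>n. c n x) \<longlonglongrightarrow> 0"
      using A(4)
    proof eventually_elim
      fix x assume "(\<lambda>n. \<phi> n x) \<longlonglongrightarrow> u x"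
      then have "(\<lambda>n. H' (\<phi> n x)) \<longlonglongrightarrow> H' (u x)"
        using Hc(2) by (auto intro: continuous_on_tendsto_compose)
      then have "(\<lambda>n. c n x) \<longlonglongrightarrow> M\<^sup>2 * ((H' (u x) - H' (u x))\<^sup>2 * (norm (U x))\<^sup>2)"
        unfolding c_def by (intro tendsto_intros)
      then show "(\<lambda>n. c n x) \<longlonglongrightarrow> 0" by simp
    qed
    show "AE x in lebesgue. norm (c n x) \<le> M\<^sup>2 * ((2 * L)\<^sup>2 * (norm (U x))\<^sup>2)" for n
      using cb by (intro AE_I2)
  qed simp
  have si: "integrable lebesgue (\<lambda>x. 4 * (a n x + b n x + c n x))" for n
    by (intro integrable_mult_right Bochner_Integration.integrable_add ai bi ci)
  have Di: "integrable lebesgue (\<lambda>x. (norm (Zn n x - Z x))\<^sup>2)" for n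
    by (rule integrable_lebesgue_bound[OF si[of n]]) (use dec in auto)
  have Dl: "(\<lambda>n. LINT x|lebesgue. (norm (Zn n x - Z x))\<^sup>2) \<longlonglongrightarrow> 0"
  proof (rule tendsto_sandwich[OF _ _ tendsto_const])
    have "(\<lambda>n. 4 * ((L * M)\<^sup>2 * (LINT x|lebesgue. indicator (cball 0 ?R) x * (\<phi> n x - u x)\<^sup>2)
        + (M * L)\<^sup>2 * (LINT x|lebesgue. (norm (grad (\<phi> n) x - U x))\<^sup>2) + (LINT x|lebesgue. c n x)))
       \<longlonglongrightarrow> 4 * ((L * M)\<^sup>2 * 0 + (M * L)\<^sup>2 * 0 + (LINT x|(lebesgue :: (real^'n) measure). 0))"
      by (intro tendsto_intros A7 cl) (use A(5) in \<open>simp add: L2_loc_tendsto_def\<close>)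
    moreover have "(LINT x|lebesgue. 4 * (a n x + b n x + c n x)) = 4 * ((L * M)\<^sup>2 * (LINT x|lebesgue. indicator (cball 0 ?R) x * (\<phi> n x - u x)\<^sup>2)
        + (M * L)\<^sup>2 * (LINT x|lebesgue. (norm (grad (\<phi> n) x - U x))\<^sup>2) + (LINT x|lebesgue. c n x))" for n
    proof -
      have "(LINT x|lebesgue. 4 * (a n x + b n x + c n x)) = 4 * ((LINT x|lebesgue. a n x) + (LINT x|lebesgue. b n x) + (LINT x|lebesgue. c n x))"
        using ai[of n] bi[of n] ci[of n] by simp
      then show ?thesis unfolding a_def b_def by simp
    qed
    ultimately show "(\<lambda>n. LINT x|lebesgue. 4 * (a n x + b n x + c n x)) \<longlonglongrightarrow> 0" by simp
    show "\<forall>\<^sub>F n in sequentially. (LINT x|lebesgue. (norm (Zn n x - Z x))\<^sup>2) \<le> (LINT x|lebesgue. 4 * (a n x + b n x + c n x))"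
      by (intro always_eventually allI integral_mono Di si dec)
  qed (auto intro!: always_eventually integral_nonneg_AE)
  have Zn2: "integrable lebesgue (\<lambda>x. (norm (Zn n x))\<^sup>2)" for n
    using Cc_inf_square_integrable(3)[OF Cc_inf_rad_Cc_inf[OF zr]] by (simp add: gz)
  \<comment> \<open>\<open>Z\<close> differs from the gradient of a test function by a square integrable function.\<close>
  have "integrable lebesgue (\<lambda>x. (norm (Zn 0 x - (Zn 0 x - Z x)))\<^sup>2)"
    by (rule integrable_norm_sq_diff[OF _ _ Zn2 Di]) measurable
  then show Z2: "integrable lebesgue (\<lambda>x. (norm (Z x))\<^sup>2)" by simp
  have zl: "loc_integrable z"
  proof -
    have "loc_integrable (\<lambda>x. zn 0 x - z x)"
      by (rule square_integrable_imp_loc_integrable) (use Lz in \<open>auto simp: L2_loc_tendsto_def\<close>)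
    moreover have "loc_integrable (zn 0)" using znw[of 0] by (auto simp: has_weak_gradient_def)
    ultimately have "loc_integrable (\<lambda>x. zn 0 x + (-1) *\<^sub>R (zn 0 x - z x))"
      by (intro loc_integrable_add loc_integrable_cmult)
    then show ?thesis by simp
  qed
  have zw: "has_weak_gradient z Z"
    by (rule has_weak_gradient_limit[OF znw zl square_integrable_imp_loc_integrable'[OF Zm Z2] Lz Di Dl])
  then show "has_weak_gradient (\<lambda>x. \<zeta> x * H (u x)) Z" by (simp add: z_def)
  have "integrable lebesgue (\<lambda>x. \<bar>z x\<bar> powr (2 * real CARD('n) / (real CARD('n) - 2)))"
    using powr by (simp only: z_def)
  then have "z \<in> D12" unfolding D12_def using zm zw Z2 by blast
  moreover have "\<exists>\<phi>\<in>Cc_inf_rad. norm12 (\<lambda>x. z x - \<phi> x) < e" if e: "e > 0" for e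
  proof -
    have "\<forall>\<^sub>F n in sequentially. (LINT x|lebesgue. (norm (Zn n x - Z x))\<^sup>2) < e\<^sup>2"
      by (rule order_tendstoD(2)[OF Dl]) (use e in simp)
    then obtain n where "(LINT x|lebesgue. (norm (Zn n x - Z x))\<^sup>2) < e\<^sup>2"
      by (auto simp: eventually_sequentially)
    then have "sqrt (LINT x|lebesgue. (norm (Z x - Zn n x))\<^sup>2) < sqrt (e\<^sup>2)"
      by (intro real_sqrt_less_mono) (simp add: norm_minus_commute)
    then have "norm12 (\<lambda>x. z x - zn n x) < e"
      using norm12_eq(1)[OF has_weak_gradient_diff[OF zw znw]] e by simp
    then show ?thesis using zr by blast
  qed
  ultimately show "(\<lambda>x. \<zeta> x * H (u x)) \<in> D12_rad" by (simp add: D12_rad_def z_def)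
qed

section \<open>Dilations and multiples\<close>

lemma Cc_inf_rad_dilation:
  assumes "\<phi> \<in> Cc_inf_rad" "c > 0" shows "(\<lambda>x. \<phi> (c *\<^sub>R x)) \<in> Cc_inf_rad"
proof -
  have \<phi>: "\<phi> \<in> Cc_inf" "radial \<phi>" using assms(1) by (auto simp: Cc_inf_rad_def)
  obtain r where r: "r > 0" "\<And>x. norm x \<ge> r \<Longrightarrow> \<phi> x = 0" using Cc_inf_support[OF \<phi>(1)] by blast
  have "(\<lambda>x. \<phi> (c *\<^sub>R x)) \<in> Cc_inf"
  proof (rule Cc_infI)
    show "smooth (\<lambda>x. \<phi> (c *\<^sub>R x))" by (intro allI C_k_compose_scaleR Cc_inf_smooth[OF \<phi>(1), rule_format])
    show "\<phi> (c *\<^sub>R x) = 0" if "norm x \<ge> r / c" for x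
      using that assms(2) by (intro r(2)) (simp add: field_simps)
  qed
  moreover have "radial (\<lambda>x. \<phi> (c *\<^sub>R x))" using \<phi>(2) assms(2) by (simp add: radial_def)
  ultimately show ?thesis by (simp add: Cc_inf_rad_def)
qed

lemma Cc_inf_rad_cmult:
  assumes "\<phi> \<in> Cc_inf_rad" shows "(\<lambda>x. c * \<phi> x) \<in> Cc_inf_rad"
proof -
  have \<phi>: "\<phi> \<in> Cc_inf" "radial \<phi>" using assms(1) by (auto simp: Cc_inf_rad_def)
  obtain r where r: "r > 0" "\<And>x. norm x \<ge> r \<Longrightarrow> \<phi> x = 0" using Cc_inf_support[OF \<phi>(1)] by blast
  have "(\<lambda>x. c * \<phi> x) \<in> Cc_inf"
  proof (rule Cc_infI[where r=r])
    show "smooth (\<lambda>x. c * \<phi> x)" by (intro allI C_k_mult[OF C_k_const] Cc_inf_smooth[OF \<phi>(1), rule_format])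
  qed (simp add: r)
  moreover have "radial (\<lambda>x. c * \<phi> x)" using \<phi>(2) unfolding radial_def by metis
  ultimately show ?thesis by (simp add: Cc_inf_rad_def)
qed

lemma loc_integrable_dilation:
  fixes u :: "real ^ 'n \<Rightarrow> 'b::{banach, second_countable_topology}"
  assumes u: "loc_integrable u" and c: "c > 0"
  shows "loc_integrable (\<lambda>x. u (c *\<^sub>R x))"
proof (intro allI impI)
  fix S :: "(real^'n) set" assume S: "compact S"
  have cS: "compact ((*\<^sub>R) c ` S)" using S by (rule compact_scaling)
  have i: "integrable lebesgue (\<lambda>x. indicator ((*\<^sub>R) c ` S) x *\<^sub>R u x)"
    using u cS by (simp add: set_integrable_def)
  have "integrable lebesgue (\<lambda>x. indicator ((*\<^sub>R) c ` S) (0 + c *\<^sub>R x) *\<^sub>R u (0 + c *\<^sub>R x))"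
    using integrable_lebesgue_affine[of c "\<lambda>x. indicator ((*\<^sub>R) c ` S) x *\<^sub>R u x" 0] i c
      borel_measurable_integrable[OF i] by blast
  moreover have "c *\<^sub>R x \<in> (*\<^sub>R) c ` S \<longleftrightarrow> x \<in> S" for x using c by auto
  then have "indicator ((*\<^sub>R) c ` S) (c *\<^sub>R x) = (indicator S x :: real)" for x by (simp add: indicator_def)
  ultimately show "set_integrable lebesgue S (\<lambda>x. u (c *\<^sub>R x))" by (simp add: set_integrable_def)
qed

lemma has_weak_gradient_dilation:
  fixes u :: "real ^ 'n \<Rightarrow> real"
  assumes w: "has_weak_gradient u U" and c: "c > 0"
  shows "has_weak_gradient (\<lambda>x. u (c *\<^sub>R x)) (\<lambda>x. c *\<^sub>R U (c *\<^sub>R x))"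
proof (rule has_weak_gradientI)
  show "loc_integrable (\<lambda>x. u (c *\<^sub>R x))" "loc_integrable (\<lambda>x. c *\<^sub>R U (c *\<^sub>R x))"
    using w c unfolding has_weak_gradient_def
    by (auto intro!: loc_integrable_dilation[rule_format] loc_integrable_cmult[rule_format])
  fix \<phi> :: "real^'n \<Rightarrow> real" and i assume \<phi>: "\<phi> \<in> Cc_inf"
  define \<psi> where "\<psi> x = \<phi> ((1 / c) *\<^sub>R x)" for x
  have sm: "smooth \<phi>" using \<phi> by (rule Cc_inf_smooth)
  obtain r where r: "r > 0" "\<And>x. norm x \<ge> r \<Longrightarrow> \<phi> x = 0" using Cc_inf_support[OF \<phi>(1)] by blast
  have \<psi>: "\<psi> \<in> Cc_inf"
    unfolding \<psi>_def
  proof (rule Cc_infI)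
    show "smooth (\<lambda>x. \<phi> ((1 / c) *\<^sub>R x))" by (intro allI C_k_compose_scaleR sm[rule_format])
    show "\<phi> ((1 / c) *\<^sub>R x) = 0" if "norm x \<ge> r * c" for x
      using that c by (intro r(2)) (simp add: field_simps)
  qed
  have g\<psi>: "grad \<psi> x = (1 / c) *\<^sub>R grad \<phi> ((1 / c) *\<^sub>R x)" for x
    unfolding \<psi>_def by (rule grad_compose_scaleR[OF sm])
  note W = has_weak_gradient_component[OF w \<psi>, of i]
  let ?k = "\<bar>c\<bar> ^ DIM(real^'n)"
  have "(LINT x|lebesgue. u x * grad \<psi> x $ i) = ?k * (LINT x|lebesgue. u (c *\<^sub>R x) * grad \<psi> (c *\<^sub>R x) $ i)"
    using integral_lebesgue_affine[of c "\<lambda>x. u x * grad \<psi> x $ i" 0] c borel_measurable_integrable[OF W(1)] by simp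
  also have "(LINT x|lebesgue. u (c *\<^sub>R x) * grad \<psi> (c *\<^sub>R x) $ i) = (LINT x|lebesgue. (1 / c) * (u (c *\<^sub>R x) * grad \<phi> x $ i))"
    using c by (intro Bochner_Integration.integral_cong) (auto simp: g\<psi>)
  also have "\<dots> = (1 / c) * (LINT x|lebesgue. u (c *\<^sub>R x) * grad \<phi> x $ i)" by (rule integral_mult_right_zero)
  finally have 1: "(LINT x|lebesgue. u x * grad \<psi> x $ i) = ?k * ((1 / c) * (LINT x|lebesgue. u (c *\<^sub>R x) * grad \<phi> x $ i))" .
  have "(LINT x|lebesgue. \<psi> x * U x $ i) = ?k * (LINT x|lebesgue. \<psi> (c *\<^sub>R x) * U (c *\<^sub>R x) $ i)"
    using integral_lebesgue_affine[of c "\<lambda>x. \<psi> x * U x $ i" 0] c borel_measurable_integrable[OF W(2)] by simp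
  then have 2: "(LINT x|lebesgue. \<psi> x * U x $ i) = ?k * (LINT x|lebesgue. \<phi> x * U (c *\<^sub>R x) $ i)"
    using c by (simp add: \<psi>_def)
  have "?k > 0" using c by simp
  then have "(1 / c) * (LINT x|lebesgue. u (c *\<^sub>R x) * grad \<phi> x $ i) = - (LINT x|lebesgue. \<phi> x * U (c *\<^sub>R x) $ i)"
    using W(3) unfolding 1 2 mult_minus_right[symmetric] by (subst (asm) mult_left_cancel) auto
  then have "(LINT x|lebesgue. u (c *\<^sub>R x) * grad \<phi> x $ i) = - (c * (LINT x|lebesgue. \<phi> x * U (c *\<^sub>R x) $ i))"
    using c by (simp add: field_simps)
  also have "c * (LINT x|lebesgue. \<phi> x * U (c *\<^sub>R x) $ i) = (LINT x|lebesgue. \<phi> x * (c *\<^sub>R U (c *\<^sub>R x)) $ i)"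
    unfolding integral_mult_right_zero[symmetric] by (intro Bochner_Integration.integral_cong) auto
  finally show "(LINT x|lebesgue. u (c *\<^sub>R x) * grad \<phi> x $ i) = - (LINT x|lebesgue. \<phi> x * (c *\<^sub>R U (c *\<^sub>R x)) $ i)" .
qed

lemma norm12_dilation:
  fixes u :: "real ^ 'n \<Rightarrow> real"
  assumes w: "has_weak_gradient u U" and c: "c > 0"
  shows "norm12 u = sqrt (c ^ DIM(real^'n) / c\<^sup>2) * norm12 (\<lambda>x. u (c *\<^sub>R x))"
proof -
  have Um: "U \<in> borel_measurable lebesgue" using has_weak_gradient_measurable[OF w] by simp
  then have "(\<lambda>x. (norm (U x))\<^sup>2) \<in> borel_measurable lebesgue" by measurable
  then have "(LINT x|lebesgue. (norm (U x))\<^sup>2) = c ^ DIM(real^'n) * (LINT x|lebesgue. (norm (U (c *\<^sub>R x)))\<^sup>2)"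
    using integral_lebesgue_affine[of c "\<lambda>x. (norm (U x))\<^sup>2" 0] c by simp
  moreover have "(LINT x|lebesgue. (norm (c *\<^sub>R U (c *\<^sub>R x)))\<^sup>2) = c\<^sup>2 * (LINT x|lebesgue. (norm (U (c *\<^sub>R x)))\<^sup>2)"
    unfolding integral_mult_right_zero[symmetric] by (simp add: power_mult_distrib)
  ultimately show ?thesis
    using c by (simp add: norm12_eq(1)[OF w] norm12_eq(1)[OF has_weak_gradient_dilation[OF w c]] real_sqrt_mult[symmetric])
qed

lemma D12_rad_dilation:
  fixes u :: "real ^ 'n \<Rightarrow> real"
  assumes u: "u \<in> D12_rad" and c: "c > 0"
  shows "(\<lambda>x. u (c *\<^sub>R x)) \<in> D12_rad"
proof -
  let ?p = "2 * real CARD('n) / (real CARD('n) - 2)"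
  obtain U where U: "has_weak_gradient u U" "integrable lebesgue (\<lambda>x. (norm (U x))\<^sup>2)"
    and um: "u \<in> borel_measurable lebesgue" and up: "integrable lebesgue (\<lambda>x. \<bar>u x\<bar> powr ?p)"
    using u by (auto simp: D12_rad_def D12_def)
  have 1: "(\<lambda>x. u (c *\<^sub>R x)) \<in> borel_measurable lebesgue"
    using measurable_lebesgue_affine[of c u 0] um c by simp
  have 2: "integrable lebesgue (\<lambda>x. \<bar>u (c *\<^sub>R x)\<bar> powr ?p)"
    using integrable_lebesgue_affine[of c "\<lambda>x. \<bar>u x\<bar> powr ?p" 0] up c borel_measurable_integrable[OF up] by simp
  have "integrable lebesgue (\<lambda>x. (norm (U (c *\<^sub>R x)))\<^sup>2)"
    using integrable_lebesgue_affine[of c "\<lambda>x. (norm (U x))\<^sup>2" 0] U(2) c borel_measurable_integrable[OF U(2)] by simp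
  then have 3: "integrable lebesgue (\<lambda>x. (norm (c *\<^sub>R U (c *\<^sub>R x)))\<^sup>2)"
    by (simp add: power_mult_distrib)
  have "\<exists>\<phi>\<in>Cc_inf_rad. norm12 (\<lambda>x. u (c *\<^sub>R x) - \<phi> x) < e" if e: "e > 0" for e
  proof -
    let ?k = "sqrt (c ^ DIM(real^'n) / c\<^sup>2)"
    have k: "?k > 0" using c by simp
    obtain \<phi> where \<phi>: "\<phi> \<in> Cc_inf_rad" "norm12 (\<lambda>x. u x - \<phi> x) < ?k * e"
      using u mult_pos_pos[OF k e] unfolding D12_rad_def by blast
    have "has_weak_gradient (\<lambda>x. u x - \<phi> x) (\<lambda>x. U x - grad \<phi> x)"
      by (rule has_weak_gradient_diff[OF U(1) smooth_has_weak_gradient[OF Cc_inf_smooth[OF Cc_inf_rad_Cc_inf[OF \<phi>(1)]]]])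
    from norm12_dilation[OF this c] \<phi>(2) k have "norm12 (\<lambda>x. u (c *\<^sub>R x) - \<phi> (c *\<^sub>R x)) < e" by simp
    then show ?thesis by (intro bexI[OF _ Cc_inf_rad_dilation[OF \<phi>(1) c]])
  qed
  then show ?thesis
    using 1 2 3 has_weak_gradient_dilation[OF U(1) c] unfolding D12_rad_def D12_def by blast
qed

lemma norm12_cmult:
  assumes "has_weak_gradient u U" shows "norm12 (\<lambda>x. c * u x) = \<bar>c\<bar> * norm12 u"
  by (simp add: norm12_eq(1)[OF assms] norm12_eq(1)[OF has_weak_gradient_cmult[OF assms]] power_mult_distrib real_sqrt_mult)

lemma D12_rad_cmult:
  fixes u :: "real ^ 'n \<Rightarrow> real"
  assumes u: "u \<in> D12_rad" and c: "c > 0"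
  shows "(\<lambda>x. c * u x) \<in> D12_rad"
proof -
  let ?p = "2 * real CARD('n) / (real CARD('n) - 2)"
  obtain U where U: "has_weak_gradient u U" "integrable lebesgue (\<lambda>x. (norm (U x))\<^sup>2)"
    and um: "u \<in> borel_measurable lebesgue" and up: "integrable lebesgue (\<lambda>x. \<bar>u x\<bar> powr ?p)"
    using u by (auto simp: D12_rad_def D12_def)
  have 2: "integrable lebesgue (\<lambda>x. \<bar>c * u x\<bar> powr ?p)"
    using up by (simp add: abs_mult powr_mult)
  have 3: "integrable lebesgue (\<lambda>x. (norm (c *\<^sub>R U x))\<^sup>2)"
    using U(2) by (simp add: power_mult_distrib)
  have "\<exists>\<phi>\<in>Cc_inf_rad. norm12 (\<lambda>x. c * u x - \<phi> x) < e" if e: "e > 0" for e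
  proof -
    obtain \<phi> where \<phi>: "\<phi> \<in> Cc_inf_rad" "norm12 (\<lambda>x. u x - \<phi> x) < e / c"
      using u divide_pos_pos[OF e c] unfolding D12_rad_def by blast
    have "has_weak_gradient (\<lambda>x. u x - \<phi> x) (\<lambda>x. U x - grad \<phi> x)"
      by (rule has_weak_gradient_diff[OF U(1) smooth_has_weak_gradient[OF Cc_inf_smooth[OF Cc_inf_rad_Cc_inf[OF \<phi>(1)]]]])
    from norm12_cmult[OF this, of c] \<phi>(2) c have "norm12 (\<lambda>x. c * u x - c * \<phi> x) < e"
      by (simp add: right_diff_distrib field_simps)
    then show ?thesis by (intro bexI[OF _ Cc_inf_rad_cmult[OF \<phi>(1)]])
  qed
  then show ?thesis
    using um 2 3 has_weak_gradient_cmult[OF U(1), of c] unfolding D12_rad_def D12_def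
    by (auto simp del: norm_scaleR)
qed

section \<open>The space on which the functional lives\<close>

lemma measurable_radial_weight:
  assumes "continuous_on {0<..} V"
  shows "(\<lambda>x::real^'n. V (norm x)) \<in> borel_measurable lebesgue"
proof -
  have "(\<lambda>r. if r \<in> {0<..} then V r else V 0) \<in> borel_measurable borel"
    by (rule borel_measurable_continuous_on_if) (auto intro: assms)
  then have "(\<lambda>x::real^'n. if norm x \<in> {0<..} then V (norm x) else V 0) \<in> borel_measurable borel"
    by (rule measurable_compose[OF borel_measurable_continuous_onI[OF continuous_on_norm[OF continuous_on_id]]])
  also have "(\<lambda>x::real^'n. if norm x \<in> {0<..} then V (norm x) else V 0) = (\<lambda>x. V (norm x))"
    by (auto simp: fun_eq_iff)
  finally show ?thesis by (simp add: measurable_completion)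
qed

lemma continuous_positive_half_line_bounded:
  fixes V :: "real \<Rightarrow> real" and a b :: real
  assumes "continuous_on {0<..} V" "0 < a"
  obtains B where "B > 0" "\<And>r. a \<le> r \<Longrightarrow> r \<le> b \<Longrightarrow> \<bar>V r\<bar> \<le> (B::real)"
proof -
  have "compact (V ` {a..b})"
    using assms(2) by (intro compact_continuous_image continuous_on_subset[OF assms(1)] compact_Icc) auto
  then obtain B where "B > 0" "\<forall>y\<in>V ` {a..b}. norm y \<le> B"
    using bounded_pos compact_imp_bounded by metis
  then show ?thesis by (intro that[of B]) auto
qed

text \<open>A radial test function that is positive exactly for \<open>a < |x|\<^sup>2 < b\<close>; for negative \<open>a\<close> this is a ball.\<close>

definition shell_bump :: "real \<Rightarrow> real \<Rightarrow> real ^ 'n \<Rightarrow> real" where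
  "shell_bump a b x = flat_exp 0 ((norm x)\<^sup>2 - a) * flat_exp 0 (b - (norm x)\<^sup>2)"

lemma flat_exp_0_mono: "s \<le> t \<Longrightarrow> flat_exp 0 s \<le> flat_exp 0 t"
  by (auto simp: flat_exp_def frac_le)

lemma flat_exp_0_pos: "s > 0 \<Longrightarrow> flat_exp 0 s > 0"
  by (simp add: flat_exp_def)

lemma shell_bump_Cc_inf_rad: "shell_bump a b \<in> Cc_inf_rad"
proof -
  have "smooth (\<lambda>x::real^'n. (norm x)\<^sup>2)"
  proof
    fix k
    have "C_k k (\<lambda>x::real^'n. \<Sum>i\<in>UNIV. x $ i * x $ i)" by (intro C_k_sum C_k_mult smooth_component)
    then show "C_k k (\<lambda>x::real^'n. (norm x)\<^sup>2)" by (simp add: power2_norm_eq_inner inner_vec_def)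
  qed
  note s = this[rule_format]
  have "smooth (shell_bump a b :: real^'n \<Rightarrow> real)"
    unfolding shell_bump_def[abs_def]
    by (intro allI C_k_mult[OF C_k_compose[OF smooth_flat_exp[rule_format] C_k_diff[OF s C_k_const]]
          C_k_compose[OF smooth_flat_exp[rule_format] C_k_diff[OF C_k_const s]]])
  moreover have "shell_bump a b x = 0" if "norm x \<ge> 1 + \<bar>b\<bar>" for x :: "real^'n"
  proof -
    have "\<bar>b\<bar> \<le> 1 + \<bar>b\<bar>" by simp
    also have "\<dots> \<le> (1 + \<bar>b\<bar>)\<^sup>2" by (simp add: power2_eq_square algebra_simps)
    also have "\<dots> \<le> (norm x)\<^sup>2" using that by (intro power_mono) auto
    finally show ?thesis by (simp add: shell_bump_def flat_exp_def)
  qed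
  ultimately have "(shell_bump a b :: real^'n \<Rightarrow> real) \<in> Cc_inf" by (rule Cc_infI)
  moreover have "radial (shell_bump a b :: real^'n \<Rightarrow> real)" by (simp add: radial_def shell_bump_def)
  ultimately show ?thesis by (simp add: Cc_inf_rad_def)
qed

lemma shell_bump_bounds: "0 \<le> shell_bump a b x" "shell_bump a b x \<le> 1"
  unfolding shell_bump_def using flat_exp_0_bounds by (auto intro!: mult_nonneg_nonneg mult_le_one)

lemma shell_bump_lower:
  assumes "a < s\<^sup>2" "t\<^sup>2 < b" "0 \<le> s"
  obtains m where "m > 0" "\<And>x::real^'n. s \<le> norm x \<Longrightarrow> norm x \<le> t \<Longrightarrow> m \<le> shell_bump a b x"
proof (rule that[of "flat_exp 0 (s\<^sup>2 - a) * flat_exp 0 (b - t\<^sup>2)"])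
  show "flat_exp 0 (s\<^sup>2 - a) * flat_exp 0 (b - t\<^sup>2) > 0" using assms by (simp add: flat_exp_0_pos)
  fix x :: "real^'n" assume x: "s \<le> norm x" "norm x \<le> t"
  have "s\<^sup>2 \<le> (norm x)\<^sup>2" "(norm x)\<^sup>2 \<le> t\<^sup>2" using x assms by (auto intro!: power_mono)
  then show "flat_exp 0 (s\<^sup>2 - a) * flat_exp 0 (b - t\<^sup>2) \<le> shell_bump a b x"
    unfolding shell_bump_def by (intro mult_mono flat_exp_0_mono flat_exp_0_bounds) auto
qed

text \<open>In dimension at least three the inverse square is integrable near the origin; here this is read
  off from Hardy's inequality for a test function that is positive on the ball.\<close>

lemma radial_weight_loc_integrable:
  assumes N: "CARD('n::finite) \<ge> 3"
    and V: "continuous_on {0<..} V" "\<And>r. r > 0 \<Longrightarrow> V r \<ge> 0" "\<exists>C>0. \<forall>r\<in>{0<..<1}. V r \<le> C / r\<^sup>2"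
  shows "integrable lebesgue (\<lambda>x::real^'n. indicator (cball 0 r) x * V (norm x))"
proof -
  obtain C where C: "C > 0" "\<forall>r\<in>{0<..<1}. V r \<le> C / r\<^sup>2" using V(3) by blast
  obtain B where B: "B > 0" "\<And>s. 1 \<le> s \<Longrightarrow> s \<le> r \<Longrightarrow> \<bar>V s\<bar> \<le> B"
    using continuous_positive_half_line_bounded[OF V(1) zero_less_one, of r] by blast
  have "(1::real)\<^sup>2 < 2" by simp
  then obtain m where m: "m > 0" "\<And>x::real^'n. 0 \<le> norm x \<Longrightarrow> norm x \<le> 1 \<Longrightarrow> m \<le> shell_bump (-1) 2 x"
    using shell_bump_lower[of "-1" 0 1 2] by auto
  let ?h = "shell_bump (-1) 2 :: real^'n \<Rightarrow> real"
  have hi: "integrable lebesgue (\<lambda>x. (?h x)\<^sup>2 / (norm x)\<^sup>2)"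
    by (rule integrable_sq_divide_norm_sq[OF N Cc_inf_rad_Cc_inf[OF shell_bump_Cc_inf_rad]])
  have cm: "cball (0 :: real^'n) r \<in> sets lebesgue" by (auto intro: fmeasurableD)
  show ?thesis
  proof (rule integrable_lebesgue_bound)
    show "integrable lebesgue (\<lambda>x. C / m\<^sup>2 * ((?h x)\<^sup>2 / (norm x)\<^sup>2) + B * indicator (cball 0 r) x)"
      by (intro Bochner_Integration.integrable_add integrable_mult_right hi integrable_indicator_cball)
    show "(\<lambda>x::real^'n. indicator (cball 0 r) x * V (norm x)) \<in> borel_measurable lebesgue"
      by (intro borel_measurable_times borel_measurable_indicator cm measurable_radial_weight V)
    fix x :: "real^'n" assume x: "x \<noteq> 0"
    have nn: "C / m\<^sup>2 * ((?h x)\<^sup>2 / (norm x)\<^sup>2) \<ge> 0" "B * indicator (cball 0 r) x \<ge> 0"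
      using C(1) B(1) by auto
    have "V (norm x) \<le> C / m\<^sup>2 * ((?h x)\<^sup>2 / (norm x)\<^sup>2)" if "norm x < 1"
    proof -
      have "m\<^sup>2 \<le> (?h x)\<^sup>2" using m(2)[of x] m(1) that by (intro power_mono) auto
      then have "1 \<le> (?h x)\<^sup>2 / m\<^sup>2" using m(1) by simp
      then have "C / (norm x)\<^sup>2 * 1 \<le> C / (norm x)\<^sup>2 * ((?h x)\<^sup>2 / m\<^sup>2)" using C(1) by (intro mult_left_mono) auto
      moreover have "V (norm x) \<le> C / (norm x)\<^sup>2" using C(2) x that by auto
      ultimately show ?thesis by (simp add: mult_ac)
    qed
    moreover have "V (norm x) \<ge> 0" using V(2) x by simp
    moreover have "V (norm x) \<le> B" if "norm x \<ge> 1" "norm x \<le> r" using B(2)[of "norm x"] that by simp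
    ultimately show "norm (indicator (cball 0 r) x * V (norm x)) \<le> C / m\<^sup>2 * ((?h x)\<^sup>2 / (norm x)\<^sup>2) + B * indicator (cball 0 r) x"
      using nn B(1) by (cases "norm x < 1") (auto split: split_indicator)
  qed
qed

text \<open>Since \<open>(f\<^sup>2)' = 2 f / sqrt (1 + 2 f\<^sup>2)\<close> is bounded, \<open>f\<^sup>2\<close> grows at most linearly. This is why products
  with the weight remain locally square integrable.\<close>

lemma dual_f_sq_Lipschitz: "\<bar>(dual_f a)\<^sup>2 - (dual_f b)\<^sup>2\<bar> \<le> 2 * \<bar>a - b\<bar>"
proof (rule DERIV_bounded_imp_Lipschitz[where \<phi>'="\<lambda>t. of_nat 2 * (1 / dual_w t * dual_f t ^ (2 - Suc 0))"])
  show "((\<lambda>t. (dual_f t)\<^sup>2) has_real_derivative of_nat 2 * (1 / dual_w t * dual_f t ^ (2 - Suc 0))) (at t)" for t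
    by (rule DERIV_power[OF dual_f_DERIV'])
  show "\<bar>of_nat 2 * (1 / dual_w t * dual_f t ^ (2 - Suc 0))\<bar> \<le> 2" for t
    using abs_dual_f_le_dual_w[of t] dual_w_pos[of t] by (simp add: abs_mult divide_le_eq)
qed

lemma dual_w_sq_le: "(dual_w t)\<^sup>2 \<le> 1 + 4 * \<bar>t\<bar>"
  using dual_f_sq_Lipschitz[of t 0] by (simp add: dual_w_sq dual_f_0)

text \<open>The functions \<open>h / f'(u) = h * sqrt (1 + 2 f(u)\<^sup>2)\<close> are unbounded in general, but the weight has a
  bounded derivative, so the chain rule applies to them.\<close>

lemma D12_rad_test_times_dual_w:
  fixes u h :: "real ^ 'n \<Rightarrow> real"
  assumes N: "CARD('n) \<ge> 3" and u: "u \<in> D12_rad" and U: "has_weak_gradient u U" and h: "h \<in> Cc_inf_rad"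
  defines "W \<equiv> \<lambda>x. dual_w (u x) *\<^sub>R grad h x + (h x * (2 * dual_f (u x) * (1 / dual_w (u x))\<^sup>2)) *\<^sub>R U x"
  shows "(\<lambda>x. h x * dual_w (u x)) \<in> D12_rad" "has_weak_gradient (\<lambda>x. h x * dual_w (u x)) W"
    "integrable lebesgue (\<lambda>x. (norm (W x))\<^sup>2)" "integrable lebesgue (\<lambda>x. (norm (U x))\<^sup>2)"
proof -
  have hc: "h \<in> Cc_inf" and hr: "radial h" using h by (auto simp: Cc_inf_rad_def)
  obtain r B where "test_bound h r B" using Cc_inf_test_bound[OF hc] by blast
  note rB = test_boundD[OF this]
  have sm: "smooth h" using hc by (rule Cc_inf_smooth)
  let ?p = "2 * real CARD('n) / (real CARD('n) - 2)"
  have p0: "?p \<ge> 0" using N by simp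
  have um[measurable]: "u \<in> borel_measurable lebesgue" and up: "integrable lebesgue (\<lambda>x. \<bar>u x\<bar> powr ?p)"
    using u by (auto simp: D12_rad_def D12_def)
  have hm[measurable]: "h \<in> borel_measurable lebesgue"
    by (intro continuous_imp_measurable_lebesgue smooth_imp_continuous sm)
  have dm[measurable]: "dual_w \<in> borel_measurable borel"
    by (intro borel_measurable_continuous_onI smooth_imp_continuous smooth_dual_w)
  have test: "(\<lambda>x. h x * dual_w (\<phi> x)) \<in> Cc_inf_rad" if \<phi>: "\<phi> \<in> Cc_inf_rad" for \<phi>
  proof -
    have \<phi>': "smooth \<phi>" "radial \<phi>" using \<phi> by (auto simp: Cc_inf_rad_def Cc_inf_def)
    have "(\<lambda>x. h x * dual_w (\<phi> x)) \<in> Cc_inf"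
    proof (rule Cc_infI[where r=r])
      show "smooth (\<lambda>x. h x * dual_w (\<phi> x))"
        by (intro allI C_k_mult[OF sm[rule_format] C_k_compose[OF smooth_dual_w[rule_format] \<phi>'(1)[rule_format]]])
    qed (simp add: rB)
    moreover have "radial (\<lambda>x. h x * dual_w (\<phi> x))" using hr \<phi>'(2) unfolding radial_def by metis
    ultimately show ?thesis by (simp add: Cc_inf_rad_def)
  qed
  have powr: "integrable lebesgue (\<lambda>x. \<bar>h x * dual_w (u x)\<bar> powr ?p)"
  proof (rule integrable_lebesgue_bound)
    show "integrable lebesgue (\<lambda>x. B powr ?p * (2 powr ?p * (indicator (cball 0 r) x + \<bar>u x\<bar> powr ?p)))"
      by (intro integrable_mult_right Bochner_Integration.integrable_add integrable_indicator_cball up)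
    show "norm (\<bar>h x * dual_w (u x)\<bar> powr ?p) \<le> B powr ?p * (2 powr ?p * (indicator (cball 0 r) x + \<bar>u x\<bar> powr ?p))" for x
    proof (cases "norm x \<le> r")
      case True
      have "\<bar>h x * dual_w (u x)\<bar> powr ?p = \<bar>h x\<bar> powr ?p * dual_w (u x) powr ?p"
        using dual_w_pos[of "u x"] by (simp add: abs_mult powr_mult)
      also have "\<dots> \<le> B powr ?p * (\<bar>1 + \<bar>u x\<bar>\<bar> powr ?p)"
        using dual_w_le'[of "u x"] dual_w_pos[of "u x"] rB(2,3) p0 by (intro mult_mono powr_mono2) auto
      also have "\<dots> \<le> B powr ?p * (2 powr ?p * (\<bar>1\<bar> powr ?p + \<bar>\<bar>u x\<bar>\<bar> powr ?p))"
        by (intro mult_left_mono powr_abs_add_le p0) auto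
      finally show ?thesis using True by simp
    next
      case False
      then show ?thesis using rB(5)[of x] by simp
    qed
  qed measurable
  note R = D12_rad_chain_rule[OF N u U sm rB(3,4,6) smooth_dual_w dual_w_DERIV dual_w_deriv_le_1 test powr]
  show "(\<lambda>x. h x * dual_w (u x)) \<in> D12_rad" "has_weak_gradient (\<lambda>x. h x * dual_w (u x)) W"
    "integrable lebesgue (\<lambda>x. (norm (W x))\<^sup>2)" "integrable lebesgue (\<lambda>x. (norm (U x))\<^sup>2)"
    using R by (simp_all only: W_def)
qed

text \<open>The chain rule with the constant cutoff; the approximating functions have compact support because
  \<open>f 0 = 0\<close>.\<close>

lemma D12_rad_dual_f:
  fixes u :: "real ^ 'n \<Rightarrow> real"
  assumes N: "CARD('n) \<ge> 3" and u: "u \<in> D12_rad" and U: "has_weak_gradient u U"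
  shows "(\<lambda>x. dual_f (u x)) \<in> D12_rad" "has_weak_gradient (\<lambda>x. dual_f (u x)) (\<lambda>x. (1 / dual_w (u x)) *\<^sub>R U x)"
proof -
  let ?p = "2 * real CARD('n) / (real CARD('n) - 2)"
  have p0: "?p \<ge> 0" using N by simp
  have um[measurable]: "u \<in> borel_measurable lebesgue" and up: "integrable lebesgue (\<lambda>x. \<bar>u x\<bar> powr ?p)"
    using u by (auto simp: D12_rad_def D12_def)
  have dm[measurable]: "dual_f \<in> borel_measurable borel"
    by (intro borel_measurable_continuous_onI smooth_imp_continuous smooth_dual_f)
  have test: "(\<lambda>x. 1 * dual_f (\<phi> x)) \<in> Cc_inf_rad" if \<phi>: "\<phi> \<in> Cc_inf_rad" for \<phi> :: "real^'n \<Rightarrow> real"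
  proof -
    have \<phi>': "\<phi> \<in> Cc_inf" "radial \<phi>" using \<phi> by (auto simp: Cc_inf_rad_def)
    obtain r where r: "r > 0" "\<And>x. norm x \<ge> r \<Longrightarrow> \<phi> x = 0" using Cc_inf_support[OF \<phi>'(1)] by blast
    have "(\<lambda>x. 1 * dual_f (\<phi> x)) \<in> Cc_inf"
    proof (rule Cc_infI[where r=r])
      show "smooth (\<lambda>x. 1 * dual_f (\<phi> x))"
        by (intro allI C_k_mult[OF C_k_const C_k_compose[OF smooth_dual_f[rule_format] Cc_inf_smooth[OF \<phi>'(1), rule_format]]])
    qed (simp add: r dual_f_0)
    moreover have "radial (\<lambda>x. 1 * dual_f (\<phi> x))" using \<phi>'(2) unfolding radial_def by metis
    ultimately show ?thesis by (simp add: Cc_inf_rad_def)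
  qed
  have powr: "integrable lebesgue (\<lambda>x. \<bar>1 * dual_f (u x)\<bar> powr ?p)"
  proof (rule integrable_lebesgue_bound[OF up])
    show "norm (\<bar>1 * dual_f (u x)\<bar> powr ?p) \<le> \<bar>u x\<bar> powr ?p" for x
      using abs_dual_f_le p0 by (simp add: powr_mono2)
  qed measurable
  have d1: "\<bar>1 / dual_w t\<bar> \<le> 1" for t using inverse_dual_w_bounds[of t] by simp
  have g0: "grad (\<lambda>x. 1) x = (0 :: real^'n)" for x by (rule grad_const)
  have sm1: "smooth (\<lambda>x::real^'n. 1)" by simp
  have b: "\<bar>1::real\<bar> \<le> 1" "norm (grad (\<lambda>x. 1) x :: real^'n) \<le> 1" for x by (simp_all add: g0)
  note R = D12_rad_chain_rule[OF N u U sm1 b g0 smooth_dual_f dual_f_DERIV' d1 test powr]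
  show "(\<lambda>x. dual_f (u x)) \<in> D12_rad" "has_weak_gradient (\<lambda>x. dual_f (u x)) (\<lambda>x. (1 / dual_w (u x)) *\<^sub>R U x)"
    using R(1,2) by (simp_all add: g0)
qed

lemma measurable_dual [measurable]: "dual_f \<in> borel_measurable borel" "dual_w \<in> borel_measurable borel"
  by (auto intro!: borel_measurable_continuous_onI smooth_imp_continuous smooth_dual_w smooth_dual_f)

text \<open>On the support of \<open>h\<close> both \<open>|v|\<close> and \<open>v\<^sup>2\<close>, for \<open>v = h * sqrt (1 + 2 f(u)\<^sup>2)\<close>, are bounded by a multiple of
  \<open>1 + f(u)\<^sup>2\<close>, whose product with the potential is integrable there.\<close>

lemma E_space_test_times_dual_w:
  fixes u h :: "real ^ 'n \<Rightarrow> real"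
  assumes N: "CARD('n) \<ge> 3"
    and V: "continuous_on {0<..} V" "\<And>r. r > 0 \<Longrightarrow> V r \<ge> 0" "\<exists>C>0. \<forall>r\<in>{0<..<1}. V r \<le> C / r\<^sup>2"
    and u: "u \<in> E_space V" and h: "h \<in> Cc_inf_rad"
  shows "(\<lambda>x. h x * dual_w (u x)) \<in> E_space V"
    and "integrable lebesgue (\<lambda>x. V (norm x) * (h x * dual_w (u x))\<^sup>2)"
    and "integrable lebesgue (\<lambda>x. V (norm x) * \<bar>h x * dual_w (u x)\<bar>)"
proof -
  have uD: "u \<in> D12_rad" and uV: "integrable lebesgue (\<lambda>x. V (norm x) * (dual_f (u x))\<^sup>2)"
    using u by (auto simp: E_space_def)
  obtain U where U: "has_weak_gradient u U" using uD by (auto simp: D12_rad_def D12_def)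
  note D = D12_rad_test_times_dual_w[OF N uD U h]
  have hc: "h \<in> Cc_inf" using h by (auto simp: Cc_inf_rad_def)
  obtain r B where "test_bound h r B" using Cc_inf_test_bound[OF hc] by blast
  note rB = test_boundD[OF this]
  have [measurable]: "u \<in> borel_measurable lebesgue" "(\<lambda>x::real^'n. V (norm x)) \<in> borel_measurable lebesgue"
    "h \<in> borel_measurable lebesgue"
    using has_weak_gradient_measurable[OF U] measurable_radial_weight[OF V(1)]
      continuous_imp_measurable_lebesgue[OF smooth_imp_continuous[OF Cc_inf_smooth[OF hc]]] by auto
  have Vi: "integrable lebesgue (\<lambda>x. indicator (cball 0 r) x * V (norm x) + V (norm x) * (dual_f (u x))\<^sup>2)"
    by (intro Bochner_Integration.integrable_add radial_weight_loc_integrable[OF N V] uV)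
  let ?M = "\<lambda>x. indicator (cball 0 r) x * V (norm x) + V (norm x) * (dual_f (u x))\<^sup>2"
  have sq: "\<bar>V (norm x)\<bar> * (h x * dual_w (u x))\<^sup>2 \<le> 2 * B\<^sup>2 * ?M x"
    and ab: "\<bar>V (norm x)\<bar> * \<bar>h x * dual_w (u x)\<bar> \<le> 2 * B * ?M x" if x: "x \<noteq> 0" for x
  proof -
    have V0: "V (norm x) \<ge> 0" using V(2) x by simp
    have "V (norm x) * (h x * dual_w (u x))\<^sup>2 \<le> 2 * B\<^sup>2 * ?M x \<and> V (norm x) * \<bar>h x * dual_w (u x)\<bar> \<le> 2 * B * ?M x"
    proof (cases "norm x \<le> r")
      case True
      let ?f = "2 * (1 + (dual_f (u x))\<^sup>2)"
      have "(h x)\<^sup>2 \<le> B\<^sup>2" using power_mono[OF rB(3)[of x], of 2] by simp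
      then have "(h x * dual_w (u x))\<^sup>2 \<le> B\<^sup>2 * ?f"
        unfolding power_mult_distrib dual_w_sq by (intro mult_mono) auto
      then have 1: "V (norm x) * (h x * dual_w (u x))\<^sup>2 \<le> V (norm x) * (B\<^sup>2 * ?f)"
        using V0 by (intro mult_left_mono)
      have "dual_w (u x) * 1 \<le> (dual_w (u x)) * dual_w (u x)"
        using dual_w_ge_1[of "u x"] by (intro mult_left_mono) auto
      then have "dual_w (u x) \<le> ?f"
        using dual_w_sq[of "u x"] unfolding power2_eq_square by simp
      then have "\<bar>h x * dual_w (u x)\<bar> \<le> B * ?f"
        unfolding abs_mult using rB(2,3) dual_w_pos[of "u x"] by (intro mult_mono) auto
      then have 2: "V (norm x) * \<bar>h x * dual_w (u x)\<bar> \<le> V (norm x) * (B * ?f)"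
        using V0 by (intro mult_left_mono)
      show ?thesis using 1 2 True by (simp add: algebra_simps)
    next
      case False
      then show ?thesis using rB(5)[of x] rB(2) V0 by simp
    qed
    then show "\<bar>V (norm x)\<bar> * (h x * dual_w (u x))\<^sup>2 \<le> 2 * B\<^sup>2 * ?M x" "\<bar>V (norm x)\<bar> * \<bar>h x * dual_w (u x)\<bar> \<le> 2 * B * ?M x"
      using V0 by simp_all
  qed
  show "integrable lebesgue (\<lambda>x. V (norm x) * (h x * dual_w (u x))\<^sup>2)"
    by (rule integrable_lebesgue_bound[OF integrable_mult_right[OF Vi], of _ "2 * B\<^sup>2"])
       (measurable, use sq in \<open>simp only: real_norm_def abs_mult abs_power2 abs_abs\<close>)
  show "integrable lebesgue (\<lambda>x. V (norm x) * \<bar>h x * dual_w (u x)\<bar>)"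
    by (rule integrable_lebesgue_bound[OF integrable_mult_right[OF Vi], of _ "2 * B"])
       (measurable, use ab in \<open>simp only: real_norm_def abs_mult abs_abs\<close>)
  have "integrable lebesgue (\<lambda>x. V (norm x) * (dual_f (h x * dual_w (u x)))\<^sup>2)"
  proof (rule integrable_lebesgue_bound[OF integrable_mult_right[OF Vi], of _ "2 * B\<^sup>2"])
    fix x :: "real^'n" assume x: "x \<noteq> 0"
    have "\<bar>dual_f (h x * dual_w (u x))\<bar>\<^sup>2 \<le> \<bar>h x * dual_w (u x)\<bar>\<^sup>2" by (intro power_mono abs_dual_f_le) auto
    then have "(dual_f (h x * dual_w (u x)))\<^sup>2 \<le> (h x * dual_w (u x))\<^sup>2" unfolding power2_abs .
    then have "\<bar>V (norm x)\<bar> * (dual_f (h x * dual_w (u x)))\<^sup>2 \<le> \<bar>V (norm x)\<bar> * (h x * dual_w (u x))\<^sup>2"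
      by (intro mult_left_mono) auto
    with sq[OF x] show "norm (V (norm x) * (dual_f (h x * dual_w (u x)))\<^sup>2) \<le> 2 * B\<^sup>2 * ?M x"
      unfolding real_norm_def abs_mult[of "V (norm x)"] abs_power2 by (rule order_trans[rotated])
  qed measurable
  then show "(\<lambda>x. h x * dual_w (u x)) \<in> E_space V" using D(1) by (simp add: E_space_def)
qed

lemma E_space_cmult:
  fixes u :: "real ^ 'n \<Rightarrow> real"
  assumes V: "continuous_on {0<..} V" "\<And>r. r > 0 \<Longrightarrow> V r \<ge> 0" and u: "u \<in> E_space V" and c: "c > 0"
  shows "(\<lambda>x. c * u x) \<in> E_space V"
proof -
  have uD: "u \<in> D12_rad" and uV: "integrable lebesgue (\<lambda>x. V (norm x) * (dual_f (u x))\<^sup>2)"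
    using u by (auto simp: E_space_def)
  have [measurable]: "u \<in> borel_measurable lebesgue" "(\<lambda>x::real^'n. V (norm x)) \<in> borel_measurable lebesgue"
    using uD measurable_radial_weight[OF V(1)] by (auto simp: D12_rad_def D12_def)
  have "integrable lebesgue (\<lambda>x. V (norm x) * (dual_f (c * u x))\<^sup>2)"
  proof (rule integrable_lebesgue_bound)
    show "integrable lebesgue (\<lambda>x. \<bar>max 1 (c\<^sup>2) * (V (norm x) * (dual_f (u x))\<^sup>2)\<bar>)"
      by (intro integrable_abs integrable_mult_right uV)
    fix x :: "real^'n"
    have "\<bar>V (norm x)\<bar> * (dual_f (c * u x))\<^sup>2 \<le> \<bar>V (norm x)\<bar> * (max 1 (c\<^sup>2) * (dual_f (u x))\<^sup>2)"
      by (intro mult_left_mono dual_f_mult_sq_le c) auto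
    then show "norm (V (norm x) * (dual_f (c * u x))\<^sup>2) \<le> \<bar>max 1 (c\<^sup>2) * (V (norm x) * (dual_f (u x))\<^sup>2)\<bar>"
      by (simp add: abs_mult mult_ac)
  qed measurable
  then show ?thesis using D12_rad_cmult[OF uD c] by (simp add: E_space_def)
qed

lemma norm_o_bounds:
  fixes u :: "real ^ 'n \<Rightarrow> real"
  assumes V: "\<And>r. r > 0 \<Longrightarrow> V r \<ge> 0"
  shows "norm_o V u \<ge> 0"
    and "k > 0 \<Longrightarrow> norm_o V u \<le> 1 / k * (1 + (LINT x|lebesgue. V (norm x) * (dual_f (k * u x))\<^sup>2))"
proof -
  have "(LINT x|lebesgue. V (norm x) * (dual_f (k * u x))\<^sup>2) \<ge> 0" for k
    by (rule integral_nonneg_AE) (use AE_lebesgue_neq_0 in eventually_elim, simp add: V)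
  then have nn: "1 / k * (1 + (LINT x|lebesgue. V (norm x) * (dual_f (k * u x))\<^sup>2)) \<ge> 0" if "k > 0" for k
    using that by (intro mult_nonneg_nonneg add_nonneg_nonneg) auto
  show "norm_o V u \<ge> 0"
    unfolding norm_o_def by (rule cINF_greatest) (use nn in auto)
  show "norm_o V u \<le> 1 / k * (1 + (LINT x|lebesgue. V (norm x) * (dual_f (k * u x))\<^sup>2))" if "k > 0"
    unfolding norm_o_def
    by (rule cINF_lower) (use nn that in \<open>auto intro!: bdd_belowI[of _ 0]\<close>)
qed

text \<open>Substituting \<open>k / c\<close> for \<open>k\<close> in the infimum gives one inequality for all functions and all factors; the
  reverse one is the same inequality for \<open>c u\<close> and the factor \<open>1 / c\<close>.\<close>

lemma norm_o_cmult:
  fixes u :: "real ^ 'n \<Rightarrow> real"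
  assumes V: "\<And>r. r > 0 \<Longrightarrow> V r \<ge> 0" and c: "c > 0"
  shows "norm_o V (\<lambda>x. c * u x) = c * norm_o V u"
proof -
  have le: "norm_o V (\<lambda>x. c * u x) \<le> c * norm_o V u" if c: "c > 0" for c and u :: "real^'n \<Rightarrow> real"
  proof -
    have "norm_o V (\<lambda>x. c * u x) / c \<le> norm_o V u"
      unfolding norm_o_def[of V u]
    proof (rule cINF_greatest)
      fix k :: real assume "k \<in> {0<..}"
      then have k: "k > 0" by simp
      have "norm_o V (\<lambda>x. c * u x) \<le> 1 / (k / c) * (1 + (LINT x|lebesgue. V (norm x) * (dual_f ((k / c) * (c * u x)))\<^sup>2))"
        by (rule norm_o_bounds(2)[OF V]) (use k c in auto)
      also have "\<dots> = c * (1 / k * (1 + (LINT x|lebesgue. V (norm x) * (dual_f (k * u x))\<^sup>2)))"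
        using c by simp
      finally show "norm_o V (\<lambda>x. c * u x) / c \<le> 1 / k * (1 + (LINT x|lebesgue. V (norm x) * (dual_f (k * u x))\<^sup>2))"
        using c by (simp only: pos_divide_le_eq mult.commute[of _ c])
    qed simp
    then show ?thesis using c by (simp add: field_simps)
  qed
  have "norm_o V (\<lambda>x. 1 / c * (c * u x)) \<le> 1 / c * norm_o V (\<lambda>x. c * u x)"
    by (rule le) (use c in simp)
  then have "c * norm_o V u \<le> norm_o V (\<lambda>x. c * u x)" using c by (simp add: field_simps)
  then show ?thesis using le[OF c, of u] by simp
qed

lemma norm_E_cmult:
  assumes V: "\<And>r. r > 0 \<Longrightarrow> V r \<ge> 0" and c: "c > 0" and u: "u \<in> E_space V"
  shows "norm_E V (\<lambda>x. c * u x) = c * norm_E V u"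
proof -
  obtain U where "has_weak_gradient u U" using u by (auto simp: E_space_def D12_rad_def D12_def)
  from norm12_cmult[OF this, of c] show ?thesis
    using c by (simp add: norm_E_def norm_o_cmult[OF V c] distrib_left)
qed

text \<open>With a vanishing gradient the parameter of the duality estimate can be sent to infinity.\<close>

lemma norm12_zero_imp_AE_zero:
  fixes u :: "real ^ 'n \<Rightarrow> real"
  assumes N: "CARD('n) \<ge> 3" and u: "u \<in> D12" and z: "norm12 u = 0"
  shows "AE x in lebesgue. u x = 0"
proof -
  let ?p = "2 * real CARD('n) / (real CARD('n) - 2)"
  have p1: "?p \<ge> 1" using N by (simp add: field_simps)
  obtain U where U: "has_weak_gradient u U" "integrable lebesgue (\<lambda>x. (norm (U x))\<^sup>2)"
    and up: "integrable lebesgue (\<lambda>x. \<bar>u x\<bar> powr ?p)"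
    using u by (auto simp: D12_def)
  have G0: "(LINT x|lebesgue. (norm (U x))\<^sup>2) = 0" using z norm12_eq(1)[OF U(1)] by simp
  show ?thesis
  proof (rule AE_zero_if_test_integrals_zero)
    show "loc_integrable u" using U(1) by (auto simp: has_weak_gradient_def)
    fix \<eta> :: "real^'n \<Rightarrow> real" assume \<eta>: "\<eta> \<in> Cc_inf"
    obtain C where C: "C \<ge> 0"
      "\<And>v V p a. has_weak_gradient v V \<Longrightarrow> integrable lebesgue (\<lambda>x. (norm (V x))\<^sup>2) \<Longrightarrow> p \<ge> 1
      \<Longrightarrow> integrable lebesgue (\<lambda>x. \<bar>v x\<bar> powr p) \<Longrightarrow> a > 0
      \<Longrightarrow> \<bar>LINT x|lebesgue. v x * \<eta> x\<bar> \<le> C * (a * (LINT x|lebesgue. (norm (V x))\<^sup>2) + 1 / a)"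
      using test_integral_le_gradient[OF N \<eta>] by blast
    have "\<bar>LINT x|lebesgue. u x * \<eta> x\<bar> \<le> 0 + e" if e: "e > 0" for e
    proof -
      have "\<bar>LINT x|lebesgue. u x * \<eta> x\<bar> \<le> C * (1 / ((C + 1) / e))"
        using C(2)[OF U p1 up, of "(C + 1) / e"] C(1) e G0 by simp
      also have "\<dots> = C / (C + 1) * e" by simp
      also have "\<dots> \<le> 1 * e" using C(1) e by (intro mult_right_mono) auto
      finally show ?thesis by simp
    qed
    then have "\<bar>LINT x|lebesgue. u x * \<eta> x\<bar> \<le> 0" by (rule field_le_epsilon)
    then show "(LINT x|lebesgue. \<eta> x * u x) = 0" by (simp add: mult.commute)
  qed
qed

text \<open>Homogeneity of the norm turns the finiteness of the suprema over the unit sphere into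
  integrability for every element of the energy space.\<close>

lemma S_finite_imp_integrable:
  fixes v :: "real ^ 'n \<Rightarrow> real"
  assumes N: "CARD('n) \<ge> 3" and V: "continuous_on {0<..} V" "\<And>r. r > 0 \<Longrightarrow> V r \<ge> 0"
    and K: "continuous_on {0<..} K" "\<And>r. r > 0 \<Longrightarrow> K r > 0" and A: "A \<in> sets lebesgue"
    and fin: "(SUP u\<in>{u \<in> (E_space V :: (real ^ 'n \<Rightarrow> real) set). norm_E V u = 1}.
        \<integral>\<^sup>+x\<in>A. ennreal (K (norm x) * \<bar>u x\<bar> powr q) \<partial>lebesgue) < \<infinity>"
    and v: "v \<in> E_space V"
  shows "integrable lebesgue (\<lambda>x. indicator A x * (K (norm x) * \<bar>v x\<bar> powr q))"
proof (rule integrableI_bounded)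
  obtain U where U: "has_weak_gradient v U" using v by (auto simp: E_space_def D12_rad_def D12_def)
  have [measurable]: "v \<in> borel_measurable lebesgue" "(\<lambda>x::real^'n. K (norm x)) \<in> borel_measurable lebesgue" "A \<in> sets lebesgue"
    using has_weak_gradient_measurable[OF U] measurable_radial_weight[OF K(1)] A by auto
  show "(\<lambda>x. indicator A x * (K (norm x) * \<bar>v x\<bar> powr q)) \<in> borel_measurable lebesgue" by measurable
  have e: "(\<integral>\<^sup>+x. ennreal (norm (indicator A x * (K (norm x) * \<bar>v x\<bar> powr q))) \<partial>lebesgue)
     = (\<integral>\<^sup>+x\<in>A. ennreal (K (norm x) * \<bar>v x\<bar> powr q) \<partial>lebesgue)"
  proof (rule nn_integral_cong_AE)
    show "AE x in lebesgue. ennreal (norm (indicator A x * (K (norm x) * \<bar>v x\<bar> powr q))) = ennreal (K (norm x) * \<bar>v x\<bar> powr q) * indicator A x"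
      using AE_lebesgue_neq_0
    proof eventually_elim
      fix x :: "real^'n" assume "x \<noteq> 0"
      then have "K (norm x) > 0" by (intro K(2)) simp
      then show "ennreal (norm (indicator A x * (K (norm x) * \<bar>v x\<bar> powr q))) = ennreal (K (norm x) * \<bar>v x\<bar> powr q) * indicator A x"
        by (auto simp: abs_mult split: split_indicator)
    qed
  qed
  define s where "s = norm_E V v"
  have s0: "norm12 v \<ge> 0" "norm_o V v \<ge> 0" using norm_o_bounds(1)[OF V(2)] by (auto simp: norm12_def)
  show "(\<integral>\<^sup>+x. ennreal (norm (indicator A x * (K (norm x) * \<bar>v x\<bar> powr q))) \<partial>lebesgue) < \<infinity>"
  proof (cases "s = 0")
    case True
    then have "norm12 v = 0" using s0 by (simp add: s_def norm_E_def)
    then have "AE x in lebesgue. v x = 0"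
      using v by (intro norm12_zero_imp_AE_zero[OF N]) (auto simp: E_space_def D12_rad_def)
    then have "(\<integral>\<^sup>+x. ennreal (norm (indicator A x * (K (norm x) * \<bar>v x\<bar> powr q))) \<partial>lebesgue) = (\<integral>\<^sup>+x. 0 \<partial>(lebesgue :: (real^'n) measure))"
      by (intro nn_integral_cong_AE) (auto elim!: eventually_mono)
    then show ?thesis by simp
  next
    case False
    then have s: "s > 0" using s0 by (simp add: s_def norm_E_def)
    let ?u = "\<lambda>x. 1 / s * v x"
    have "?u \<in> E_space V" by (rule E_space_cmult[OF V v divide_pos_pos[OF zero_less_one s]])
    moreover have "norm_E V ?u = 1" using norm_E_cmult[OF V(2) _ v, of "1 / s"] s by (simp add: s_def[symmetric])
    ultimately have "(\<integral>\<^sup>+x\<in>A. ennreal (K (norm x) * \<bar>?u x\<bar> powr q) \<partial>lebesgue) \<le> (SUP u\<in>{u \<in> (E_space V :: (real ^ 'n \<Rightarrow> real) set). norm_E V u = 1}.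
        \<integral>\<^sup>+x\<in>A. ennreal (K (norm x) * \<bar>u x\<bar> powr q) \<partial>lebesgue)"
      by (intro SUP_upper) blast
    then have uf: "(\<integral>\<^sup>+x\<in>A. ennreal (K (norm x) * \<bar>?u x\<bar> powr q) \<partial>lebesgue) < \<infinity>" using fin by (rule le_less_trans)
    have "(\<integral>\<^sup>+x\<in>A. ennreal (K (norm x) * \<bar>v x\<bar> powr q) \<partial>lebesgue)
      = (\<integral>\<^sup>+x. ennreal (s powr q) * (ennreal (K (norm x) * \<bar>?u x\<bar> powr q) * indicator A x) \<partial>lebesgue)"
    proof (rule nn_integral_cong)
      fix x
      have "K (norm x) * \<bar>v x\<bar> powr q = s powr q * (K (norm x) * \<bar>?u x\<bar> powr q)"
        using s by (simp add: abs_mult powr_divide)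
      then show "ennreal (K (norm x) * \<bar>v x\<bar> powr q) * indicator A x = ennreal (s powr q) * (ennreal (K (norm x) * \<bar>?u x\<bar> powr q) * indicator A x)"
        by (simp only: ennreal_mult' powr_ge_zero mult.assoc)
    qed
    also have "\<dots> = ennreal (s powr q) * (\<integral>\<^sup>+x\<in>A. ennreal (K (norm x) * \<bar>?u x\<bar> powr q) \<partial>lebesgue)"
      by (rule nn_integral_cmult) measurable
    also have "\<dots> < \<infinity>" using uf by (simp add: ennreal_mult_less_top)
    finally show ?thesis unfolding e .
  qed
qed

section \<open>Domination of the nonlinear term\<close>

lemma D12_rad_dual_w_sq_loc_integrable:
  assumes "u \<in> D12_rad"
  shows "integrable lebesgue (\<lambda>x. indicator (cball 0 r) x * (dual_w (u x))\<^sup>2)"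
proof (rule integrable_lebesgue_bound)
  obtain U where U: "has_weak_gradient u U" using assms by (auto simp: D12_rad_def D12_def)
  then have i: "integrable lebesgue (\<lambda>x. indicator (cball 0 r) x *\<^sub>R u x)"
    by (simp add: has_weak_gradient_def set_integrable_def)
  show "integrable lebesgue (\<lambda>x. indicator (cball 0 r) x + 4 * \<bar>indicator (cball 0 r) x *\<^sub>R u x\<bar>)"
    by (intro Bochner_Integration.integrable_add integrable_indicator_cball integrable_mult_right integrable_abs i)
  have [measurable]: "u \<in> borel_measurable lebesgue" "cball (0::real^'a) r \<in> sets lebesgue"
    using has_weak_gradient_measurable[OF U] by (auto intro: fmeasurableD)
  show "(\<lambda>x. indicator (cball 0 r) x * (dual_w (u x))\<^sup>2) \<in> borel_measurable lebesgue" by measurable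
  show "norm (indicator (cball 0 r) x * (dual_w (u x))\<^sup>2) \<le> indicator (cball 0 r) x + 4 * \<bar>indicator (cball 0 r) x *\<^sub>R u x\<bar>" for x
    using dual_w_sq_le by (auto split: split_indicator)
qed

text \<open>Between the radii \<open>R1\<close> and \<open>R2\<close> neither of the two integrability conditions applies. A dilation
  moves this shell into the ball of radius \<open>R1\<close>, where \<open>K\<close> is bounded below on compact sets away from the
  origin; a cutoff that vanishes near the origin keeps the dilated function in the energy space.\<close>

lemma shell_integrable:
  fixes u :: "real ^ 'n \<Rightarrow> real"
  assumes N: "CARD('n) \<ge> 3" and V: "continuous_on {0<..} V" "\<And>r. r > 0 \<Longrightarrow> V r \<ge> 0"
    and K: "continuous_on {0<..} K" "\<And>r. r > 0 \<Longrightarrow> K r > 0" and R: "0 < R1" "R1 < R2" and q: "q > 0"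
    and fin: "\<And>v. v \<in> (E_space V :: (real ^ 'n \<Rightarrow> real) set) \<Longrightarrow>
      integrable lebesgue (\<lambda>x. indicator (ball 0 R1) x * (K (norm x) * \<bar>v x\<bar> powr q))"
    and u: "u \<in> D12_rad"
  shows "integrable lebesgue (\<lambda>x. indicator (ball 0 R2 - ball 0 R1) x * dual_w (u x) powr q)"
proof -
  \<comment> \<open>The map \<open>x \<mapsto> c x\<close> sends the shell with radii \<open>s\<close> and \<open>R1\<close> onto the one with radii \<open>R1\<close> and \<open>R2\<close>.\<close>
  define c where "c = R2 / R1"
  have c: "c > 0" using R by (simp add: c_def)
  define s where "s = R1 / c"
  have s: "0 < s" "s < R1" using R by (auto simp: s_def c_def divide_less_eq)
  define h :: "real^'n \<Rightarrow> real" where "h = shell_bump (s\<^sup>2 / 4) (4 * R1\<^sup>2)"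
  have h: "h \<in> Cc_inf_rad" unfolding h_def by (rule shell_bump_Cc_inf_rad)
  have hb: "\<bar>h x\<bar> \<le> 1" for x using shell_bump_bounds[of _ _ x] by (simp add: h_def)
  have hz: "h x = 0" if "norm x \<le> s / 2 \<or> norm x \<ge> 2 * R1" for x
  proof -
    have "(norm x)\<^sup>2 \<le> (s / 2)\<^sup>2 \<or> (2 * R1)\<^sup>2 \<le> (norm x)\<^sup>2"
      using that
    proof
      assume "norm x \<le> s / 2"
      then have "(norm x)\<^sup>2 \<le> (s / 2)\<^sup>2" by (intro power_mono) auto
      then show ?thesis ..
    next
      assume "norm x \<ge> 2 * R1"
      then have "(2 * R1)\<^sup>2 \<le> (norm x)\<^sup>2" using R(1) by (intro power_mono) auto
      then show ?thesis ..
    qed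
    then show ?thesis by (auto simp: h_def shell_bump_def flat_exp_def power_divide power_mult_distrib)
  qed
  have "s\<^sup>2 / 4 < s\<^sup>2" "R1\<^sup>2 < 4 * R1\<^sup>2" "0 \<le> s" using s R by auto
  then obtain m where m: "m > 0" "\<And>x::real^'n. s \<le> norm x \<Longrightarrow> norm x \<le> R1 \<Longrightarrow> m \<le> h x"
    unfolding h_def using shell_bump_lower[of "s\<^sup>2 / 4" s R1 "4 * R1\<^sup>2"] by blast
  define y where "y x = u (c *\<^sub>R x)" for x
  have y: "y \<in> D12_rad" unfolding y_def by (rule D12_rad_dilation[OF u c])
  then obtain Y where Y: "has_weak_gradient y Y" by (auto simp: D12_rad_def D12_def)
  obtain U where U: "has_weak_gradient u U" using u by (auto simp: D12_rad_def D12_def)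
  have um[measurable]: "u \<in> borel_measurable lebesgue" using has_weak_gradient_measurable[OF U] by simp
  have ym[measurable]: "y \<in> borel_measurable lebesgue" using has_weak_gradient_measurable[OF Y] by simp
  have [measurable]: "(\<lambda>x::real^'n. V (norm x)) \<in> borel_measurable lebesgue" "h \<in> borel_measurable lebesgue"
    using measurable_radial_weight[OF V(1)]
      continuous_imp_measurable_lebesgue[OF smooth_imp_continuous[OF Cc_inf_smooth[OF Cc_inf_rad_Cc_inf[OF h]]]] by auto
  have sets[measurable]: "ball (0::real^'n) r \<in> sets lebesgue" for r by (auto intro: fmeasurableD)
  define z where "z x = h x * dual_w (y x)" for x
  obtain BV where BV: "BV > 0" "\<And>r. s / 2 \<le> r \<Longrightarrow> r \<le> 2 * R1 \<Longrightarrow> \<bar>V r\<bar> \<le> BV"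
    using continuous_positive_half_line_bounded[OF V(1), of "s / 2" "2 * R1"] s(1) by auto
  have "z \<in> E_space V"
  proof -
    have "integrable lebesgue (\<lambda>x. V (norm x) * (dual_f (z x))\<^sup>2)"
    proof (rule integrable_lebesgue_bound)
      show "integrable lebesgue (\<lambda>x. BV * (indicator (cball 0 (2 * R1)) x * (dual_w (y x))\<^sup>2))"
        by (rule integrable_mult_right[OF D12_rad_dual_w_sq_loc_integrable[OF y]])
      show "(\<lambda>x. V (norm x) * (dual_f (z x))\<^sup>2) \<in> borel_measurable lebesgue" unfolding z_def by measurable
      fix x :: "real^'n"
      show "norm (V (norm x) * (dual_f (z x))\<^sup>2) \<le> BV * (indicator (cball 0 (2 * R1)) x * (dual_w (y x))\<^sup>2)"
      proof (cases "norm x \<le> s / 2 \<or> norm x \<ge> 2 * R1")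
        case True
        then show ?thesis using hz[of x] BV(1) by (simp add: z_def dual_f_0)
      next
        case False
        have "\<bar>z x\<bar> \<le> 1 * dual_w (y x)"
          unfolding z_def abs_mult using hb[of x] dual_w_pos[of "y x"] by (intro mult_mono) auto
        then have "\<bar>dual_f (z x)\<bar> \<le> dual_w (y x)" using abs_dual_f_le[of "z x"] by simp
        then have "\<bar>dual_f (z x)\<bar>\<^sup>2 \<le> (dual_w (y x))\<^sup>2" by (intro power_mono) auto
        then have "\<bar>V (norm x)\<bar> * (dual_f (z x))\<^sup>2 \<le> BV * (dual_w (y x))\<^sup>2"
          using BV False by (intro mult_mono) auto
        then show ?thesis using False BV(1) by (simp add: abs_mult)
      qed
    qed
    moreover have "z \<in> D12_rad" unfolding z_def by (rule D12_rad_test_times_dual_w(1)[OF N y Y h])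
    ultimately show ?thesis by (simp add: E_space_def)
  qed
  from fin[OF this] have zi: "integrable lebesgue (\<lambda>x. indicator (ball 0 R1) x * (K (norm x) * \<bar>z x\<bar> powr q))" .
  obtain k where k: "k > 0" "\<And>r. s \<le> r \<Longrightarrow> r \<le> R1 \<Longrightarrow> k \<le> K r"
  proof -
    have "continuous_on {s..R1} K" using s(1) by (intro continuous_on_subset[OF K(1)]) auto
    then obtain r0 where r0: "r0 \<in> {s..R1}" "\<forall>r\<in>{s..R1}. K r0 \<le> K r"
      using continuous_attains_inf[of "{s..R1}" K] s by auto
    show ?thesis by (rule that[of "K r0"]) (use r0 s(1) K(2) in auto)
  qed
  define P where "P = (\<lambda>x. indicator (ball 0 R2 - ball 0 R1) x * dual_w (u x) powr q)"
  have Pm: "P \<in> borel_measurable lebesgue" unfolding P_def by measurable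
  have "integrable lebesgue (\<lambda>x. P (0 + c *\<^sub>R x))"
  proof (rule integrable_lebesgue_bound)
    show "integrable lebesgue (\<lambda>x. 1 / (k * m powr q) * (indicator (ball 0 R1) x * (K (norm x) * \<bar>z x\<bar> powr q)))"
      by (rule integrable_mult_right[OF zi])
    show "(\<lambda>x. P (0 + c *\<^sub>R x)) \<in> borel_measurable lebesgue"
      by (rule measurable_lebesgue_affine) (use c Pm in auto)
    fix x :: "real^'n" assume x0: "x \<noteq> 0"
    show "norm (P (0 + c *\<^sub>R x)) \<le> 1 / (k * m powr q) * (indicator (ball 0 R1) x * (K (norm x) * \<bar>z x\<bar> powr q))"
    proof (cases "R1 \<le> norm (c *\<^sub>R x) \<and> norm (c *\<^sub>R x) < R2")
      case False
      then have "P (0 + c *\<^sub>R x) = 0" by (auto simp: P_def)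
      moreover have "K (norm x) > 0" using x0 by (intro K(2)) simp
      ultimately show ?thesis using k(1) by simp
    next
      case True
      have x: "s \<le> norm x" "norm x < R1"
        using True c R by (auto simp: s_def c_def field_simps)
      have "m * dual_w (y x) \<le> \<bar>z x\<bar>"
        unfolding z_def abs_mult using m(2)[of x] x dual_w_pos[of "y x"] m(1) by (intro mult_mono) auto
      then have "(m * dual_w (y x)) powr q \<le> \<bar>z x\<bar> powr q"
        using m(1) dual_w_pos[of "y x"] q by (intro powr_mono2) auto
      then have 1: "m powr q * dual_w (y x) powr q \<le> \<bar>z x\<bar> powr q"
        using m(1) dual_w_pos[of "y x"] by (simp add: powr_mult)
      have "k * (m powr q * dual_w (y x) powr q) \<le> K (norm x) * \<bar>z x\<bar> powr q"
        using k x 1 order_trans[OF less_imp_le[OF k(1)] k(2)[of "norm x"]] by (intro mult_mono) auto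
      then have "dual_w (y x) powr q \<le> 1 / (k * m powr q) * (K (norm x) * \<bar>z x\<bar> powr q)"
        using k(1) m(1) by (simp add: field_simps)
      moreover have "P (0 + c *\<^sub>R x) = dual_w (y x) powr q" using True by (simp add: P_def y_def)
      moreover have "indicator (ball 0 R1) x = (1::real)" using x by simp
      ultimately show ?thesis by simp
    qed
  qed
  then have "integrable lebesgue P" using integrable_lebesgue_affine[of c P 0] c Pm by simp
  then show ?thesis by (simp add: P_def)
qed

text \<open>On the ball and on the exterior domain \<open>y\<close> is bounded by two elements of the energy space, and on
  the shell by a multiple of the weight \<open>sqrt (1 + 2 f(u)\<^sup>2)\<close>.\<close>

lemma weighted_powers_integrable:
  fixes u h :: "real ^ 'n \<Rightarrow> real"
  assumes N: "CARD('n) \<ge> 3" and V: "continuous_on {0<..} V" "\<And>r. r > 0 \<Longrightarrow> V r \<ge> 0" "\<exists>C>0. \<forall>r\<in>{0<..<1}. V r \<le> C / r\<^sup>2"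
    and K: "continuous_on {0<..} K" "\<And>r. r > 0 \<Longrightarrow> K r > 0" and R: "R1 > 0" "R2 > 0" and q: "q1 > 1" "q2 > 1"
    and S0: "S_zero TYPE('n) V K q1 R1 < \<infinity>" and Sinf: "S_inf TYPE('n) V K q2 R2 < \<infinity>"
    and u: "u \<in> E_space V" and h: "h \<in> Cc_inf_rad"
  defines "y \<equiv> \<lambda>x. \<bar>dual_f (u x)\<bar> + \<bar>h x * dual_w (u x)\<bar>"
  shows "integrable lebesgue (\<lambda>x. K (norm x) * min (y x powr q1) (y x powr q2))"
proof -
  have uD: "u \<in> D12_rad" using u by (simp add: E_space_def)
  then obtain U where U: "has_weak_gradient u U" by (auto simp: D12_rad_def D12_def)
  have hc: "h \<in> Cc_inf" using h by (auto simp: Cc_inf_rad_def)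
  define v where "v = (\<lambda>x. h x * dual_w (u x))"
  have v: "v \<in> E_space V" unfolding v_def by (rule E_space_test_times_dual_w(1)[OF N V u h])
  have sets[measurable]: "ball (0::real^'n) r \<in> sets lebesgue" "- ball (0::real^'n) r \<in> sets lebesgue" for r
    by (auto intro: fmeasurableD)
  have [measurable]: "u \<in> borel_measurable lebesgue" "(\<lambda>x::real^'n. K (norm x)) \<in> borel_measurable lebesgue" "h \<in> borel_measurable lebesgue"
    using has_weak_gradient_measurable[OF U] measurable_radial_weight[OF K(1)]
      continuous_imp_measurable_lebesgue[OF smooth_imp_continuous[OF Cc_inf_smooth[OF hc]]] by auto
  have i1: "integrable lebesgue (\<lambda>x. indicator (ball 0 R1) x * (K (norm x) * \<bar>e x\<bar> powr q1))" if "e \<in> E_space V" for e :: "real^'n \<Rightarrow> real"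
    by (rule S_finite_imp_integrable[OF N V(1,2) K sets(1) S0[unfolded S_zero_def] that])
  have i2: "integrable lebesgue (\<lambda>x. indicator (- ball 0 R2) x * (K (norm x) * \<bar>e x\<bar> powr q2))" if "e \<in> E_space V" for e :: "real^'n \<Rightarrow> real"
    by (rule S_finite_imp_integrable[OF N V(1,2) K sets(2) Sinf[unfolded S_inf_def] that])
  obtain r B where "test_bound h r B" using Cc_inf_test_bound[OF hc] by blast
  note B = test_boundD(2,3)[OF this]
  have yle: "y x \<le> (1 + B) * dual_w (u x)" for x
  proof -
    have "\<bar>h x * dual_w (u x)\<bar> \<le> B * dual_w (u x)"
      unfolding abs_mult using B dual_w_pos[of "u x"] by (intro mult_mono) auto
    then show ?thesis using abs_dual_f_le_dual_w[of "u x"] by (simp add: y_def distrib_right)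
  qed
  have y0: "y x \<ge> 0" for x by (simp add: y_def)
  have i3: "integrable lebesgue (\<lambda>x. indicator (ball 0 R2 - ball 0 R1) x * dual_w (u x) powr q1)"
  proof (cases "R1 < R2")
    case True
    show ?thesis by (rule shell_integrable[OF N V(1,2) K R(1) True _ i1 uD]) (use q in auto)
  next
    case False
    then have e: "ball 0 R2 - ball 0 R1 = ({} :: (real^'n) set)" by auto
    show ?thesis unfolding e by simp
  qed
  obtain BK where BK: "BK > 0" "\<And>r. R1 \<le> r \<Longrightarrow> r \<le> R2 \<Longrightarrow> \<bar>K r\<bar> \<le> BK"
    using continuous_positive_half_line_bounded[OF K(1) R(1), of R2] by blast
  have ypow: "y x powr q \<le> 2 powr q * (\<bar>u x\<bar> powr q + \<bar>v x\<bar> powr q)" if "q > 1" for x q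
  proof -
    have "y x \<le> \<bar>\<bar>u x\<bar> + \<bar>v x\<bar>\<bar>" using abs_dual_f_le[of "u x"] by (simp add: y_def v_def)
    then have "y x powr q \<le> \<bar>\<bar>u x\<bar> + \<bar>v x\<bar>\<bar> powr q" using y0 that by (intro powr_mono2) auto
    also have "\<dots> \<le> 2 powr q * (\<bar>\<bar>u x\<bar>\<bar> powr q + \<bar>\<bar>v x\<bar>\<bar> powr q)" by (rule powr_abs_add_le) (use that in simp)
    finally show ?thesis by simp
  qed
  let ?D = "\<lambda>x. 2 powr q1 * (indicator (ball 0 R1) x * (K (norm x) * \<bar>u x\<bar> powr q1) + indicator (ball 0 R1) x * (K (norm x) * \<bar>v x\<bar> powr q1))
    + 2 powr q2 * (indicator (- ball 0 R2) x * (K (norm x) * \<bar>u x\<bar> powr q2) + indicator (- ball 0 R2) x * (K (norm x) * \<bar>v x\<bar> powr q2))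
    + BK * (1 + B) powr q1 * (indicator (ball 0 R2 - ball 0 R1) x * dual_w (u x) powr q1)"
  show ?thesis
  proof (rule integrable_lebesgue_bound)
    show "integrable lebesgue ?D"
      by (intro Bochner_Integration.integrable_add integrable_mult_right i1 i2 i3 u v)
    show "(\<lambda>x. K (norm x) * min (y x powr q1) (y x powr q2)) \<in> borel_measurable lebesgue"
      unfolding y_def by measurable
    fix x :: "real^'n" assume "x \<noteq> 0"
    then have K0: "K (norm x) > 0" by (intro K(2)) simp
    define a1 where "a1 = 2 powr q1 * (indicator (ball 0 R1) x * (K (norm x) * \<bar>u x\<bar> powr q1) + indicator (ball 0 R1) x * (K (norm x) * \<bar>v x\<bar> powr q1))"
    define a2 where "a2 = 2 powr q2 * (indicator (- ball 0 R2) x * (K (norm x) * \<bar>u x\<bar> powr q2) + indicator (- ball 0 R2) x * (K (norm x) * \<bar>v x\<bar> powr q2))"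
    define a3 where "a3 = BK * (1 + B) powr q1 * (indicator (ball 0 R2 - ball 0 R1) x * dual_w (u x) powr q1)"
    have nn: "a1 \<ge> 0" "a2 \<ge> 0" "a3 \<ge> 0"
      using K0 BK(1) by (auto simp: a1_def a2_def a3_def intro!: mult_nonneg_nonneg add_nonneg_nonneg)
    have "K (norm x) * min (y x powr q1) (y x powr q2) \<le> a1 + a2 + a3"
    proof -
      consider "norm x < R1" | "norm x \<ge> R2" | "R1 \<le> norm x" "norm x < R2" by linarith
      then show ?thesis
      proof cases
        case 1
        have "K (norm x) * min (y x powr q1) (y x powr q2) \<le> K (norm x) * (2 powr q1 * (\<bar>u x\<bar> powr q1 + \<bar>v x\<bar> powr q1))"
          using K0 ypow[OF q(1), of x] by (intro mult_left_mono) auto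
        also have "\<dots> = a1" using 1 by (simp add: a1_def algebra_simps)
        finally show ?thesis using nn by linarith
      next
        case 2
        have "K (norm x) * min (y x powr q1) (y x powr q2) \<le> K (norm x) * (2 powr q2 * (\<bar>u x\<bar> powr q2 + \<bar>v x\<bar> powr q2))"
          using K0 ypow[OF q(2), of x] by (intro mult_left_mono) auto
        also have "\<dots> = a2" using 2 by (simp add: a2_def algebra_simps)
        finally show ?thesis using nn by linarith
      next
        case 3
        have "y x powr q1 \<le> ((1 + B) * dual_w (u x)) powr q1" using yle[of x] y0[of x] q by (intro powr_mono2) auto
        also have "\<dots> = (1 + B) powr q1 * dual_w (u x) powr q1" using B(1) dual_w_pos[of "u x"] by (simp add: powr_mult)
        finally have "K (norm x) * min (y x powr q1) (y x powr q2) \<le> BK * ((1 + B) powr q1 * dual_w (u x) powr q1)"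
          using K0 BK(1) BK(2)[of "norm x"] 3 by (intro mult_mono) auto
        also have "\<dots> = a3" using 3 by (simp add: a3_def)
        finally show ?thesis using nn by linarith
      qed
    qed
    moreover have "K (norm x) * min (y x powr q1) (y x powr q2) \<ge> 0" using K0 by simp
    ultimately show "norm (K (norm x) * min (y x powr q1) (y x powr q2)) \<le> ?D x"
      unfolding a1_def[symmetric] a2_def[symmetric] a3_def[symmetric] real_norm_def by linarith
  qed
qed

section \<open>The derivative of the functional\<close>

lemma integral_primitive_DERIV:
  fixes g G :: "real \<Rightarrow> real"
  assumes g: "continuous_on UNIV g" and G: "\<And>t. G t = (LBINT s=0..t. g s)"
  shows "(G has_real_derivative g t) (at t)"
proof -
  define a b where "a = - \<bar>t\<bar> - 1" and "b = \<bar>t\<bar> + 1"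
  have ab: "a < 0" "0 < b" "a < t" "t < b" "a \<le> 0" "0 \<le> b" by (auto simp: a_def b_def)
  have c: "continuous_on {a..b} g" by (rule continuous_on_subset[OF g]) auto
  have "((\<lambda>u. LBINT y=0..u. g y) has_vector_derivative g t) (at t within {a..b})"
    using interval_integral_FTC2[of a 0 b g t] c ab by (simp add: zero_ereal_def)
  moreover have "at t within {a..b} = at t" using ab by (intro at_within_interior) auto
  moreover have "G = (\<lambda>u. LBINT y=0..u. g y)" using G by (auto simp: fun_eq_iff)
  ultimately show ?thesis by (simp add: has_real_derivative_iff_has_vector_derivative)
qed

text \<open>Dominated convergence for difference quotients. The parameters are positive, because the norm of the
  energy space is handled through its homogeneity under positive factors.\<close>

lemma dominated_difference_quotients:
  fixes \<Phi> :: "real \<Rightarrow> 'a \<Rightarrow> real"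
  assumes t: "\<And>n. 0 < t n" "\<And>n. t n \<le> 1" "t \<longlonglongrightarrow> 0"
    and i: "\<And>s. 0 \<le> s \<Longrightarrow> s \<le> 1 \<Longrightarrow> integrable M (\<Phi> s)"
    and d: "AE x in M. ((\<lambda>s. \<Phi> s x) has_real_derivative \<Phi>' x) (at 0)"
    and b: "AE x in M. \<forall>s. 0 \<le> s \<longrightarrow> s \<le> 1 \<longrightarrow> \<bar>\<Phi> s x - \<Phi> 0 x\<bar> \<le> s * w x"
    and w: "integrable M w" and m: "\<Phi>' \<in> borel_measurable M"
  shows "integrable M \<Phi>'"
    and "(\<lambda>n. ((LINT x|M. \<Phi> (t n) x) - (LINT x|M. \<Phi> 0 x)) / t n) \<longlonglongrightarrow> (LINT x|M. \<Phi>' x)"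
proof -
  have i0: "integrable M (\<Phi> 0)" and it: "integrable M (\<Phi> (t n))" for n
    by (intro i order_refl zero_le_one less_imp_le[OF t(1)] t(2))+
  let ?s = "\<lambda>n x. (\<Phi> (t n) x - \<Phi> 0 x) / t n"
  have sm: "?s n \<in> borel_measurable M" for n using it i0 by (intro borel_measurable_divide borel_measurable_diff) auto
  have lim: "AE x in M. (\<lambda>n. ?s n x) \<longlonglongrightarrow> \<Phi>' x"
    using d
  proof eventually_elim
    fix x assume "((\<lambda>s. \<Phi> s x) has_real_derivative \<Phi>' x) (at 0)"
    then have "((\<lambda>s. (\<Phi> s x - \<Phi> 0 x) / s) \<longlongrightarrow> \<Phi>' x) (at 0)" by (simp add: has_field_derivative_iff)
    moreover have "filterlim t (at 0) sequentially"
      using t(1,3) by (auto simp: filterlim_at intro!: always_eventually less_imp_neq[symmetric])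
    ultimately show "(\<lambda>n. ?s n x) \<longlonglongrightarrow> \<Phi>' x" by (rule filterlim_compose)
  qed
  have bd: "AE x in M. norm (?s n x) \<le> w x" for n
    using b
  proof eventually_elim
    fix x assume "\<forall>s. 0 \<le> s \<longrightarrow> s \<le> 1 \<longrightarrow> \<bar>\<Phi> s x - \<Phi> 0 x\<bar> \<le> s * w x"
    then have "\<bar>\<Phi> (t n) x - \<Phi> 0 x\<bar> \<le> t n * w x" using t(1,2) less_imp_le by blast
    then show "norm (?s n x) \<le> w x" using t(1)[of n] by (simp add: abs_divide divide_le_eq mult.commute)
  qed
  show "integrable M \<Phi>'" by (rule integrable_dominated_convergence[OF m sm w lim bd])
  have "(\<lambda>n. LINT x|M. ?s n x) \<longlonglongrightarrow> (LINT x|M. \<Phi>' x)"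
    by (rule integral_dominated_convergence[OF m sm w lim bd])
  moreover have "(LINT x|M. ?s n x) = ((LINT x|M. \<Phi> (t n) x) - (LINT x|M. \<Phi> 0 x)) / t n" for n
    unfolding integral_divide_zero Bochner_Integration.integral_diff[OF it i0] ..
  ultimately show "(\<lambda>n. ((LINT x|M. \<Phi> (t n) x) - (LINT x|M. \<Phi> 0 x)) / t n) \<longlonglongrightarrow> (LINT x|M. \<Phi>' x)"
    by (simp only:)
qed

text \<open>The norm is positively homogeneous along the ray, so Frechet differentiability with vanishing
  differential bounds the difference quotients by an arbitrarily small multiple of \<open>norm_E V v\<close>.\<close>

lemma critical_point_derivative_zero:
  fixes u v :: "real ^ 'n \<Rightarrow> real"
  assumes crit: "critical_point (E_space V) (norm_E V) J u"
    and V: "continuous_on {0<..} V" "\<And>r. r > 0 \<Longrightarrow> V r \<ge> 0" and v: "v \<in> E_space V"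
    and t: "\<And>n. 0 < t n" "t \<longlonglongrightarrow> 0"
    and lim: "(\<lambda>n. (J (\<lambda>x. u x + t n * v x) - J u) / t n) \<longlonglongrightarrow> L"
  shows "L = 0"
proof -
  define c where "c = norm_E V v"
  have c0: "c \<ge> 0" using norm_o_bounds(1)[OF V(2), where u=v] by (simp add: c_def norm_E_def norm12_def)
  have "\<bar>L\<bar> \<le> 0 + e" if e: "e > 0" for e
  proof -
    define e' where "e' = e / (c + 1)"
    have e': "e' > 0" using e c0 by (simp add: e'_def)
    obtain d where d: "d > 0" "\<And>v'. v' \<in> E_space V \<Longrightarrow> norm_E V v' < d \<Longrightarrow> \<bar>J (\<lambda>x. u x + v' x) - J u\<bar> \<le> e' * norm_E V v'"
      using crit e' unfolding critical_point_def has_frechet_differential_def by auto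
    have "(\<lambda>n. t n * c) \<longlonglongrightarrow> 0 * c" by (intro tendsto_intros t)
    then have "\<forall>\<^sub>F n in sequentially. t n * c < d" using d(1) by (intro order_tendstoD(2)) auto
    then have "\<forall>\<^sub>F n in sequentially. norm ((J (\<lambda>x. u x + t n * v x) - J u) / t n) \<le> e' * c"
    proof eventually_elim
      fix n assume n: "t n * c < d"
      have E: "(\<lambda>x. t n * v x) \<in> E_space V" by (rule E_space_cmult[OF V v t(1)])
      have nE: "norm_E V (\<lambda>x. t n * v x) = t n * c" unfolding c_def by (rule norm_E_cmult[OF V(2) t(1) v])
      have "\<bar>J (\<lambda>x. u x + t n * v x) - J u\<bar> \<le> e' * (t n * c)" using d(2)[OF E] n by (simp add: nE)
      then show "norm ((J (\<lambda>x. u x + t n * v x) - J u) / t n) \<le> e' * c"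
        using t(1)[of n] by (simp add: abs_divide divide_le_eq mult_ac)
    qed
    then have "norm L \<le> e' * c"
      by (rule tendsto_upperbound[OF tendsto_norm[OF lim]]) simp
    also have "\<dots> \<le> e" using c0 e by (simp add: e'_def divide_le_eq mult_left_mono)
    finally show ?thesis by simp
  qed
  then have "\<bar>L\<bar> \<le> 0" by (rule field_le_epsilon)
  then show ?thesis by simp
qed

section \<open>The equation in the original variable\<close>

lemma abs_inner_le_sq: "\<bar>a \<bullet> b\<bar> \<le> (norm a)\<^sup>2 + (norm (b::'a::real_inner))\<^sup>2"
proof -
  have "\<bar>a \<bullet> b\<bar> \<le> norm a * norm b" by (rule Cauchy_Schwarz_ineq2)
  moreover have "2 * norm a * norm b \<le> (norm a)\<^sup>2 + (norm b)\<^sup>2" by (rule sum_squares_bound)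
  moreover have "0 \<le> norm a * norm b" by simp
  ultimately show ?thesis by linarith
qed

theorem theorem6p4:
  fixes V K g G :: "real \<Rightarrow> real"
    and q1 q2 R1 R2 :: real
    and u w :: "real ^ 'n \<Rightarrow> real"
  assumes N: "CARD('n) \<ge> 3"
    and V_cont: "continuous_on {0<..} V" and V_nonneg: "\<And>r. r > 0 \<Longrightarrow> V r \<ge> 0"
    and K_cont: "continuous_on {0<..} K" and K_pos: "\<And>r. r > 0 \<Longrightarrow> K r > 0"
    and V_bound: "\<exists>C>0. \<forall>r\<in>{0<..<1}. V r \<le> C / r\<^sup>2"
    and q: "q1 > 1" "q2 > 1"
    and R: "R1 > 0" "R2 > 0"
    and S0: "S_zero TYPE('n) V K q1 R1 < \<infinity>"
    and Sinf: "S_inf TYPE('n) V K q2 R2 < \<infinity>"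
    and g_cont: "continuous_on UNIV g"
    and G_def: "\<And>t. G t = (LBINT s=0..t. g s)"
    and hyp_i: "\<exists>\<theta>>2. \<forall>t. 0 \<le> 2 * \<theta> * G t \<and> 2 * \<theta> * G t \<le> g t * t"
    and hyp_ii: "\<exists>t0>0. G t0 > 0"
    and hyp_iii: "\<exists>C>0. \<forall>t. \<bar>g t\<bar> \<le> C * min (\<bar>t\<bar> powr (q1 - 1)) (\<bar>t\<bar> powr (q2 - 1))"
    and crit: "critical_point (E_space V) (norm_E V) (functional_I V K G) u"
    and w_def: "w = (\<lambda>x. dual_f (u x))"
  shows "w \<in> X_space V \<and>
    (\<forall>h\<in>Cc_inf_rad.
      integrable lebesgue (\<lambda>x. (1 + 2 * (w x)\<^sup>2) * (wgrad w x \<bullet> grad h x)) \<and>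
      integrable lebesgue (\<lambda>x. 2 * w x * (norm (wgrad w x))\<^sup>2 * h x) \<and>
      integrable lebesgue (\<lambda>x. V (norm x) * w x * h x) \<and>
      integrable lebesgue (\<lambda>x. K (norm x) * g (w x) * h x) \<and>
      (LINT x|lebesgue. (1 + 2 * (w x)\<^sup>2) * (wgrad w x \<bullet> grad h x))
      + (LINT x|lebesgue. 2 * w x * (norm (wgrad w x))\<^sup>2 * h x)
      + (LINT x|lebesgue. V (norm x) * w x * h x)
      = (LINT x|lebesgue. K (norm x) * g (w x) * h x))"
proof (intro conjI ballI)
  have uE: "u \<in> E_space V" using crit by (simp add: critical_point_def)
  then have uD: "u \<in> D12_rad" and uV: "integrable lebesgue (\<lambda>x. V (norm x) * (dual_f (u x))\<^sup>2)"
    by (auto simp: E_space_def)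
  obtain U where U: "has_weak_gradient u U" using uD by (auto simp: D12_rad_def D12_def)
  note Dw = D12_rad_dual_f[OF N uD U]
  show "w \<in> X_space V" using Dw(1) uV by (simp add: X_space_def w_def)
  have ww: "AE x in lebesgue. wgrad w x = (1 / dual_w (u x)) *\<^sub>R U x"
    unfolding w_def by (rule wgrad_AE_eq(2)[OF Dw(2)])
  have wwm[measurable]: "wgrad w \<in> borel_measurable lebesgue"
    unfolding w_def using has_weak_gradient_measurable[OF wgrad_AE_eq(1)[OF Dw(2)]] by simp
  have um[measurable]: "u \<in> borel_measurable lebesgue" "U \<in> borel_measurable lebesgue"
    using has_weak_gradient_measurable[OF U] by auto
  have gm[measurable]: "g \<in> borel_measurable borel" by (rule borel_measurable_continuous_onI[OF g_cont])
  have VKm[measurable]: "(\<lambda>x::real^'n. V (norm x)) \<in> borel_measurable lebesgue" "(\<lambda>x::real^'n. K (norm x)) \<in> borel_measurable lebesgue"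
    using measurable_radial_weight V_cont K_cont by blast+
  note G_DERIV = integral_primitive_DERIV[OF g_cont G_def]
  have Gm[measurable]: "G \<in> borel_measurable borel"
    by (intro borel_measurable_continuous_onI continuous_at_imp_continuous_on ballI DERIV_isCont[OF G_DERIV])
  obtain C where C: "C > 0" "\<And>t. \<bar>g t\<bar> \<le> C * min (\<bar>t\<bar> powr (q1 - 1)) (\<bar>t\<bar> powr (q2 - 1))" using hyp_iii by blast
  obtain \<theta> where \<theta>: "\<theta> > 2" "\<And>t. 0 \<le> 2 * \<theta> * G t" "\<And>t. 2 * \<theta> * G t \<le> g t * t" using hyp_i by blast
  \<comment> \<open>The factor \<open>y\<close> raises both exponents by one.\<close>
  have g_le: "\<bar>g t\<bar> * y \<le> C * min (y powr q1) (y powr q2)" if "\<bar>t\<bar> \<le> y" for t y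
  proof -
    have y0: "y \<ge> 0" using that by linarith
    have p: "y powr (q - 1) * y = y powr q" if "q > 1" for q
    proof (cases "y = 0")
      case False
      then have "y powr (q - 1) * y powr 1 = y powr q" using y0 by (simp only: powr_add[symmetric]) simp
      then show ?thesis using y0 False by simp
    qed simp
    have "\<bar>g t\<bar> \<le> C * min (y powr (q1 - 1)) (y powr (q2 - 1))"
    proof (rule order_trans[OF C(2)])
      show "C * min (\<bar>t\<bar> powr (q1 - 1)) (\<bar>t\<bar> powr (q2 - 1)) \<le> C * min (y powr (q1 - 1)) (y powr (q2 - 1))"
        using C(1) that q by (intro mult_left_mono min.mono powr_mono2) auto
    qed
    then have "\<bar>g t\<bar> * y \<le> C * min (y powr (q1 - 1)) (y powr (q2 - 1)) * y" using y0 by (rule mult_right_mono)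
    also have "\<dots> = C * min (y powr (q1 - 1) * y) (y powr (q2 - 1) * y)"
      using y0 by (simp add: min_mult_distrib_right mult.assoc)
    finally show ?thesis by (simp add: p q)
  qed
  have G_le: "\<bar>G t\<bar> \<le> C * min (y powr q1) (y powr q2)" if "\<bar>t\<bar> \<le> y" for t y
  proof -
    have G0: "G t \<ge> 0" using \<theta>(1) \<theta>(2)[of t] by (simp add: zero_le_mult_iff)
    have "1 * G t \<le> 2 * \<theta> * G t" using \<theta>(1) G0 by (intro mult_right_mono) auto
    also have "\<dots> \<le> \<bar>g t\<bar> * \<bar>t\<bar>" using \<theta>(3)[of t] by (simp add: abs_mult[symmetric])
    also have "\<dots> \<le> \<bar>g t\<bar> * y" using that by (intro mult_left_mono) auto
    also have "\<dots> \<le> C * min (y powr q1) (y powr q2)" by (rule g_le[OF that])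
    finally show ?thesis using G0 by simp
  qed

  fix h :: "real^'n \<Rightarrow> real" assume h: "h \<in> Cc_inf_rad"
  have hc: "h \<in> Cc_inf" using h by (simp add: Cc_inf_rad_def)
  have hsm: "smooth h" using hc by (rule Cc_inf_smooth)
  have hm[measurable]: "h \<in> borel_measurable lebesgue" "grad h \<in> borel_measurable lebesgue"
    using hsm by (auto intro!: continuous_imp_measurable_lebesgue smooth_imp_continuous continuous_grad)
  obtain r B where "test_bound h r B" using Cc_inf_test_bound[OF hc] by blast
  note rB = test_boundD[OF this]
  define v where "v = (\<lambda>x. h x * dual_w (u x))"
  define W where "W = (\<lambda>x. dual_w (u x) *\<^sub>R grad h x + (h x * (2 * dual_f (u x) * (1 / dual_w (u x))\<^sup>2)) *\<^sub>R U x)"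
  have Tv: "v \<in> D12_rad" "has_weak_gradient v W" "integrable lebesgue (\<lambda>x. (norm (W x))\<^sup>2)"
    "integrable lebesgue (\<lambda>x. (norm (U x))\<^sup>2)"
    unfolding v_def W_def by (rule D12_rad_test_times_dual_w[OF N uD U h])+
  have Ev: "v \<in> E_space V" "integrable lebesgue (\<lambda>x. V (norm x) * (v x)\<^sup>2)"
    "integrable lebesgue (\<lambda>x. V (norm x) * \<bar>v x\<bar>)"
    unfolding v_def by (rule E_space_test_times_dual_w[OF N V_cont V_nonneg V_bound uE h]; assumption)+
  have vm[measurable]: "v \<in> borel_measurable lebesgue" "W \<in> borel_measurable lebesgue"
    using has_weak_gradient_measurable[OF Tv(2)] by auto
  have fv: "1 / dual_w (u x) * v x = h x" for x using dual_w_pos[of "u x"] by (simp add: v_def)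
  \<comment> \<open>The two parts of \<open>\<nabla>u \<bullet> \<nabla>v\<close>. The second one is integrable as the difference of the whole and the first.\<close>
  define A1 where "A1 x = dual_w (u x) * (U x \<bullet> grad h x)" for x
  define A2 where "A2 x = h x * (2 * dual_f (u x) * (1 / dual_w (u x))\<^sup>2) * (norm (U x))\<^sup>2" for x
  have UW: "U x \<bullet> W x = A1 x + A2 x" for x
    by (simp add: W_def A1_def A2_def inner_add_right power2_norm_eq_inner)
  have UWi: "integrable lebesgue (\<lambda>x. U x \<bullet> W x)"
    by (rule integrable_lebesgue_bound[OF Bochner_Integration.integrable_add[OF Tv(4,3)]])
       (use abs_inner_le_sq in auto)
  have A1m: "A1 \<in> borel_measurable lebesgue" unfolding A1_def by measurable
  have A1i: "integrable lebesgue A1"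
  proof (rule integrable_lebesgue_bound[OF _ A1m])
    show "integrable lebesgue (\<lambda>x. (norm (U x))\<^sup>2 + B\<^sup>2 * (indicator (cball 0 r) x * (dual_w (u x))\<^sup>2))"
      by (intro Bochner_Integration.integrable_add integrable_mult_right Tv(4) D12_rad_dual_w_sq_loc_integrable uD)
    fix x
    have "\<bar>A1 x\<bar> = \<bar>U x \<bullet> (dual_w (u x) *\<^sub>R grad h x)\<bar>" by (simp add: A1_def)
    also have "\<dots> \<le> (norm (U x))\<^sup>2 + (norm (dual_w (u x) *\<^sub>R grad h x))\<^sup>2" by (rule abs_inner_le_sq)
    also have "(norm (dual_w (u x) *\<^sub>R grad h x))\<^sup>2 \<le> B\<^sup>2 * (indicator (cball 0 r) x * (dual_w (u x))\<^sup>2)"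
    proof (cases "norm x \<le> r")
      case True
      have "(norm (grad h x))\<^sup>2 \<le> B\<^sup>2" using rB(4) by (intro power_mono) auto
      then have "(dual_w (u x))\<^sup>2 * (norm (grad h x))\<^sup>2 \<le> (dual_w (u x))\<^sup>2 * B\<^sup>2" by (intro mult_left_mono) auto
      then show ?thesis using True by (simp add: power_mult_distrib mult.commute)
    next
      case False
      then show ?thesis using rB(6)[of x] by simp
    qed
    finally show "norm (A1 x) \<le> (norm (U x))\<^sup>2 + B\<^sup>2 * (indicator (cball 0 r) x * (dual_w (u x))\<^sup>2)" by simp
  qed
  have A2i: "integrable lebesgue A2"
  proof -
    have "A2 = (\<lambda>x. U x \<bullet> W x - A1 x)" by (simp add: UW fun_eq_iff)
    then show ?thesis using Bochner_Integration.integrable_diff[OF UWi A1i] by simp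
  qed
  have I12: "(LINT x|lebesgue. U x \<bullet> W x) = (LINT x|lebesgue. A1 x) + (LINT x|lebesgue. A2 x)"
    unfolding UW by (rule Bochner_Integration.integral_add[OF A1i A2i])
  have e1: "AE x in lebesgue. A1 x = (1 + 2 * (w x)\<^sup>2) * (wgrad w x \<bullet> grad h x)"
    using ww
  proof eventually_elim
    fix x assume "wgrad w x = (1 / dual_w (u x)) *\<^sub>R U x"
    then show "A1 x = (1 + 2 * (w x)\<^sup>2) * (wgrad w x \<bullet> grad h x)"
      using dual_w_pos[of "u x"] unfolding w_def dual_w_sq[symmetric] A1_def by (simp add: power2_eq_square)
  qed
  have e2: "AE x in lebesgue. A2 x = 2 * w x * (norm (wgrad w x))\<^sup>2 * h x"
    using ww
  proof eventually_elim
    fix x assume "wgrad w x = (1 / dual_w (u x)) *\<^sub>R U x"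
    then show "A2 x = 2 * w x * (norm (wgrad w x))\<^sup>2 * h x"
      unfolding w_def A2_def by (simp add: power_mult_distrib power_divide)
  qed
  have m1: "(\<lambda>x. (1 + 2 * (w x)\<^sup>2) * (wgrad w x \<bullet> grad h x)) \<in> borel_measurable lebesgue"
    and m2: "(\<lambda>x. 2 * w x * (norm (wgrad w x))\<^sup>2 * h x) \<in> borel_measurable lebesgue"
  proof -
    have [measurable]: "w \<in> borel_measurable lebesgue" unfolding w_def by measurable
    show "(\<lambda>x. (1 + 2 * (w x)\<^sup>2) * (wgrad w x \<bullet> grad h x)) \<in> borel_measurable lebesgue" by measurable
    show "(\<lambda>x. 2 * w x * (norm (wgrad w x))\<^sup>2 * h x) \<in> borel_measurable lebesgue" by measurable
  qed
  show r1: "integrable lebesgue (\<lambda>x. (1 + 2 * (w x)\<^sup>2) * (wgrad w x \<bullet> grad h x))"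
    by (rule integrable_cong_AE_imp[OF A1i m1]) (use e1 in eventually_elim, simp)
  show r2: "integrable lebesgue (\<lambda>x. 2 * w x * (norm (wgrad w x))\<^sup>2 * h x)"
    by (rule integrable_cong_AE_imp[OF A2i m2]) (use e2 in eventually_elim, simp)
  have J1: "(LINT x|lebesgue. A1 x) = (LINT x|lebesgue. (1 + 2 * (w x)\<^sup>2) * (wgrad w x \<bullet> grad h x))"
    by (rule integral_cong_AE[OF A1m m1 e1])
  have J2: "(LINT x|lebesgue. A2 x) = (LINT x|lebesgue. 2 * w x * (norm (wgrad w x))\<^sup>2 * h x)"
    by (rule integral_cong_AE[OF borel_measurable_integrable[OF A2i] m2 e2])

  define t where "t n = 1 / real (Suc n)" for n
  have t: "0 < t n" "t n \<le> 1" "t \<longlonglongrightarrow> 0" for n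
  proof -
    show "t \<longlonglongrightarrow> 0" unfolding t_def by real_asymp
  qed (auto simp: t_def)
  have ray: "((\<lambda>s. u x + s * v x) has_real_derivative v x) (at s)" for x s
    by (auto intro!: derivative_eq_intros)
  have f_ray: "((\<lambda>s. dual_f (u x + s * v x)) has_real_derivative 1 / dual_w (u x + s * v x) * v x) (at s)" for x s
    by (rule DERIV_chain2[where f=dual_f, OF dual_f_DERIV' ray])

  \<comment> \<open>The potential term along the ray, and its derivative at the starting point.\<close>
  define P where "P s x = V (norm x) * (dual_f (u x + s * v x))\<^sup>2" for s x
  define P' where "P' x = 2 * (V (norm x) * w x * h x)" for x
  have Pi: "integrable lebesgue (P s)" for s
  proof (rule integrable_lebesgue_bound)
    show "integrable lebesgue (\<lambda>x. 2 * (V (norm x) * (dual_f (u x))\<^sup>2) + 2 * s\<^sup>2 * (V (norm x) * (v x)\<^sup>2))"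
      by (intro Bochner_Integration.integrable_add integrable_mult_right uV Ev(2))
    show "P s \<in> borel_measurable lebesgue" unfolding P_def by measurable
    fix x :: "real^'n" assume "x \<noteq> 0"
    then have V0: "V (norm x) \<ge> 0" by (intro V_nonneg) simp
    have "\<bar>dual_f (u x + s * v x)\<bar> \<le> \<bar>\<bar>dual_f (u x)\<bar> + \<bar>s * v x\<bar>\<bar>"
      using dual_f_Lipschitz[of "u x + s * v x" "u x"] by linarith
    then have "\<bar>dual_f (u x + s * v x)\<bar>\<^sup>2 \<le> \<bar>\<bar>dual_f (u x)\<bar> + \<bar>s * v x\<bar>\<bar>\<^sup>2" by (intro power_mono) auto
    also have "\<dots> \<le> 2 * (dual_f (u x))\<^sup>2 + 2 * (s * v x)\<^sup>2"
      using norm_add_sq_le[of "\<bar>dual_f (u x)\<bar>" "\<bar>s * v x\<bar>"] by simp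
    finally have "V (norm x) * (dual_f (u x + s * v x))\<^sup>2 \<le> V (norm x) * (2 * (dual_f (u x))\<^sup>2 + 2 * (s * v x)\<^sup>2)"
      using V0 by (intro mult_left_mono) auto
    also have "\<dots> = 2 * (V (norm x) * (dual_f (u x))\<^sup>2) + 2 * s\<^sup>2 * (V (norm x) * (v x)\<^sup>2)"
      by (simp add: algebra_simps power_mult_distrib)
    finally show "norm (P s x) \<le> 2 * (V (norm x) * (dual_f (u x))\<^sup>2) + 2 * s\<^sup>2 * (V (norm x) * (v x)\<^sup>2)"
      using V0 by (simp add: P_def)
  qed
  have Pd: "((\<lambda>s. P s x) has_real_derivative P' x) (at 0)" for x
  proof -
    have "((\<lambda>s. P s x) has_real_derivative V (norm x) * (of_nat 2 * (1 / dual_w (u x + 0 * v x) * v x * dual_f (u x + 0 * v x) ^ (2 - Suc 0)))) (at 0)"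
      unfolding P_def by (rule DERIV_cmult[OF DERIV_power[OF f_ray]])
    then show ?thesis by (rule DERIV_cong) (simp add: P'_def w_def v_def dual_w_pos[THEN less_imp_neq, symmetric])
  qed
  have Pb: "AE x in lebesgue. \<forall>s. 0 \<le> s \<longrightarrow> s \<le> 1 \<longrightarrow> \<bar>P s x - P 0 x\<bar> \<le> s * (2 * (V (norm x) * \<bar>v x\<bar>))"
    using AE_lebesgue_neq_0
  proof eventually_elim
    fix x :: "real^'n" assume "x \<noteq> 0"
    then have V0: "V (norm x) \<ge> 0" by (intro V_nonneg) simp
    show "\<forall>s. 0 \<le> s \<longrightarrow> s \<le> 1 \<longrightarrow> \<bar>P s x - P 0 x\<bar> \<le> s * (2 * (V (norm x) * \<bar>v x\<bar>))"
    proof (intro allI impI)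
      fix s :: real assume s: "0 \<le> s"
      have "\<bar>P s x - P 0 x\<bar> = V (norm x) * \<bar>(dual_f (u x + s * v x))\<^sup>2 - (dual_f (u x))\<^sup>2\<bar>"
        using V0 by (simp add: P_def abs_mult right_diff_distrib[symmetric])
      also have "\<dots> \<le> V (norm x) * (2 * \<bar>(u x + s * v x) - u x\<bar>)"
        by (rule mult_left_mono[OF dual_f_sq_Lipschitz V0])
      also have "\<dots> = s * (2 * (V (norm x) * \<bar>v x\<bar>))" using s by (simp add: abs_mult)
      finally show "\<bar>P s x - P 0 x\<bar> \<le> s * (2 * (V (norm x) * \<bar>v x\<bar>))" .
    qed
  qed
  have P'm: "P' \<in> borel_measurable lebesgue" unfolding P'_def w_def by measurable
  have Pq: "integrable lebesgue P'" "(\<lambda>n. ((LINT x|lebesgue. P (t n) x) - (LINT x|lebesgue. P 0 x)) / t n) \<longlonglongrightarrow> (LINT x|lebesgue. P' x)"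
    using dominated_difference_quotients[OF t Pi AE_I2[where P="\<lambda>x. ((\<lambda>s. P s x) has_real_derivative P' x) (at 0)", OF Pd] Pb
        integrable_mult_right[OF Ev(3)] P'm] by auto
  have P'e: "P' = (\<lambda>x. 2 * (V (norm x) * w x * h x))" by (simp add: P'_def fun_eq_iff)
  show "integrable lebesgue (\<lambda>x. V (norm x) * w x * h x)" using Pq(1) unfolding P'e by simp

  \<comment> \<open>The nonlinear term along the ray. All values of \<open>f\<close> on the ray up to parameter \<open>1\<close> are bounded by \<open>y\<close>.\<close>
  define y where "y x = \<bar>dual_f (u x)\<bar> + \<bar>v x\<bar>" for x
  define D where "D x = C * (K (norm x) * min (y x powr q1) (y x powr q2))" for x
  have Di: "integrable lebesgue D"
    using integrable_mult_right[OF weighted_powers_integrable[OF N V_cont V_nonneg V_bound K_cont K_pos R q S0 Sinf uE h], of C]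
    by (simp add: D_def[abs_def] y_def v_def)
  have f_y: "\<bar>dual_f (u x + s * v x)\<bar> \<le> y x" if "0 \<le> s" "s \<le> 1" for s x
  proof -
    have "\<bar>dual_f (u x + s * v x) - dual_f (u x)\<bar> \<le> \<bar>s * v x\<bar>" using dual_f_Lipschitz[of "u x + s * v x" "u x"] by simp
    also have "\<dots> \<le> 1 * \<bar>v x\<bar>" unfolding abs_mult using that by (intro mult_right_mono) auto
    finally show ?thesis unfolding y_def by linarith
  qed
  define Q where "Q s x = K (norm x) * G (dual_f (u x + s * v x))" for s x
  define Q' where "Q' x = K (norm x) * g (w x) * h x" for x
  have Qi: "integrable lebesgue (Q s)" if s: "0 \<le> s" "s \<le> 1" for s
  proof (rule integrable_lebesgue_bound[OF Di])
    show "Q s \<in> borel_measurable lebesgue" unfolding Q_def by measurable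
    fix x :: "real^'n" assume "x \<noteq> 0"
    then have K0: "K (norm x) > 0" by (intro K_pos) simp
    have "norm (Q s x) = K (norm x) * \<bar>G (dual_f (u x + s * v x))\<bar>" using K0 by (simp add: Q_def abs_mult)
    also have "\<dots> \<le> K (norm x) * (C * min (y x powr q1) (y x powr q2))"
      using K0 G_le[OF f_y[OF s]] by (intro mult_left_mono) auto
    also have "\<dots> = D x" by (simp add: D_def)
    finally show "norm (Q s x) \<le> D x" .
  qed
  have Q_ray: "((\<lambda>s. Q s x) has_real_derivative K (norm x) * (g (dual_f (u x + s * v x)) * (1 / dual_w (u x + s * v x) * v x))) (at s)" for x s
    unfolding Q_def by (intro DERIV_cmult DERIV_chain2[where f=G, OF G_DERIV f_ray])
  have Qd: "((\<lambda>s. Q s x) has_real_derivative Q' x) (at 0)" for x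
    using Q_ray[of x 0] by (rule DERIV_cong) (simp add: Q'_def w_def v_def dual_w_pos[THEN less_imp_neq, symmetric])
  have Qb: "AE x in lebesgue. \<forall>s. 0 \<le> s \<longrightarrow> s \<le> 1 \<longrightarrow> \<bar>Q s x - Q 0 x\<bar> \<le> s * D x"
    using AE_lebesgue_neq_0
  proof eventually_elim
    fix x :: "real^'n" assume "x \<noteq> 0"
    then have K0: "K (norm x) > 0" by (intro K_pos) simp
    show "\<forall>s. 0 \<le> s \<longrightarrow> s \<le> 1 \<longrightarrow> \<bar>Q s x - Q 0 x\<bar> \<le> s * D x"
    proof (intro allI impI)
      fix s :: real assume s: "0 \<le> s" "s \<le> 1"
      have "norm (Q s x - Q 0 x) \<le> D x * norm (s - 0)"
      proof (rule field_differentiable_bound[where S="{0..1}" and f="\<lambda>s. Q s x"])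
        fix s :: real assume "s \<in> {0..1}"
        then have s: "0 \<le> s" "s \<le> 1" by auto
        show "((\<lambda>s. Q s x) has_field_derivative K (norm x) * (g (dual_f (u x + s * v x)) * (1 / dual_w (u x + s * v x) * v x))) (at s within {0..1})"
          by (rule has_field_derivative_at_within[OF Q_ray])
        have "\<bar>1 / dual_w (u x + s * v x) * v x\<bar> \<le> 1 * y x"
          unfolding abs_mult using inverse_dual_w_bounds[of "u x + s * v x"] by (intro mult_mono) (auto simp: y_def)
        then have "\<bar>g (dual_f (u x + s * v x))\<bar> * \<bar>1 / dual_w (u x + s * v x) * v x\<bar> \<le> \<bar>g (dual_f (u x + s * v x))\<bar> * y x"
          by (intro mult_left_mono) auto
        also have "\<dots> \<le> C * min (y x powr q1) (y x powr q2)" by (rule g_le[OF f_y[OF s]])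
        finally have "K (norm x) * (\<bar>g (dual_f (u x + s * v x))\<bar> * \<bar>1 / dual_w (u x + s * v x) * v x\<bar>) \<le> K (norm x) * (C * min (y x powr q1) (y x powr q2))"
          using K0 by (intro mult_left_mono) auto
        then show "norm (K (norm x) * (g (dual_f (u x + s * v x)) * (1 / dual_w (u x + s * v x) * v x))) \<le> D x"
          using K0 by (simp only: real_norm_def abs_mult abs_of_pos D_def mult.left_commute[of C])
      qed (use s in auto)
      then show "\<bar>Q s x - Q 0 x\<bar> \<le> s * D x" using s by (simp add: mult.commute)
    qed
  qed
  have Q'm: "Q' \<in> borel_measurable lebesgue" unfolding Q'_def w_def by measurable
  have Qq: "integrable lebesgue Q'" "(\<lambda>n. ((LINT x|lebesgue. Q (t n) x) - (LINT x|lebesgue. Q 0 x)) / t n) \<longlonglongrightarrow> (LINT x|lebesgue. Q' x)"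
    using dominated_difference_quotients[OF t Qi AE_I2[where P="\<lambda>x. ((\<lambda>s. Q s x) has_real_derivative Q' x) (at 0)", OF Qd] Qb Di Q'm] by auto
  then show "integrable lebesgue (\<lambda>x. K (norm x) * g (w x) * h x)" by (simp add: Q'_def[abs_def])

  \<comment> \<open>The gradient term is a quadratic polynomial in the parameter.\<close>
  define E where "E s = (LINT x|lebesgue. (norm (U x + s *\<^sub>R W x))\<^sup>2)" for s
  have Eq: "(\<lambda>n. (E (t n) - E 0) / t n) \<longlonglongrightarrow> 2 * (LINT x|lebesgue. U x \<bullet> W x)"
  proof -
    have Ee: "E s = (LINT x|lebesgue. (norm (U x))\<^sup>2) + 2 * s * (LINT x|lebesgue. U x \<bullet> W x) + s\<^sup>2 * (LINT x|lebesgue. (norm (W x))\<^sup>2)" for s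
    proof -
      have *: "a + s * b + s * (b + s * c) = a + 2 * s * b + s\<^sup>2 * c" for a b c :: real
        by (simp add: algebra_simps power2_eq_square)
      have "(norm (U x + s *\<^sub>R W x))\<^sup>2 = (norm (U x))\<^sup>2 + 2 * s * (U x \<bullet> W x) + s\<^sup>2 * (norm (W x))\<^sup>2" for x
        by (simp only: power2_norm_eq_inner inner_add_left inner_add_right inner_scaleR_left inner_scaleR_right
              inner_commute[of "W x" "U x"]) (rule *)
      then have "E s = (LINT x|lebesgue. (norm (U x))\<^sup>2 + 2 * s * (U x \<bullet> W x) + s\<^sup>2 * (norm (W x))\<^sup>2)"
        unfolding E_def by simp
      also have "\<dots> = (LINT x|lebesgue. (norm (U x))\<^sup>2) + 2 * s * (LINT x|lebesgue. U x \<bullet> W x) + s\<^sup>2 * (LINT x|lebesgue. (norm (W x))\<^sup>2)"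
        using Tv(3,4) UWi by simp
      finally show ?thesis .
    qed
    have "(E (t n) - E 0) / t n = 2 * (LINT x|lebesgue. U x \<bullet> W x) + t n * (LINT x|lebesgue. (norm (W x))\<^sup>2)" for n
      unfolding Ee using t(1)[of n] by (simp add: field_simps power2_eq_square)
    moreover have "(\<lambda>n. 2 * (LINT x|lebesgue. U x \<bullet> W x) + t n * (LINT x|lebesgue. (norm (W x))\<^sup>2))
      \<longlonglongrightarrow> 2 * (LINT x|lebesgue. U x \<bullet> W x) + 0 * (LINT x|lebesgue. (norm (W x))\<^sup>2)"
      by (intro tendsto_intros t(3))
    ultimately show ?thesis by simp
  qed
  have Ie: "functional_I V K G (\<lambda>x. u x + s * v x) = 1 / 2 * E s + 1 / 2 * (LINT x|lebesgue. P s x) - (LINT x|lebesgue. Q s x)" for s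
    unfolding functional_I_def norm12_eq(2)[OF has_weak_gradient_add[OF U has_weak_gradient_cmult[OF Tv(2)]]]
    by (simp add: E_def P_def Q_def)
  have Ie0: "functional_I V K G u = 1 / 2 * E 0 + 1 / 2 * (LINT x|lebesgue. P 0 x) - (LINT x|lebesgue. Q 0 x)"
    using Ie[of 0] by simp
  have "(functional_I V K G (\<lambda>x. u x + t n * v x) - functional_I V K G u) / t n
    = 1 / 2 * ((E (t n) - E 0) / t n) + 1 / 2 * (((LINT x|lebesgue. P (t n) x) - (LINT x|lebesgue. P 0 x)) / t n)
      - ((LINT x|lebesgue. Q (t n) x) - (LINT x|lebesgue. Q 0 x)) / t n" for n
    unfolding Ie Ie0 by (simp add: diff_divide_distrib add_divide_distrib)
  moreover have "(\<lambda>n. 1 / 2 * ((E (t n) - E 0) / t n) + 1 / 2 * (((LINT x|lebesgue. P (t n) x) - (LINT x|lebesgue. P 0 x)) / t n)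
      - ((LINT x|lebesgue. Q (t n) x) - (LINT x|lebesgue. Q 0 x)) / t n)
    \<longlonglongrightarrow> 1 / 2 * (2 * (LINT x|lebesgue. U x \<bullet> W x)) + 1 / 2 * (LINT x|lebesgue. P' x) - (LINT x|lebesgue. Q' x)"
    by (intro tendsto_diff tendsto_add tendsto_mult tendsto_const Eq Pq(2) Qq(2))
  ultimately have lim: "(\<lambda>n. (functional_I V K G (\<lambda>x. u x + t n * v x) - functional_I V K G u) / t n)
    \<longlonglongrightarrow> 1 / 2 * (2 * (LINT x|lebesgue. U x \<bullet> W x)) + 1 / 2 * (LINT x|lebesgue. P' x) - (LINT x|lebesgue. Q' x)"
    by (simp only:)
  have "1 / 2 * (2 * (LINT x|lebesgue. U x \<bullet> W x)) + 1 / 2 * (LINT x|lebesgue. P' x) - (LINT x|lebesgue. Q' x) = 0"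
    by (rule critical_point_derivative_zero[OF crit V_cont V_nonneg Ev(1) t(1) t(3) lim])
  then have "(LINT x|lebesgue. U x \<bullet> W x) + 1 / 2 * (LINT x|lebesgue. P' x) = (LINT x|lebesgue. Q' x)" by simp
  moreover have "1 / 2 * (LINT x|lebesgue. P' x) = (LINT x|lebesgue. V (norm x) * w x * h x)"
    unfolding P'e by simp
  ultimately show "(LINT x|lebesgue. (1 + 2 * (w x)\<^sup>2) * (wgrad w x \<bullet> grad h x))
      + (LINT x|lebesgue. 2 * w x * (norm (wgrad w x))\<^sup>2 * h x)
      + (LINT x|lebesgue. V (norm x) * w x * h x)
      = (LINT x|lebesgue. K (norm x) * g (w x) * h x)"
    unfolding I12 J1 J2 by (simp add: Q'_def[abs_def])
qed

end
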